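(* Let $\kappa$ be a positive definite kernel on $X$, $\mathbf A=(A_i)_{i\in I}$ an $(I^+,I^-)$-condenser, and $\mathbf f$, $\mathbf a$, $\mathbf g$ as in the context. Suppose that an equilibrium measure exists, i.e. $\mathcal G_{\mathbf f}(\mathbf A,\mathbf a,\mathbf g)\ne\varnothing$. Let $\mu\in\mathcal E_{\mathbf f}(\mathbf A,\mathbf a,\mathbf g)$, and suppose there are real numbers $\eta_i$, $i\in I$, such that at least one of the following two pairs of conditions holds: (1) $a_i\,W_\mu^i(x)\ge\eta_i\,g_i(x)$ n.e. in $A_i$ for all $i\in I$, and $G_{\mathbf f}(\mu)\le\sum_{i\in I}\eta_i+\langle\mathbf f,\mu\rangle$; (2) $a_i\,W_\mu^i(x)\le\eta_i\,g_i(x)$ $\mu^i$-a.e. in $X$ for all $i\in I$, and $G_{\mathbf f}(\mathbf A,\mathbf a,\mathbf g)\ge\sum_{i\in I}\eta_i+\langle\mathbf f,\mu\rangle$. Then $\mu\in\mathcal G_{\mathbf f}(\mathbf A,\mathbf a,\mathbf g)$ and $$\eta_i=\bigl\langle W_\mu^i,\mu^i\bigr\rangle\quad\text{for all }i\in I.$$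
   Context: Let $X$ be a locally compact Hausdorff space and $\mathfrak M$ the space of real-valued (signed) Radon measures on $X$. For a locally compact space $Y$, $\Phi(Y)$ is the set of lower semicontinuous $\psi:Y\to(-\infty,\infty]$, with $\psi\ge0$ required unless $Y$ is compact. Write $\langle u,\nu\rangle:=\int u\,d\nu$. A kernel is an element $\kappa\in\Phi(X\times X)$; $\kappa(\nu,\nu_1):=\int\kappa\,d(\nu\otimes\nu_1)$ and $\kappa(x,\nu):=\int\kappa(x,y)\,d\nu(y)$ whenever well defined. $\kappa$ is positive definite if it is symmetric and $\kappa(\nu,\nu)\ge0$ for every $\nu\in\mathfrak M$ for which it is defined. Then $\mathcal E:=\{\nu\in\mathfrak M:-\infty<\kappa(\nu,\nu)<\infty\}$ is a pre-Hilbert space with scalar product $\kappa(\nu,\nu_1)$ and seminorm $\|\nu\|:=\sqrt{\kappa(\nu,\nu)}$. $\mathfrak M^+(E)$ is the set of nonnegative measures supported by the closed set $E$; $\mathcal E^+:=\mathfrak M^+(X)\cap\mathcal E$. The interior capacity of $E\subset X$ is $C(E):=[\inf\|\nu\|^2]^{-1}$, the infimum over $\nu\in\mathcal E^+$ with $\nu(X)=1$ and compact support contained in $E$ ($\inf\varnothing=\infty$, $1/\infty=0$, $1/0=\infty$). A property holds nearly everywhere (n.e.) in $E$ if the set of $x\in E$ where it fails has interior capacity zero. $I^+$, $I^-$ are disjoint countable (finite or infinite) sets of indices in $\mathbb N$, $I^-$ possibly empty, $I=I^+\cup I^-$; $\alpha_i=+1$ for $i\in I^+$ and $\alpha_i=-1$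 for $i\in I^-$. An $(I^+,I^-)$-condenser is a family $\mathbf A=(A_i)_{i\in I}$ of nonempty closed sets in $X$ such that every compact set meets at most finitely many $A_i$ and $A_i\cap A_j=\varnothing$ for $i\in I^+$, $j\in I^-$. $\mathfrak M(\mathbf A):=\prod_{i\in I}\mathfrak M^+(A_i)$ consists of vector measures $\mu=(\mu^i)_{i\in I}$. Put $\kappa(\mu,\mu_1):=\sum_{i,j\in I}\alpha_i\alpha_j\kappa(\mu^i,\mu_1^j)$ and $\kappa_\mu=(\kappa^i_\mu)_{i\in I}$ with $\kappa_\mu^i(x):=\sum_{j\in I}\alpha_i\alpha_j\kappa(x,\mu^j)$. $\mathcal E(\mathbf A)$ is the set of $\mu\in\mathfrak M(\mathbf A)$ with $\kappa(\mu,\mu)$ finite (absolute convergence). External field: $\mathbf f=(f_i)_{i\in I}$, where for each $i$ there are $f_{i1},f_{i2}\in\Phi(X)$ with $f_{i2}\ne\infty$ n.e. in $X$ and $f_i=f_{i1}-f_{i2}$ (defined exactly where the right side is). $\mathbf g=(g_i)_{i\in I}$ with $g_i:A_i\to(0,\infty)$ continuous; $\mathbf a=(a_i)_{i\in I}$ with $a_i>0$. $\langle\mathbf f,\mu\rangle:=\sum_{i\in I}\langle f_i,\mu^i\rangle$ (finite iff the series converges absolutely). $\mathbf W_\mu=(W^i_\mu)_{i\in I}:=\kappa_\mu+\mathbf f$ (for $\mu\in\mathcal E(\mathbf A)$ it is defined and $\ne-\infty$ n.e. in $X$) and $G_{\mathbf f}(\mu):=\kappa(\mu,\mu)+2\langle\mathbf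 f,\mu\rangle$. $\mathcal E_{\mathbf f}(\mathbf A,\mathbf a,\mathbf g)$ is the set of $\mu\in\mathcal E(\mathbf A)$ with $\langle g_i,\mu^i\rangle=a_i$ for all $i\in I$ and $\langle\mathbf f,\mu\rangle$ finite. $G_{\mathbf f}(\mathbf A,\mathbf a,\mathbf g):=\inf_{\mu\in\mathcal E_{\mathbf f}(\mathbf A,\mathbf a,\mathbf g)}G_{\mathbf f}(\mu)$ ($\inf\varnothing=+\infty$). $\mathcal G_{\mathbf f}(\mathbf A,\mathbf a,\mathbf g)$ is the set of $\lambda\in\mathcal E_{\mathbf f}(\mathbf A,\mathbf a,\mathbf g)$ with $G_{\mathbf f}(\lambda)=G_{\mathbf f}(\mathbf A,\mathbf a,\mathbf g)$ (equilibrium measures). The sums $\sum_{i\in I}\eta_i$ are tacitly assumed well defined. *)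

theory Defs
  imports "HOL-Analysis.Analysis"
begin

section \<open>Extended-real integrals and sums\<close>

text \<open>
  The integral of an extended-real function is the difference of the integrals of its positive
  and negative parts. It is well defined when these are not both infinite (the junk value is
  irrelevant then), and finite when both are finite. Sums over an index set are integrals with
  respect to the counting measure; a sum is thus finite iff it converges absolutely.
\<close>

definition ext_integral :: "'a measure \<Rightarrow> ('a \<Rightarrow> ereal) \<Rightarrow> ereal" where
  "ext_integral M u =
     enn2ereal (\<integral>\<^sup>+x. e2ennreal (u x) \<partial>M) - enn2ereal (\<integral>\<^sup>+x. e2ennreal (- u x) \<partial>M)"

definition ext_integral_defined :: "'a measure \<Rightarrow> ('a \<Rightarrow> ereal) \<Rightarrow> bool" where
  "ext_integral_defined M u \<longleftrightarrow> u \<in> borel_measurable M \<and>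
     \<not> ((\<integral>\<^sup>+x. e2ennreal (u x) \<partial>M) = \<infinity> \<and> (\<integral>\<^sup>+x. e2ennreal (- u x) \<partial>M) = \<infinity>)"

definition ext_integral_finite :: "'a measure \<Rightarrow> ('a \<Rightarrow> ereal) \<Rightarrow> bool" where
  "ext_integral_finite M u \<longleftrightarrow> u \<in> borel_measurable M \<and>
     (\<integral>\<^sup>+x. e2ennreal (u x) \<partial>M) < \<infinity> \<and> (\<integral>\<^sup>+x. e2ennreal (- u x) \<partial>M) < \<infinity>"

abbreviation ext_sum :: "'i set \<Rightarrow> ('i \<Rightarrow> ereal) \<Rightarrow> ereal" where
  "ext_sum I t \<equiv> ext_integral (count_space I) t"

abbreviation ext_sum_defined :: "'i set \<Rightarrow> ('i \<Rightarrow> ereal) \<Rightarrow> bool" where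
  "ext_sum_defined I t \<equiv> ext_integral_defined (count_space I) t"

abbreviation ext_sum_finite :: "'i set \<Rightarrow> ('i \<Rightarrow> ereal) \<Rightarrow> bool" where
  "ext_sum_finite I t \<equiv> ext_integral_finite (count_space I) t"

section \<open>Lower semicontinuous functions and Radon measures\<close>

definition lower_semicontinuous :: "('a::topological_space \<Rightarrow> ereal) \<Rightarrow> bool" where
  "lower_semicontinuous u \<longleftrightarrow> (\<forall>c. open {x. c < u x})"

definition Phi :: "('a::topological_space \<Rightarrow> ereal) set" where
  "Phi = {u. lower_semicontinuous u \<and> (\<forall>x. u x \<noteq> -\<infinity>) \<and>
             (compact (UNIV :: 'a set) \<or> (\<forall>x. 0 \<le> u x))}"

text \<open>
  Nonnegative Radon measures, as Borel measures that are finite on compact sets and inner regular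
  on all Borel sets. On a locally compact Hausdorff space they correspond bijectively to the
  positive linear functionals on the continuous functions of compact support.
\<close>

definition radon :: "'a::topological_space measure \<Rightarrow> bool" where
  "radon M \<longleftrightarrow> sets M = sets borel \<and>
     (\<forall>K. compact K \<longrightarrow> emeasure M K < \<infinity>) \<and>
     (\<forall>B \<in> sets borel. emeasure M B = (SUP K \<in> {K. compact K \<and> K \<subseteq> B}. emeasure M K))"

definition msupport :: "'a::topological_space measure \<Rightarrow> 'a set" where
  "msupport M = {x. \<forall>U. open U \<and> x \<in> U \<longrightarrow> emeasure M U > 0}"

definition Mplus :: "'a::topological_space set \<Rightarrow> 'a measure set" where
  "Mplus E = {M. radon M \<and> msupport M \<subseteq> E}"

text \<open>
  The tensor product of two Radon measures. The library's \<open>\<Otimes>\<^sub>M\<close> is not suitable: without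
  second countability its \<open>\<sigma>\<close>-algebra may be smaller than the Borel sets of the product space, and
  lower semicontinuous kernels need not be measurable for it. On locally compact Hausdorff spaces
  the Radon measure described here exists and is unique.
\<close>

definition radon_prod ::
    "'a::topological_space measure \<Rightarrow> 'b::topological_space measure \<Rightarrow> ('a \<times> 'b) measure" where
  "radon_prod M N = (THE R. radon R \<and>
     (\<forall>K L. compact K \<and> compact L \<longrightarrow> emeasure R (K \<times> L) = emeasure M K * emeasure N L))"

text \<open>
  A real-valued Radon measure \<open>\<nu>\<close> is given by its Jordan decomposition \<open>(\<nu>\<^sup>+, \<nu>\<^sup>-)\<close>, a pair of
  mutually singular nonnegative Radon measures. Singularity is required on compact sets only:
  both parts may be infinite and not \<open>\<sigma>\<close>-finite, and then a global Borel Hahn set is not guaranteed.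
\<close>

definition signed_radon :: "('a::topological_space measure \<times> 'a measure) set" where
  "signed_radon = {(P, N). radon P \<and> radon N \<and>
     (\<forall>K. compact K \<longrightarrow>
        (\<exists>B \<in> sets borel. emeasure P (K \<inter> B) = 0 \<and> emeasure N (K - B) = 0))}"

section \<open>Kernels, energies and potentials\<close>

type_synonym 'a kernel = "'a \<times> 'a \<Rightarrow> ereal"

text \<open>
  For nonnegative Radon measures and a kernel in \<open>Phi\<close> on a locally compact Hausdorff space, mutual
  energies and potentials are always well defined and never \<open>-\<infinity>\<close>.
\<close>

definition mutual_energy ::
    "'a::topological_space kernel \<Rightarrow> 'a measure \<Rightarrow> 'a measure \<Rightarrow> ereal" where
  "mutual_energy \<kappa> M N = ext_integral (radon_prod M N) \<kappa>"

definition potential :: "'a::topological_space kernel \<Rightarrow> 'a measure \<Rightarrow> 'a \<Rightarrow> ereal" where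
  "potential \<kappa> M x = ext_integral M (\<lambda>y. \<kappa> (x, y))"

text \<open>
  The energy of a signed measure integrates \<open>\<kappa>\<close> over \<open>\<nu> \<otimes> \<nu>\<close>, whose positive part is
  \<open>\<nu>\<^sup>+ \<otimes> \<nu>\<^sup>+ + \<nu>\<^sup>- \<otimes> \<nu>\<^sup>-\<close> and whose negative part is \<open>\<nu>\<^sup>+ \<otimes> \<nu>\<^sup>- + \<nu>\<^sup>- \<otimes> \<nu>\<^sup>+\<close>.
\<close>

definition signed_energy_defined ::
    "'a::topological_space kernel \<Rightarrow> 'a measure \<times> 'a measure \<Rightarrow> bool" where
  "signed_energy_defined \<kappa> \<nu> \<longleftrightarrow> (case \<nu> of (P, N) \<Rightarrow>
     \<not> (mutual_energy \<kappa> P P + mutual_energy \<kappa> N N = \<infinity> \<and>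
        mutual_energy \<kappa> P N + mutual_energy \<kappa> N P = \<infinity>))"

definition signed_energy ::
    "'a::topological_space kernel \<Rightarrow> 'a measure \<times> 'a measure \<Rightarrow> ereal" where
  "signed_energy \<kappa> \<nu> = (case \<nu> of (P, N) \<Rightarrow>
     (mutual_energy \<kappa> P P + mutual_energy \<kappa> N N) -
     (mutual_energy \<kappa> P N + mutual_energy \<kappa> N P))"

definition positive_definite :: "'a::topological_space kernel \<Rightarrow> bool" where
  "positive_definite \<kappa> \<longleftrightarrow> (\<forall>x y. \<kappa> (x, y) = \<kappa> (y, x)) \<and>
     (\<forall>\<nu> \<in> signed_radon. signed_energy_defined \<kappa> \<nu> \<longrightarrow> 0 \<le> signed_energy \<kappa> \<nu>)"

definition Eplus :: "'a::topological_space kernel \<Rightarrow> 'a measure set" where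
  "Eplus \<kappa> = {M \<in> Mplus UNIV. -\<infinity> < mutual_energy \<kappa> M M \<and> mutual_energy \<kappa> M M < \<infinity>}"

text \<open>
  In \<^typ>\<open>ereal\<close> the infimum over the empty set is \<open>\<infinity>\<close>, \<open>inverse \<infinity> = 0\<close> and \<open>inverse 0 = \<infinity>\<close>.
\<close>

definition interior_capacity :: "'a::topological_space kernel \<Rightarrow> 'a set \<Rightarrow> ereal" where
  "interior_capacity \<kappa> E = inverse
     (INF M \<in> {M \<in> Eplus \<kappa>. emeasure M UNIV = 1 \<and> compact (msupport M) \<and> msupport M \<subseteq> E}.
        mutual_energy \<kappa> M M)"

definition nearly_everywhere ::
    "'a::topological_space kernel \<Rightarrow> 'a set \<Rightarrow> ('a \<Rightarrow> bool) \<Rightarrow> bool" where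
  "nearly_everywhere \<kappa> E Q \<longleftrightarrow> interior_capacity \<kappa> {x \<in> E. \<not> Q x} = 0"

section \<open>Condensers and vector measures\<close>

definition condenser :: "nat set \<Rightarrow> nat set \<Rightarrow> (nat \<Rightarrow> 'a::topological_space set) \<Rightarrow> bool" where
  "condenser Ip In A \<longleftrightarrow> Ip \<inter> In = {} \<and> Ip \<noteq> {} \<and>
     (\<forall>i \<in> Ip \<union> In. closed (A i) \<and> A i \<noteq> {}) \<and>
     (\<forall>K. compact K \<longrightarrow> finite {i \<in> Ip \<union> In. A i \<inter> K \<noteq> {}}) \<and>
     (\<forall>i \<in> Ip. \<forall>j \<in> In. A i \<inter> A j = {})"

definition plate_sign :: "nat set \<Rightarrow> nat \<Rightarrow> ereal" where
  "plate_sign Ip i = (if i \<in> Ip then 1 else - 1)"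

definition vec_measures ::
    "nat set \<Rightarrow> nat set \<Rightarrow> (nat \<Rightarrow> 'a::topological_space set) \<Rightarrow> (nat \<Rightarrow> 'a measure) set" where
  "vec_measures Ip In A = (\<Pi> i \<in> Ip \<union> In. Mplus (A i))"

definition vec_energy_term ::
    "'a::topological_space kernel \<Rightarrow> nat set \<Rightarrow> (nat \<Rightarrow> 'a measure) \<Rightarrow> (nat \<Rightarrow> 'a measure) \<Rightarrow>
     nat \<times> nat \<Rightarrow> ereal" where
  "vec_energy_term \<kappa> Ip \<mu> \<mu>1 =
     (\<lambda>(i, j). plate_sign Ip i * plate_sign Ip j * mutual_energy \<kappa> (\<mu> i) (\<mu>1 j))"

definition vec_energy ::
    "'a::topological_space kernel \<Rightarrow> nat set \<Rightarrow> nat set \<Rightarrow>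
     (nat \<Rightarrow> 'a measure) \<Rightarrow> (nat \<Rightarrow> 'a measure) \<Rightarrow> ereal" where
  "vec_energy \<kappa> Ip In \<mu> \<mu>1 =
     ext_sum ((Ip \<union> In) \<times> (Ip \<union> In)) (vec_energy_term \<kappa> Ip \<mu> \<mu>1)"

definition vec_finite_energy ::
    "'a::topological_space kernel \<Rightarrow> nat set \<Rightarrow> nat set \<Rightarrow> (nat \<Rightarrow> 'a set) \<Rightarrow>
     (nat \<Rightarrow> 'a measure) set" where
  "vec_finite_energy \<kappa> Ip In A = {\<mu> \<in> vec_measures Ip In A.
     ext_sum_finite ((Ip \<union> In) \<times> (Ip \<union> In)) (vec_energy_term \<kappa> Ip \<mu> \<mu>)}"

definition vec_potential_term ::
    "'a::topological_space kernel \<Rightarrow> nat set \<Rightarrow> (nat \<Rightarrow> 'a measure) \<Rightarrow> nat \<Rightarrow> 'a \<Rightarrow> nat \<Rightarrow> ereal" where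
  "vec_potential_term \<kappa> Ip \<mu> i x j =
     plate_sign Ip i * plate_sign Ip j * potential \<kappa> (\<mu> j) x"

definition vec_potential ::
    "'a::topological_space kernel \<Rightarrow> nat set \<Rightarrow> nat set \<Rightarrow> (nat \<Rightarrow> 'a measure) \<Rightarrow>
     nat \<Rightarrow> 'a \<Rightarrow> ereal" where
  "vec_potential \<kappa> Ip In \<mu> i x = ext_sum (Ip \<union> In) (vec_potential_term \<kappa> Ip \<mu> i x)"

definition vec_potential_defined ::
    "'a::topological_space kernel \<Rightarrow> nat set \<Rightarrow> nat set \<Rightarrow> (nat \<Rightarrow> 'a measure) \<Rightarrow>
     nat \<Rightarrow> 'a \<Rightarrow> bool" where
  "vec_potential_defined \<kappa> Ip In \<mu> i x \<longleftrightarrow>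
     ext_sum_defined (Ip \<union> In) (vec_potential_term \<kappa> Ip \<mu> i x)"

section \<open>External fields and the minimum problem\<close>

text \<open>
  The field \<open>f i = f1 i - f2 i\<close> is a partial function. It is undefined exactly where both terms
  are \<open>\<infinity>\<close>; the functions in \<open>Phi\<close> do not take the value \<open>-\<infinity>\<close>.
\<close>

definition external_field ::
    "'a::topological_space kernel \<Rightarrow> nat set \<Rightarrow> (nat \<Rightarrow> 'a \<Rightarrow> ereal) \<Rightarrow> (nat \<Rightarrow> 'a \<Rightarrow> ereal) \<Rightarrow> bool"
  where
  "external_field \<kappa> I f1 f2 \<longleftrightarrow>
     (\<forall>i \<in> I. f1 i \<in> Phi \<and> f2 i \<in> Phi \<and> nearly_everywhere \<kappa> UNIV (\<lambda>x. f2 i x \<noteq> \<infinity>))"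

definition field_fun :: "(nat \<Rightarrow> 'a \<Rightarrow> ereal) \<Rightarrow> (nat \<Rightarrow> 'a \<Rightarrow> ereal) \<Rightarrow> nat \<Rightarrow> 'a \<Rightarrow> ereal" where
  "field_fun f1 f2 i x = f1 i x - f2 i x"

definition field_defined ::
    "(nat \<Rightarrow> 'a \<Rightarrow> ereal) \<Rightarrow> (nat \<Rightarrow> 'a \<Rightarrow> ereal) \<Rightarrow> nat \<Rightarrow> 'a \<Rightarrow> bool" where
  "field_defined f1 f2 i x \<longleftrightarrow> \<not> (f1 i x = \<infinity> \<and> f2 i x = \<infinity>)"

text \<open>\<open>\<langle>u, M\<rangle>\<close> for a function \<open>u\<close> that is only defined at the points satisfying \<open>D\<close>.\<close>

definition pairing_defined :: "('a \<Rightarrow> bool) \<Rightarrow> ('a \<Rightarrow> ereal) \<Rightarrow> 'a measure \<Rightarrow> bool" where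
  "pairing_defined D u M \<longleftrightarrow> (AE x in M. D x) \<and> ext_integral_defined M u"

definition field_pairing ::
    "nat set \<Rightarrow> (nat \<Rightarrow> 'a \<Rightarrow> ereal) \<Rightarrow> (nat \<Rightarrow> 'a \<Rightarrow> ereal) \<Rightarrow> (nat \<Rightarrow> 'a measure) \<Rightarrow> ereal" where
  "field_pairing I f1 f2 \<mu> = ext_sum I (\<lambda>i. ext_integral (\<mu> i) (field_fun f1 f2 i))"

definition field_pairing_finite ::
    "nat set \<Rightarrow> (nat \<Rightarrow> 'a \<Rightarrow> ereal) \<Rightarrow> (nat \<Rightarrow> 'a \<Rightarrow> ereal) \<Rightarrow> (nat \<Rightarrow> 'a measure) \<Rightarrow> bool" where
  "field_pairing_finite I f1 f2 \<mu> \<longleftrightarrow>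
     (\<forall>i \<in> I. pairing_defined (field_defined f1 f2 i) (field_fun f1 f2 i) (\<mu> i)) \<and>
     ext_sum_finite I (\<lambda>i. ext_integral (\<mu> i) (field_fun f1 f2 i))"

definition weighted_potential ::
    "'a::topological_space kernel \<Rightarrow> nat set \<Rightarrow> nat set \<Rightarrow> (nat \<Rightarrow> 'a \<Rightarrow> ereal) \<Rightarrow>
     (nat \<Rightarrow> 'a \<Rightarrow> ereal) \<Rightarrow> (nat \<Rightarrow> 'a measure) \<Rightarrow> nat \<Rightarrow> 'a \<Rightarrow> ereal" where
  "weighted_potential \<kappa> Ip In f1 f2 \<mu> i x = vec_potential \<kappa> Ip In \<mu> i x + field_fun f1 f2 i x"

definition weighted_potential_defined ::
    "'a::topological_space kernel \<Rightarrow> nat set \<Rightarrow> nat set \<Rightarrow> (nat \<Rightarrow> 'a \<Rightarrow> ereal) \<Rightarrow>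
     (nat \<Rightarrow> 'a \<Rightarrow> ereal) \<Rightarrow> (nat \<Rightarrow> 'a measure) \<Rightarrow> nat \<Rightarrow> 'a \<Rightarrow> bool" where
  "weighted_potential_defined \<kappa> Ip In f1 f2 \<mu> i x \<longleftrightarrow>
     vec_potential_defined \<kappa> Ip In \<mu> i x \<and> field_defined f1 f2 i x \<and>
     \<not> (vec_potential \<kappa> Ip In \<mu> i x = \<infinity> \<and> field_fun f1 f2 i x = -\<infinity>) \<and>
     \<not> (vec_potential \<kappa> Ip In \<mu> i x = -\<infinity> \<and> field_fun f1 f2 i x = \<infinity>)"

definition weighted_energy ::
    "'a::topological_space kernel \<Rightarrow> nat set \<Rightarrow> nat set \<Rightarrow> (nat \<Rightarrow> 'a \<Rightarrow> ereal) \<Rightarrow>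
     (nat \<Rightarrow> 'a \<Rightarrow> ereal) \<Rightarrow> (nat \<Rightarrow> 'a measure) \<Rightarrow> ereal" where
  "weighted_energy \<kappa> Ip In f1 f2 \<mu> =
     vec_energy \<kappa> Ip In \<mu> \<mu> + 2 * field_pairing (Ip \<union> In) f1 f2 \<mu>"

definition admissible ::
    "'a::topological_space kernel \<Rightarrow> nat set \<Rightarrow> nat set \<Rightarrow> (nat \<Rightarrow> 'a \<Rightarrow> ereal) \<Rightarrow>
     (nat \<Rightarrow> 'a \<Rightarrow> ereal) \<Rightarrow> (nat \<Rightarrow> 'a set) \<Rightarrow> (nat \<Rightarrow> real) \<Rightarrow> (nat \<Rightarrow> 'a \<Rightarrow> real) \<Rightarrow>
     (nat \<Rightarrow> 'a measure) set" where
  "admissible \<kappa> Ip In f1 f2 A a g = {\<mu> \<in> vec_finite_energy \<kappa> Ip In A.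
     (\<forall>i \<in> Ip \<union> In. (\<integral>\<^sup>+x \<in> A i. ennreal (g i x) \<partial>\<mu> i) = ennreal (a i)) \<and>
     field_pairing_finite (Ip \<union> In) f1 f2 \<mu>}"

definition min_weighted_energy ::
    "'a::topological_space kernel \<Rightarrow> nat set \<Rightarrow> nat set \<Rightarrow> (nat \<Rightarrow> 'a \<Rightarrow> ereal) \<Rightarrow>
     (nat \<Rightarrow> 'a \<Rightarrow> ereal) \<Rightarrow> (nat \<Rightarrow> 'a set) \<Rightarrow> (nat \<Rightarrow> real) \<Rightarrow> (nat \<Rightarrow> 'a \<Rightarrow> real) \<Rightarrow> ereal" where
  "min_weighted_energy \<kappa> Ip In f1 f2 A a g =
     (INF \<mu> \<in> admissible \<kappa> Ip In f1 f2 A a g. weighted_energy \<kappa> Ip In f1 f2 \<mu>)"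

definition equilibrium_measures ::
    "'a::topological_space kernel \<Rightarrow> nat set \<Rightarrow> nat set \<Rightarrow> (nat \<Rightarrow> 'a \<Rightarrow> ereal) \<Rightarrow>
     (nat \<Rightarrow> 'a \<Rightarrow> ereal) \<Rightarrow> (nat \<Rightarrow> 'a set) \<Rightarrow> (nat \<Rightarrow> real) \<Rightarrow> (nat \<Rightarrow> 'a \<Rightarrow> real) \<Rightarrow>
     (nat \<Rightarrow> 'a measure) set" where
  "equilibrium_measures \<kappa> Ip In f1 f2 A a g = {\<mu> \<in> admissible \<kappa> Ip In f1 f2 A a g.
     weighted_energy \<kappa> Ip In f1 f2 \<mu> = min_weighted_energy \<kappa> Ip In f1 f2 A a g}"

end

theory Submission
  imports Defs
begin

text \<open>
  Write \<open>E(\<nu>, \<mu>)\<close> for the mutual energy of two vector measures and \<open>F(\<nu>)\<close> for the pairing of \<open>\<nu>\<close>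
  with the external field, so that \<open>\<nu>\<close> has weighted energy \<open>E(\<nu>, \<nu>) + 2 F(\<nu>)\<close>. For admissible \<open>\<nu>\<close>
  and \<open>\<mu>\<close>, Tonelli's and Fubini's theorems give the variational identity that the integrals of the
  components of \<open>W\<^sub>\<mu>\<close> against those of \<open>\<nu>\<close> add up to \<open>E(\<nu>, \<mu>) + F(\<nu>)\<close>
  (\<open>weighted_potential_integral\<close>, \<open>potential_mass_sum\<close>), and positive definiteness gives
  \<open>2 E(\<nu>, \<mu>) \<le> E(\<nu>, \<nu>) + E(\<mu>, \<mu>)\<close> (\<open>signed_total_inequality\<close>).

  Suppose the first pair of conditions holds. A measure of finite energy does not charge a Borel set of
  interior capacity zero (\<open>null_if_capacity_zero\<close>), so the lower bound for \<open>W\<^sub>\<mu>\<close> holds almost everywhere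
  for each component of every admissible \<open>\<nu>\<close>; integrated against a component it reads
  \<open>\<eta>\<^sub>i \<le> \<langle>W\<^sub>\<mu>, \<nu>\<rangle>\<^sub>i\<close>. For \<open>\<nu> = \<mu>\<close> the energy condition says that the sum of these inequalities is an
  equality, hence each of them is. For general \<open>\<nu>\<close> the sum then reads
  \<open>E(\<mu>, \<mu>) + F(\<mu>) \<le> E(\<nu>, \<mu>) + F(\<nu>)\<close>, and the inequality above turns this into minimality of \<open>\<mu>\<close>.
  Under the second pair the integrated inequality is \<open>\<langle>W\<^sub>\<mu>, \<mu>\<rangle>\<^sub>i \<le> \<eta>\<^sub>i\<close>; summed, it puts the weighted
  energy of \<open>\<mu>\<close> below the minimum, so again all inequalities are equalities.

  Most of the text justifies these manipulations for measures on a space without a countable base.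
  The Radon product of two \<open>\<sigma>\<close>-finite Radon measures is shown to be their iterated integral
  (\<open>radon_prod_eq\<close>), which makes mutual energies bilinear, symmetric and compatible with potentials;
  components of admissible vector measures are \<open>\<sigma>\<close>-finite because the positive weight \<open>g\<^sub>i\<close> has a finite
  integral. Positive definiteness speaks of mutually singular pairs, whereas the positive and
  negative parts of \<open>\<nu> - \<mu>\<close> overlap; common mass is split off with Radon-Nikodym densities
  (\<open>energy_inequality\<close>), and infinite families of infinite measures are reached by truncation
  (\<open>nonneg_family_energy_inequality\<close>).
\<close>

section \<open>Tightness of Radon measures\<close>

lemma measurable_if_sets_borel: "sets M = sets borel \<Longrightarrow> f \<in> measurable borel L \<Longrightarrow> f \<in> measurable M L"
  using measurable_cong_sets[of M borel L L] by simp

lemma radon_sets: "radon M \<Longrightarrow> sets M = sets borel"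
  by (simp add: radon_def)

lemma radon_space: "radon M \<Longrightarrow> space M = UNIV"
  by (metis radon_sets sets_eq_imp_space_eq space_borel)

lemma radon_compact_finite: "radon M \<Longrightarrow> compact K \<Longrightarrow> emeasure M K < \<infinity>"
  by (simp add: radon_def)

lemma compact_borel: "compact (K :: 'a::t2_space set) \<Longrightarrow> K \<in> sets borel"
  by (simp add: compact_imp_closed)

lemma radon_inner_compact:
  fixes M :: "'a::t2_space measure"
  assumes "radon M" "B \<in> sets borel" "c < emeasure M B"
  obtains K where "compact K" "K \<subseteq> B" "c < emeasure M K"
proof -
  have "emeasure M B = (SUP K \<in> {K. compact K \<and> K \<subseteq> B}. emeasure M K)"
    using assms(1,2) unfolding radon_def by blast
  then have "c < (SUP K \<in> {K. compact K \<and> K \<subseteq> B}. emeasure M K)"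
    using assms(3) by argo
  with that show ?thesis unfolding less_SUP_iff by blast
qed

lemma radonI:
  fixes M :: "'a::t2_space measure"
  assumes M: "sets M = sets borel"
    and fin: "\<And>K. compact K \<Longrightarrow> emeasure M K < \<infinity>"
    and inner: "\<And>B c. B \<in> sets borel \<Longrightarrow> c < emeasure M B \<Longrightarrow>
      \<exists>K. compact K \<and> K \<subseteq> B \<and> c < emeasure M K"
  shows "radon M"
  unfolding radon_def
proof (intro conjI ballI allI impI M fin)
  fix B :: "'a set" assume B: "B \<in> sets borel"
  show "emeasure M B = (SUP K \<in> {K. compact K \<and> K \<subseteq> B}. emeasure M K)" (is "_ = ?s")
  proof (rule antisym)
    show "emeasure M B \<le> ?s"
    proof (rule ccontr)
      assume "\<not> ?thesis"
      then obtain K where K: "compact K" "K \<subseteq> B" and lt: "?s < emeasure M K"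
        using inner[OF B not_le_imp_less] by blast
      have "emeasure M K \<le> ?s" by (rule SUP_upper) (use K in simp)
      with lt show False using leD by blast
    qed
    show "?s \<le> emeasure M B" by (rule SUP_least, rule emeasure_mono) (use B M in auto)
  qed
qed

text \<open>
  Read contrapositively: a compact set of positive measure has a point none of whose neighbourhoods
  meets it in a null set.
\<close>

lemma null_if_locally_null:
  fixes M :: "'a::t2_space measure"
  assumes M: "radon M" and K: "compact K"
    and null: "\<And>x. x \<in> K \<Longrightarrow> \<exists>U. open U \<and> x \<in> U \<and> emeasure M (K \<inter> U) = 0"
  shows "emeasure M K = 0"
proof -
  have "\<exists>U. \<forall>x\<in>K. open (U x) \<and> x \<in> U x \<and> emeasure M (K \<inter> U x) = 0"
    by (rule bchoice, rule ballI, rule null)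
  then obtain U where "\<forall>x\<in>K. open (U x) \<and> x \<in> U x \<and> emeasure M (K \<inter> U x) = 0"
    by (elim exE)
  then have U: "\<And>x. x \<in> K \<Longrightarrow> open (U x)" "\<And>x. x \<in> K \<Longrightarrow> x \<in> U x" "\<And>x. x \<in> K \<Longrightarrow> emeasure M (K \<inter> U x) = 0"
    by simp_all
  have cover: "K \<subseteq> (\<Union>x\<in>K. U x)"
    using U(2) by blast
  obtain F where F: "F \<subseteq> K" "finite F" "K \<subseteq> (\<Union>x\<in>F. U x)"
    by (rule compactE_image[OF K U(1) cover])
  have KU: "K \<inter> U x \<in> sets M" if "x \<in> F" for x
    using sets.Int[OF compact_borel[OF K] borel_open[OF U(1)]] F(1) that radon_sets[OF M] by auto
  have "emeasure M K \<le> emeasure M (\<Union>x\<in>F. K \<inter> U x)"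
  proof (rule emeasure_mono)
    show "(\<Union>x\<in>F. K \<inter> U x) \<in> sets M"
      using KU F(2) by (intro sets.finite_UN)
  qed (use F(3) in blast)
  also have "\<dots> \<le> (\<Sum>x\<in>F. emeasure M (K \<inter> U x))"
    using KU F(2) by (intro emeasure_subadditive_finite) auto
  also have "\<dots> = 0"
    using U(3) F(1) by (intro sum.neutral) blast
  finally show ?thesis by simp
qed

text \<open>
  Tightness, with an additive error, is the form of inner regularity that passes to dominated
  measures, multiples and finite sums.
\<close>

lemma radonI_tight:
  fixes M :: "'a::t2_space measure"
  assumes M: "sets M = sets borel"
    and fin: "\<And>K. compact K \<Longrightarrow> emeasure M K < \<infinity>"
    and tight: "\<And>B e. B \<in> sets borel \<Longrightarrow> 0 < (e::real) \<Longrightarrow>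
      \<exists>K. compact K \<and> K \<subseteq> B \<and> emeasure M (B - K) \<le> ennreal e"
  shows "radon M"
proof (rule radonI[OF M fin])
  fix B :: "'a set" and c assume B: "B \<in> sets borel" and c: "c < emeasure M B"
  show "\<exists>K. compact K \<and> K \<subseteq> B \<and> c < emeasure M K"
  proof (rule ccontr)
    assume *: "\<not> ?thesis"
    have "emeasure M B \<le> c + ennreal e" if "0 < e" for e :: real
    proof -
      obtain K where K: "compact K" "K \<subseteq> B" "emeasure M (B - K) \<le> ennreal e"
        using tight[OF B \<open>0 < e\<close>] by auto
      have "emeasure M B = emeasure M K + emeasure M (B - K)"
        using compact_borel[OF K(1)] K(2) B M by (subst plus_emeasure) (auto simp: Un_absorb1)
      also have "\<dots> \<le> c + ennreal e"
        using K * by (intro add_mono) (auto simp: not_less)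
      finally show ?thesis .
    qed
    then have "emeasure M B \<le> c"
      using ennreal_le_epsilon[of c "emeasure M B"] by blast
    with c show False by (simp add: not_le[symmetric])
  qed
qed

lemma radon_tight:
  fixes M :: "'a::t2_space measure"
  assumes M: "radon M" and B: "B \<in> sets borel" "emeasure M B < \<infinity>" and "0 < (e::real)"
  obtains K where "compact K" "K \<subseteq> B" "emeasure M (B - K) \<le> ennreal e"
proof (cases "emeasure M B = 0")
  case True
  then show ?thesis using that[of "{}"] by simp
next
  case False
  have lt: "emeasure M B - ennreal e < emeasure M B"
    using B False \<open>0 < e\<close> by (intro ennreal_between) (auto simp: zero_less_iff_neq_zero)
  then obtain K where K: "compact K" "K \<subseteq> B" "emeasure M B - ennreal e < emeasure M K"
    using radon_inner_compact[OF M B(1)] by metis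
  have "emeasure M B \<le> emeasure M K + ennreal e"
    using K(3) by (simp add: ennreal_minus_le_iff less_imp_le add.commute) (metis add.commute ennreal_minus_le_iff less_imp_le)
  then have "emeasure M (B - K) \<le> ennreal e"
    using compact_borel[OF K(1)] K(2) B radon_sets[OF M] radon_compact_finite[OF M K(1)]
    by (subst emeasure_Diff) (auto simp: ennreal_minus_le_iff)
  with K that show ?thesis by blast
qed

lemma radon_mono:
  fixes M :: "'a::t2_space measure"
  assumes M: "radon M" "emeasure M UNIV < \<infinity>" and N: "sets N = sets borel"
    and le: "\<And>B. B \<in> sets borel \<Longrightarrow> emeasure N B \<le> emeasure M B"
  shows "radon N"
proof (rule radonI_tight[OF N])
  fix K :: "'a set" assume "compact K"
  then show "emeasure N K < \<infinity>"
    using le[of K] radon_compact_finite[OF M(1)] by (metis compact_borel le_less_trans)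
next
  fix B :: "'a set" and e :: real assume B: "B \<in> sets borel" and e: "0 < e"
  have "emeasure M B \<le> emeasure M UNIV"
    using M by (intro emeasure_mono) (auto simp: radon_sets)
  then obtain K where K: "compact K" "K \<subseteq> B" "emeasure M (B - K) \<le> ennreal e"
    using radon_tight[OF M(1) B _ e] M(2) by (metis le_less_trans)
  moreover have "emeasure N (B - K) \<le> emeasure M (B - K)"
    using compact_borel[OF K(1)] B by (intro le) auto
  ultimately show "\<exists>K. compact K \<and> K \<subseteq> B \<and> emeasure N (B - K) \<le> ennreal e"
    by (meson order_trans)
qed

lemma radon_restrict:
  fixes M :: "'a::t2_space measure"
  assumes M: "radon M" and X: "X \<in> sets borel"
  shows "radon (density M (indicator X))"
proof (rule radonI)
  have s[simp]: "sets M = sets borel" using M by (rule radon_sets)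
  show "sets (density M (indicator X)) = sets borel" by simp
  fix K :: "'a set" assume "compact K"
  then have K: "K \<in> sets M" using compact_borel by simp
  have "emeasure (density M (indicator X)) K = emeasure M (X \<inter> K)"
    by (rule emeasure_restricted) (use X K in simp_all)
  also have "\<dots> \<le> emeasure M K" by (rule emeasure_mono) (use K in simp_all)
  also have "\<dots> < \<infinity>" using M \<open>compact K\<close> by (rule radon_compact_finite)
  finally show "emeasure (density M (indicator X)) K < \<infinity>" .
next
  have s[simp]: "sets M = sets borel" using M by (rule radon_sets)
  fix B :: "'a set" and c assume B: "B \<in> sets borel" and c: "c < emeasure (density M (indicator X)) B"
  then have "c < emeasure M (X \<inter> B)" using X by (simp add: emeasure_restricted)
  moreover have "X \<inter> B \<in> sets borel" using X B by simp
  ultimately obtain K where K: "compact K" "K \<subseteq> X \<inter> B" "c < emeasure M K"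
    using radon_inner_compact[OF M] by blast
  have "emeasure (density M (indicator X)) K = emeasure M (X \<inter> K)"
    by (rule emeasure_restricted) (use X compact_borel[OF K(1)] in simp_all)
  also have "X \<inter> K = K" using K(2) by blast
  finally show "\<exists>K. compact K \<and> K \<subseteq> B \<and> c < emeasure (density M (indicator X)) K"
    using K by (metis le_inf_iff)
qed

text \<open>
  For a \<open>\<sigma>\<close>-finite Radon measure the sections of an arbitrary Borel set of a product space have
  measurable measure, so iterated integrals make sense.
\<close>

definition sigma_radon :: "'a::topological_space measure \<Rightarrow> bool" where
  "sigma_radon M \<longleftrightarrow> radon M \<and> sigma_finite_measure M"

definition finite_radon :: "'a::topological_space measure \<Rightarrow> bool" where
  "finite_radon M \<longleftrightarrow> radon M \<and> emeasure M UNIV < \<infinity>"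

lemma finite_radon_finite_measure: "finite_radon M \<Longrightarrow> finite_measure M"
  unfolding finite_radon_def by (intro finite_measureI) (auto simp: radon_space)

lemma finite_radon_sigma_radon: "finite_radon M \<Longrightarrow> sigma_radon M"
  using finite_radon_finite_measure[of M]
  by (simp add: finite_radon_def sigma_radon_def finite_measure_def)

lemma sigma_radon_radon: "sigma_radon M \<Longrightarrow> radon M"
  by (simp add: sigma_radon_def)

lemma sigma_radon_sets: "sigma_radon M \<Longrightarrow> sets M = sets borel"
  by (simp add: sigma_radon_def radon_sets)

lemma sigma_radon_measurable: "sigma_radon M \<Longrightarrow> f \<in> measurable borel L \<Longrightarrow> f \<in> measurable M L"
  by (rule measurable_if_sets_borel[OF sigma_radon_sets])

lemma sigma_radon_exhaust:
  assumes "sigma_radon M"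
  obtains X :: "nat \<Rightarrow> 'a::t2_space set"
  where "\<And>n. X n \<in> sets borel" "(\<Union>n. X n) = UNIV" "incseq X"
    "\<And>n. finite_radon (density M (indicator (X n)))"
proof -
  interpret sigma_finite_measure M using assms by (simp add: sigma_radon_def)
  have M: "radon M" using assms by (simp add: sigma_radon_def)
  obtain X :: "nat \<Rightarrow> 'a set" where X: "range X \<subseteq> sets M" "(\<Union>n. X n) = space M"
    "\<And>n. emeasure M (X n) \<noteq> \<infinity>" "incseq X"
    using sigma_finite_incseq by blast
  have Xb: "X n \<in> sets borel" for n using X(1) radon_sets[OF M] by auto
  show ?thesis
  proof (rule that)
    show "X n \<in> sets borel" for n by (rule Xb)
    show "(\<Union>n. X n) = UNIV" using X(2) radon_space[OF M] by simp
    show "finite_radon (density M (indicator (X n)))" for n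
      unfolding finite_radon_def using X(3)[of n] radon_restrict[OF M Xb] Xb[of n] M
      by (auto simp: emeasure_restricted radon_sets less_top)
  qed (rule X(4))
qed

text \<open>
  For a finite measure, inner regularity on open sets is enough. The sets that lie between a closed
  and an open set of almost the same measure form a \<open>\<sigma>\<close>-algebra containing the open sets, and
  regularity on the whole space turns the closed sets into compact ones.
\<close>

lemma radonI_open:
  fixes M :: "'a::t2_space measure"
  assumes M: "sets M = sets borel" "emeasure M UNIV < \<infinity>"
    and opn: "\<And>U e. open U \<Longrightarrow> 0 < (e::real) \<Longrightarrow>
      \<exists>K. compact K \<and> K \<subseteq> U \<and> emeasure M (U - K) \<le> ennreal e"
  shows "radon M"
proof -
  have [simp]: "space M = UNIV" using sets_eq_imp_space_eq[OF M(1)] by simp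
  interpret finite_measure M using M(2) by (intro finite_measureI) auto
  have fin: "emeasure M B < \<infinity>" for B by (simp add: less_top[symmetric])
  note [simp] = M(1)
  have squeeze: "\<forall>e>0. \<exists>F G. closed F \<and> open G \<and> F \<subseteq> B \<and> B \<subseteq> G \<and> emeasure M (G - F) \<le> ennreal e"
    if "B \<in> sigma_sets UNIV {S. open S}" for B :: "'a set"
    using that
  proof induct
    case (Basic U)
    show ?case
    proof (intro allI impI)
      fix e :: real assume "0 < e"
      then obtain K where "compact K" "K \<subseteq> U" "emeasure M (U - K) \<le> ennreal e"
        using opn[of U e] Basic by auto
      then show "\<exists>F G. closed F \<and> open G \<and> F \<subseteq> U \<and> U \<subseteq> G \<and> emeasure M (G - F) \<le> ennreal e"
        using Basic by (intro exI[of _ K] exI[of _ U]) (auto simp: compact_imp_closed)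
    qed
  next
    case Empty
    then show ?case by (intro allI impI exI[of _ "{}"]) auto
  next
    case (Compl B)
    show ?case
    proof (intro allI impI)
      fix e :: real assume "0 < e"
      then obtain F G where FG: "closed F" "open G" "F \<subseteq> B" "B \<subseteq> G" "emeasure M (G - F) \<le> ennreal e"
        using Compl(2)[rule_format, OF \<open>0 < e\<close>] by (elim exE conjE)
      have "closed (- G)" "open (- F)" "- G \<subseteq> UNIV - B" "UNIV - B \<subseteq> - F" "- F - - G = G - F"
        using FG(1-4) by auto
      with FG(5) show "\<exists>F G. closed F \<and> open G \<and> F \<subseteq> UNIV - B \<and> UNIV - B \<subseteq> G \<and> emeasure M (G - F) \<le> ennreal e"
        by metis
    qed
  next
    case (Union B)
    show ?case
    proof (intro allI impI)
      fix e :: real assume e: "0 < e"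
      let ?d = "\<lambda>n. e / 2 * (1/2) ^ Suc n"
      have "\<exists>F G. closed F \<and> open G \<and> F \<subseteq> B n \<and> B n \<subseteq> G \<and> emeasure M (G - F) \<le> ennreal (?d n)" for n
        by (rule Union(2)[rule_format]) (use e in simp)
      then obtain F G where FG: "\<And>n. closed (F n)" "\<And>n. open (G n)" "\<And>n. F n \<subseteq> B n" "\<And>n. B n \<subseteq> G n"
        "\<And>n. emeasure M (G n - F n) \<le> ennreal (?d n)" by metis
      define H where "H N = (\<Union>n\<le>N. F n)" for N
      have Hc: "closed (H N)" for N unfolding H_def using FG(1) by auto
      have "(\<lambda>N. emeasure M ((\<Union>n. F n) - H N)) \<longlonglongrightarrow> emeasure M (\<Inter>N. (\<Union>n. F n) - H N)"
        using FG(1) Hc fin by (intro Lim_emeasure_decseq) (fastforce simp: decseq_def H_def)+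
      moreover have "(\<Inter>N. (\<Union>n. F n) - H N) = {}" unfolding H_def by auto
      ultimately have "(\<lambda>N. emeasure M ((\<Union>n. F n) - H N)) \<longlonglongrightarrow> 0"
        by (simp only: emeasure_empty)
      then have "\<forall>\<^sub>F N in sequentially. emeasure M ((\<Union>n. F n) - H N) < ennreal (e/2)"
        by (rule order_tendstoD) (use e in simp)
      then obtain N where N: "emeasure M ((\<Union>n. F n) - H N) < ennreal (e/2)"
        by (auto simp: eventually_sequentially)
      have "emeasure M ((\<Union>n. G n) - H N) \<le> emeasure M ((\<Union>n. G n - F n) \<union> ((\<Union>n. F n) - H N))"
        using FG Hc by (intro emeasure_mono) auto
      also have "\<dots> \<le> emeasure M (\<Union>n. G n - F n) + emeasure M ((\<Union>n. F n) - H N)"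
        using FG Hc by (intro emeasure_subadditive) auto
      also have "\<dots> \<le> ennreal (e/2) + ennreal (e/2)"
      proof (intro add_mono less_imp_le[OF N])
        have "emeasure M (\<Union>n. G n - F n) \<le> (\<Sum>n. emeasure M (G n - F n))"
          using FG by (intro emeasure_subadditive_countably) auto
        also have "\<dots> \<le> (\<Sum>n. ennreal (?d n))" by (intro suminf_le FG(5)) auto
        also have "\<dots> = ennreal (\<Sum>n. ?d n)"
          using e by (intro suminf_ennreal2) (auto intro!: summable_mult sums_summable[OF power_half_series] simp del: power_Suc)
        also have "(\<Sum>n. ?d n) = e/2"
          using sums_unique[OF sums_mult[OF power_half_series, of "e/2"]] by simp
        finally show "emeasure M (\<Union>n. G n - F n) \<le> ennreal (e/2)" .
      qed
      also have "\<dots> = ennreal e" using e by (simp flip: ennreal_plus)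
      finally have "emeasure M ((\<Union>n. G n) - H N) \<le> ennreal e" .
      moreover have "open (\<Union>n. G n)" "H N \<subseteq> (\<Union>n. B n)" "(\<Union>n. B n) \<subseteq> (\<Union>n. G n)"
        using FG(2) UN_mono[of "{..N}" UNIV F B] UN_mono[of UNIV UNIV B G] FG(3,4)
        by (auto simp only: H_def intro!: open_UN)
      ultimately show "\<exists>F G. closed F \<and> open G \<and> F \<subseteq> \<Union>(range B) \<and> \<Union>(range B) \<subseteq> G \<and> emeasure M (G - F) \<le> ennreal e"
        using Hc by metis
    qed
  qed
  show ?thesis
  proof (rule radonI_tight)
    fix B :: "'a set" and e :: real assume B: "B \<in> sets borel" and e: "0 < e"
    obtain K where K: "compact K" "emeasure M (UNIV - K) \<le> ennreal (e/2)"
      using opn[of UNIV "e/2"] e by auto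
    obtain F G where F: "closed F" "open G" "F \<subseteq> B" "B \<subseteq> G" "emeasure M (G - F) \<le> ennreal (e/2)"
      using squeeze[of B] B e unfolding sets_borel by (metis half_gt_zero)
    have "F \<in> sets borel" "G \<in> sets borel" "K \<in> sets borel" using F(1,2) compact_borel[OF K(1)] by simp_all
    then have FK: "G - F \<in> sets borel" "UNIV - K \<in> sets borel" by (blast intro: sets.Diff borel_open open_UNIV)+
    have "emeasure M (B - F \<inter> K) \<le> emeasure M ((G - F) \<union> (UNIV - K))"
      by (rule emeasure_mono) (use F(4) sets.Un[OF FK] in auto)
    also have "\<dots> \<le> emeasure M (G - F) + emeasure M (UNIV - K)"
      using FK by (intro emeasure_subadditive) simp_all
    also have "\<dots> \<le> ennreal (e/2) + ennreal (e/2)"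
      using F K by (intro add_mono)
    also have "\<dots> = ennreal e" using e by (simp flip: ennreal_plus)
    finally show "\<exists>K. compact K \<and> K \<subseteq> B \<and> emeasure M (B - K) \<le> ennreal e"
      using F K by (intro exI[of _ "F \<inter> K"]) (auto intro: closed_Int_compact)
  qed (use fin in auto)
qed

text \<open>
  The supremum of the measures of the compact subsets of \<open>U\<close> is attained by an increasing sequence,
  so no further compact subset adds mass to its union. It is not claimed that the sequence exhausts
  the measure of \<open>U\<close>: without inner regularity it need not.
\<close>

lemma compact_exhaustion:
  fixes J :: "'a::t2_space measure"
  assumes J: "sets J = sets borel" and fin: "emeasure J UNIV < \<infinity>"
  obtains Z :: "nat \<Rightarrow> 'a set" where "\<And>n. compact (Z n)" "\<And>n. Z n \<subseteq> U" "incseq Z"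
    "\<And>Q. compact Q \<Longrightarrow> Q \<subseteq> U \<Longrightarrow> emeasure J (Q - (\<Union>n. Z n)) = 0"
proof -
  note [simp] = J
  let ?C = "{C. compact C \<and> C \<subseteq> U}"
  define s where "s = (SUP C\<in>?C. emeasure J C)"
  have s_upper: "emeasure J C \<le> s" if "compact C" "C \<subseteq> U" for C
    unfolding s_def by (rule SUP_upper) (use that in simp)
  have "s \<le> emeasure J UNIV"
    unfolding s_def by (rule SUP_least, rule emeasure_mono) simp_all
  then have s_fin: "s < \<infinity>"
    using fin by (rule le_less_trans)
  have "{} \<in> ?C" by simp
  then have "?C \<noteq> {}" by blast
  then have "\<exists>f::nat \<Rightarrow> ennreal. range f \<subseteq> emeasure J ` ?C \<and> s = (SUP n. f n)"
    unfolding s_def by (rule ennreal_SUP_countable_SUP)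
  then obtain f :: "nat \<Rightarrow> ennreal" where f: "range f \<subseteq> emeasure J ` ?C" "s = (SUP n. f n)"
    by (elim exE conjE)
  have "\<forall>n. \<exists>C. compact C \<and> C \<subseteq> U \<and> f n = emeasure J C"
    using f(1) by blast
  then obtain C where C: "\<And>n. compact (C n)" "\<And>n. C n \<subseteq> U" "\<And>n. f n = emeasure J (C n)"
    by metis
  define Z where "Z n = (\<Union>k\<le>n. C k)" for n
  have Z: "compact (Z n)" "Z n \<subseteq> U" for n
    unfolding Z_def by (rule compact_UN[OF finite_atMost C(1)], rule UN_least[OF C(2)])
  have Zb: "Z n \<in> sets borel" for n
    using Z(1) by (rule compact_borel)
  have Zmono: "Z m \<subseteq> Z n" if "m \<le> n" for m n
    unfolding Z_def using that by (intro UN_mono) auto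
  let ?Z = "\<Union>n. Z n"
  have Zub: "?Z \<in> sets borel"
    using Zb by simp
  have null: "emeasure J (Q - ?Z) = 0" if Q: "compact Q" "Q \<subseteq> U" for Q
  proof -
    have Qb: "Q \<in> sets borel"
      using Q(1) by (rule compact_borel)
    have "f n \<le> emeasure J ?Z" for n
      unfolding C(3) by (rule emeasure_mono) (use Zub in \<open>auto simp: Z_def\<close>)
    then have "s \<le> emeasure J ?Z"
      unfolding f(2) by (rule SUP_least)
    then have "s + emeasure J (Q - ?Z) \<le> emeasure J ?Z + emeasure J (Q - ?Z)"
      by (rule add_right_mono)
    also have "\<dots> = emeasure J (\<Union>n. Q \<union> Z n)"
    proof -
      have "?Z \<union> (Q - ?Z) = (\<Union>n. Q \<union> Z n)" by blast
      then show ?thesis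
        using Qb Zub by (subst plus_emeasure) simp_all
    qed
    also have "\<dots> = (SUP n. emeasure J (Q \<union> Z n))"
      using Qb Zb Zmono by (intro SUP_emeasure_incseq[symmetric]) (auto simp: incseq_def)
    also have "\<dots> \<le> s"
      by (rule SUP_least, rule s_upper) (use Q Z in \<open>simp_all add: compact_Un\<close>)
    finally have "s + emeasure J (Q - ?Z) \<le> s + 0" by simp
    then have "s = \<infinity> \<or> emeasure J (Q - ?Z) \<le> 0"
      by (simp only: ennreal_add_left_cancel_le infinity_ennreal_def)
    then show ?thesis
      using s_fin by (elim disjE) simp_all
  qed
  have "incseq Z"
    using Zmono by (rule monoI)
  then show ?thesis by (rule that[OF Z(1) Z(2) _ null])
qed

section \<open>Mixtures of measures\<close>

text \<open>
  The integral of a family of Borel measures over a parameter. The product of two measures is a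
  mixture of copies of the second factor carried by the vertical sections, and a sum of measures is
  a mixture over the counting measure.
\<close>

definition mixture :: "'t measure \<Rightarrow> ('t \<Rightarrow> 'a::topological_space measure) \<Rightarrow> 'a measure" where
  "mixture T k = measure_of UNIV (sets borel) (\<lambda>B. \<integral>\<^sup>+t. emeasure (k t) B \<partial>T)"

lemma sets_mixture [simp]: "sets (mixture T k) = sets borel"
  unfolding mixture_def using sets.sets_measure_of_eq[of borel] by simp

lemma emeasure_mixture:
  assumes k: "\<And>t. t \<in> space T \<Longrightarrow> sets (k t) = sets borel"
    and m: "\<And>B. B \<in> sets borel \<Longrightarrow> (\<lambda>t. emeasure (k t) B) \<in> borel_measurable T"
    and B: "B \<in> sets borel"
  shows "emeasure (mixture T k) B = (\<integral>\<^sup>+t. emeasure (k t) B \<partial>T)"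
  unfolding mixture_def
proof (rule emeasure_measure_of_sigma)
  show "sigma_algebra UNIV (sets borel)"
    using sets.sigma_algebra_axioms[of borel] by simp
  show "positive (sets borel) (\<lambda>B. \<integral>\<^sup>+t. emeasure (k t) B \<partial>T)"
    by (simp add: positive_def)
  show "countably_additive (sets borel) (\<lambda>B. \<integral>\<^sup>+t. emeasure (k t) B \<partial>T)"
  proof (rule countably_additiveI)
    fix B :: "nat \<Rightarrow> 'b set"
    assume B: "range B \<subseteq> sets borel" "disjoint_family B"
    have "(\<Sum>n. \<integral>\<^sup>+t. emeasure (k t) (B n) \<partial>T) = (\<integral>\<^sup>+t. (\<Sum>n. emeasure (k t) (B n)) \<partial>T)"
      by (rule nn_integral_suminf[symmetric], rule m) (use B in blast)
    also have "\<dots> = (\<integral>\<^sup>+t. emeasure (k t) (\<Union>n. B n) \<partial>T)"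
      by (rule nn_integral_cong, rule suminf_emeasure) (use B k in simp_all)
    finally show "(\<Sum>n. \<integral>\<^sup>+t. emeasure (k t) (B n) \<partial>T) = (\<integral>\<^sup>+t. emeasure (k t) (\<Union>n. B n) \<partial>T)" .
  qed
qed (rule B)

text \<open>
  Both claims are proved in one induction over \<open>h\<close>, because the monotone limit in the second needs
  the measurability from the first.
\<close>

lemma nn_integral_mixture:
  fixes h :: "'a::topological_space \<Rightarrow> ennreal"
  assumes k: "\<And>t. t \<in> space T \<Longrightarrow> sets (k t) = sets borel"
    and m: "\<And>B. B \<in> sets borel \<Longrightarrow> (\<lambda>t. emeasure (k t) B) \<in> borel_measurable T"
    and h: "h \<in> borel_measurable borel"
  shows "(\<lambda>t. \<integral>\<^sup>+x. h x \<partial>k t) \<in> borel_measurable T \<and>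
    (\<integral>\<^sup>+x. h x \<partial>mixture T k) = (\<integral>\<^sup>+t. \<integral>\<^sup>+x. h x \<partial>k t \<partial>T)"
proof -
  have mk: "u \<in> borel_measurable (k t)" if "u \<in> borel_measurable borel" "t \<in> space T" for u :: "'a \<Rightarrow> ennreal" and t
    by (rule measurable_if_sets_borel[OF k[OF that(2)] that(1)])
  have mm: "u \<in> borel_measurable (mixture T k)" if "u \<in> borel_measurable borel" for u :: "'a \<Rightarrow> ennreal"
    by (rule measurable_if_sets_borel[OF sets_mixture that])
  show ?thesis
    using h
  proof (induction rule: borel_measurable_induct)
    case (cong f g)
    have "f = g" by (rule ext, rule cong(3)) simp
    show ?case
      unfolding \<open>f = g\<close> by (rule cong.IH)
  next
    case (set B)
    have B: "(\<integral>\<^sup>+x. indicator B x \<partial>k t) = emeasure (k t) B" if "t \<in> space T" for t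
      by (rule nn_integral_indicator) (use set k[OF that] in simp)
    have "(\<lambda>t. \<integral>\<^sup>+x. indicator B x \<partial>k t) \<in> borel_measurable T"
      using m[OF set] measurable_cong[OF B, of T "\<lambda>t. t"] by simp
    moreover have "(\<integral>\<^sup>+x. indicator B x \<partial>mixture T k) = emeasure (mixture T k) B"
      by (rule nn_integral_indicator) (use set in simp)
    moreover have "(\<integral>\<^sup>+t. \<integral>\<^sup>+x. indicator B x \<partial>k t \<partial>T) = (\<integral>\<^sup>+t. emeasure (k t) B \<partial>T)"
      by (rule nn_integral_cong[OF B])
    ultimately show ?case
      using emeasure_mixture[of T k B, OF k m set] by (simp only: simp_thms)
  next
    case (mult u c)
    note IH = conjunct1[OF mult.IH] conjunct2[OF mult.IH]
    have c: "(\<integral>\<^sup>+x. c * u x \<partial>k t) = c * (\<integral>\<^sup>+x. u x \<partial>k t)" if "t \<in> space T" for t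
      by (rule nn_integral_cmult[OF mk[OF mult(2) that]])
    have "(\<lambda>t. c * (\<integral>\<^sup>+x. u x \<partial>k t)) \<in> borel_measurable T"
      using IH(1) by measurable
    then have "(\<lambda>t. \<integral>\<^sup>+x. c * u x \<partial>k t) \<in> borel_measurable T"
      by (simp only: measurable_cong[OF c])
    moreover have "(\<integral>\<^sup>+x. c * u x \<partial>mixture T k) = c * (\<integral>\<^sup>+x. u x \<partial>mixture T k)"
      by (rule nn_integral_cmult[OF mm[OF mult(2)]])
    moreover have "(\<integral>\<^sup>+t. \<integral>\<^sup>+x. c * u x \<partial>k t \<partial>T) = c * (\<integral>\<^sup>+t. \<integral>\<^sup>+x. u x \<partial>k t \<partial>T)"
      by (subst nn_integral_cmult[OF IH(1), symmetric]) (rule nn_integral_cong[OF c])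
    ultimately show ?case
      using IH(2) by (simp only: simp_thms)
  next
    case (add u v)
    note IHu = conjunct1[OF add.IH(1)] conjunct2[OF add.IH(1)]
    note IHv = conjunct1[OF add.IH(2)] conjunct2[OF add.IH(2)]
    have plus: "(\<integral>\<^sup>+x. v x + u x \<partial>k t) = (\<integral>\<^sup>+x. v x \<partial>k t) + (\<integral>\<^sup>+x. u x \<partial>k t)" if "t \<in> space T" for t
      by (rule nn_integral_add[OF mk[OF add(3) that] mk[OF add(1) that]])
    have "(\<lambda>t. (\<integral>\<^sup>+x. v x \<partial>k t) + (\<integral>\<^sup>+x. u x \<partial>k t)) \<in> borel_measurable T"
      using IHu(1) IHv(1) by measurable
    then have "(\<lambda>t. \<integral>\<^sup>+x. v x + u x \<partial>k t) \<in> borel_measurable T"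
      by (simp only: measurable_cong[OF plus])
    moreover have "(\<integral>\<^sup>+x. v x + u x \<partial>mixture T k) = (\<integral>\<^sup>+x. v x \<partial>mixture T k) + (\<integral>\<^sup>+x. u x \<partial>mixture T k)"
      by (rule nn_integral_add[OF mm[OF add(3)] mm[OF add(1)]])
    moreover have "(\<integral>\<^sup>+t. \<integral>\<^sup>+x. v x + u x \<partial>k t \<partial>T) = (\<integral>\<^sup>+t. \<integral>\<^sup>+x. v x \<partial>k t \<partial>T) + (\<integral>\<^sup>+t. \<integral>\<^sup>+x. u x \<partial>k t \<partial>T)"
      by (subst nn_integral_add[OF IHv(1) IHu(1), symmetric]) (rule nn_integral_cong[OF plus])
    ultimately show ?case
      using IHu(2) IHv(2) by (simp only: simp_thms)
  next
    case (seq U)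
    have sup: "Sup (range U) x = (SUP i. U i x)" for x by (simp only: Sup_apply image_image)
    have lim: "(\<integral>\<^sup>+x. (Sup (range U)) x \<partial>k t) = (SUP i. \<integral>\<^sup>+x. U i x \<partial>k t)" if "t \<in> space T" for t
      unfolding sup by (rule nn_integral_monotone_convergence_SUP[OF \<open>incseq U\<close> mk[OF seq(1) that]])
    note IH = conjunct1[OF seq.IH] conjunct2[OF seq.IH]
    have "(\<lambda>t. SUP i. \<integral>\<^sup>+x. U i x \<partial>k t) \<in> borel_measurable T"
      by (rule borel_measurable_SUP[OF _ IH(1)]) simp
    then have "(\<lambda>t. \<integral>\<^sup>+x. (Sup (range U)) x \<partial>k t) \<in> borel_measurable T"
      by (simp only: measurable_cong[OF lim])
    moreover have "(\<integral>\<^sup>+x. (Sup (range U)) x \<partial>mixture T k) = (\<integral>\<^sup>+t. (SUP i. \<integral>\<^sup>+x. U i x \<partial>k t) \<partial>T)"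
    proof -
      have "(\<integral>\<^sup>+x. (Sup (range U)) x \<partial>mixture T k) = (SUP i. \<integral>\<^sup>+x. U i x \<partial>mixture T k)"
        unfolding sup by (rule nn_integral_monotone_convergence_SUP[OF \<open>incseq U\<close> mm[OF seq(1)]])
      also have "\<dots> = (\<integral>\<^sup>+t. (SUP i. \<integral>\<^sup>+x. U i x \<partial>k t) \<partial>T)"
        unfolding IH(2)
      proof (rule nn_integral_monotone_convergence_SUP[symmetric, OF _ IH(1)])
        show "incseq (\<lambda>i t. \<integral>\<^sup>+x. U i x \<partial>k t)"
          using incseq_SucD[OF \<open>incseq U\<close>]
          by (intro incseq_SucI le_funI nn_integral_mono) (simp add: le_funD)
      qed
      finally show ?thesis .
    qed
    moreover have "(\<integral>\<^sup>+t. \<integral>\<^sup>+x. (Sup (range U)) x \<partial>k t \<partial>T) = (\<integral>\<^sup>+t. (SUP i. \<integral>\<^sup>+x. U i x \<partial>k t) \<partial>T)"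
      by (rule nn_integral_cong[OF lim])
    ultimately show ?case by (simp only: simp_thms)
  qed
qed

section \<open>The product of two Radon measures as an iterated integral\<close>

lemma section_borel:
  fixes B :: "('a::topological_space \<times> 'b::topological_space) set"
  assumes "B \<in> sets borel"
  shows "Pair x -` B \<in> sets borel"
proof -
  have "(Pair x :: 'b \<Rightarrow> 'a \<times> 'b) \<in> borel_measurable borel"
    by (intro borel_measurable_continuous_onI continuous_intros)
  from measurable_sets_borel[OF this assms] show ?thesis .
qed

lemma borel_Times:
  fixes B :: "'a::topological_space set" and C :: "'b::topological_space set"
  assumes "B \<in> sets borel" "C \<in> sets borel"
  shows "B \<times> C \<in> sets borel"
proof -
  have f: "(fst :: 'a \<times> 'b \<Rightarrow> 'a) \<in> borel_measurable borel"
    by (intro borel_measurable_continuous_onI continuous_intros)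
  have s: "(snd :: 'a \<times> 'b \<Rightarrow> 'b) \<in> borel_measurable borel"
    by (intro borel_measurable_continuous_onI continuous_intros)
  have "B \<times> C = (fst -` B) \<inter> (snd -` C)" by auto
  then show ?thesis
    using measurable_sets_borel[OF f assms(1)] measurable_sets_borel[OF s assms(2)] by simp
qed

text \<open>
  Inner regularity replaces the measure of a section by that of a compact subset of it, and the tube
  lemma says that this compact set stays inside all neighbouring sections.
\<close>

lemma section_measure_open:
  fixes U :: "('a::t2_space \<times> 'b::t2_space) set"
  assumes N: "radon N" and U: "open U"
  shows "open {x. c < emeasure N (Pair x -` U)}"
proof (subst open_subopen, rule ballI)
  fix x assume "x \<in> {x. c < emeasure N (Pair x -` U)}"
  then have c: "c < emeasure N (Pair x -` U)" by simp
  have "Pair x -` U \<in> sets borel" using U by (intro section_borel) simp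
  then obtain K where K: "compact K" "K \<subseteq> Pair x -` U" "c < emeasure N K"
    using radon_inner_compact[OF N] c by blast
  have "{x} \<times> K \<subseteq> U" using K(2) by auto
  then obtain W where W: "x \<in> W" "open W" "W \<times> K \<subseteq> U"
    using Elementary_Topology.tube_lemma[OF K(1) U] by blast
  have "c < emeasure N (Pair y -` U)" if "y \<in> W" for y
  proof -
    have "emeasure N K \<le> emeasure N (Pair y -` U)"
      using W(3) that U by (intro emeasure_mono) (auto simp: radon_sets[OF N] intro!: section_borel)
    with K(3) show ?thesis by (rule less_le_trans)
  qed
  with W show "\<exists>T. open T \<and> x \<in> T \<and> T \<subseteq> {x. c < emeasure N (Pair x -` U)}" by blast
qed

text \<open>
  A Dynkin system argument from the lower semicontinuous case. It reaches every Borel set of the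
  product space, also those outside the \<open>\<sigma>\<close>-algebra generated by Borel rectangles.
\<close>

lemma section_measure_measurable_finite:
  fixes B :: "('a::t2_space \<times> 'b::t2_space) set"
  assumes N: "finite_radon N" and B: "B \<in> sets borel"
  shows "(\<lambda>x. emeasure N (Pair x -` B)) \<in> borel_measurable borel"
proof -
  have N': "radon N" using N by (simp add: finite_radon_def)
  interpret finite_measure N using N by (rule finite_radon_finite_measure)
  note [simp] = radon_sets[OF N'] radon_space[OF N']
  have "Int_stable {S :: ('a \<times> 'b) set. open S}" by (auto simp: Int_stable_def)
  moreover have "{S :: ('a \<times> 'b) set. open S} \<subseteq> Pow UNIV" by simp
  moreover have "B \<in> sigma_sets UNIV {S. open S}" using B by (simp add: sets_borel)
  ultimately show ?thesis
  proof (induction rule: sigma_sets_induct_disjoint)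
    case (basic U)
    then have U: "open U" by simp
    show ?case by (rule borel_measurableI_greater) (simp add: section_measure_open[OF N' U])
  next
    case empty
    show ?case by simp
  next
    case (compl B)
    then have "B \<in> sets borel" by (simp add: sets_borel)
    then have Bx: "Pair x -` B \<in> sets N" for x by (simp add: section_borel)
    have "emeasure N (Pair x -` (UNIV - B)) = emeasure N UNIV - emeasure N (Pair x -` B)" for x
      using emeasure_compl[OF Bx[of x]] by (simp add: vimage_Diff)
    then show ?case using compl.IH by simp
  next
    case (union B)
    then have "B i \<in> sets borel" for i by (auto simp: sets_borel)
    then have Bx: "Pair x -` B i \<in> sets N" for x i by (simp add: section_borel)
    have "emeasure N (Pair x -` (\<Union>i. B i)) = (\<Sum>i. emeasure N (Pair x -` B i))" for x
      using Bx union.hyps(1) unfolding vimage_UN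
      by (intro suminf_emeasure[symmetric]) (auto simp: disjoint_family_on_vimageI)
    then show ?case using union.IH by simp
  qed
qed

lemma section_measure_measurable:
  fixes B :: "('a::t2_space \<times> 'b::t2_space) set"
  assumes N: "sigma_radon N" and B: "B \<in> sets borel"
  shows "(\<lambda>x. emeasure N (Pair x -` B)) \<in> borel_measurable borel"
proof -
  obtain Y :: "nat \<Rightarrow> 'b set" where Y: "\<And>n. Y n \<in> sets borel" "(\<Union>n. Y n) = UNIV" "incseq Y"
    "\<And>n. finite_radon (density N (indicator (Y n)))"
    using sigma_radon_exhaust[OF N] by blast
  note [simp] = sigma_radon_sets[OF N]
  have Bx: "Pair x -` B \<in> sets borel" for x using B by (rule section_borel)
  have "emeasure N (Pair x -` B) = (SUP n. emeasure (density N (indicator (Y n))) (Pair x -` B))" for x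
  proof -
    have "(SUP n. emeasure (density N (indicator (Y n))) (Pair x -` B)) = (SUP n. emeasure N (Y n \<inter> Pair x -` B))"
      using Y Bx by (intro SUP_cong refl emeasure_restricted) auto
    also have "\<dots> = emeasure N (\<Union>n. Y n \<inter> Pair x -` B)"
      using Y(1) Bx monoD[OF Y(3)] by (intro SUP_emeasure_incseq) (fastforce simp: incseq_def)+
    also have "(\<Union>n. Y n \<inter> Pair x -` B) = Pair x -` B"
      using Y(2) by blast
    finally show ?thesis by simp
  qed
  moreover have "(\<lambda>x. SUP n. emeasure (density N (indicator (Y n))) (Pair x -` B)) \<in> borel_measurable borel"
    by (intro borel_measurable_SUP section_measure_measurable_finite Y(4) B) simp
  ultimately show ?thesis by (simp only:)
qed

definition iter_measure :: "'a::t2_space measure \<Rightarrow> 'b::t2_space measure \<Rightarrow> ('a \<times> 'b) measure" where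
  "iter_measure M N = mixture M (\<lambda>x. distr N borel (Pair x))"

lemma sets_iter_measure [simp]: "sets (iter_measure M N) = sets borel"
  unfolding iter_measure_def by simp

lemma space_iter_measure [simp]: "space (iter_measure M N) = UNIV"
  using sets_eq_imp_space_eq[OF sets_iter_measure] by simp

lemma Pair_measurable:
  fixes N :: "'b::t2_space measure" and x :: "'a::t2_space"
  assumes "sigma_radon N"
  shows "Pair x \<in> measurable N borel"
  by (rule sigma_radon_measurable[OF assms])
    (intro borel_measurable_continuous_onI continuous_intros)

lemma emeasure_distr_Pair:
  fixes B :: "('a::t2_space \<times> 'b::t2_space) set"
  assumes N: "sigma_radon N" and B: "B \<in> sets borel"
  shows "emeasure (distr N borel (Pair x)) B = emeasure N (Pair x -` B)"
  using emeasure_distr[OF Pair_measurable[OF N] B] radon_space[OF sigma_radon_radon[OF N]] by simp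

lemma nn_integral_distr_Pair:
  fixes h :: "'a::t2_space \<times> 'b::t2_space \<Rightarrow> ennreal"
  assumes "sigma_radon N" "h \<in> borel_measurable borel"
  shows "(\<integral>\<^sup>+z. h z \<partial>distr N borel (Pair x)) = (\<integral>\<^sup>+y. h (x, y) \<partial>N)"
  by (rule nn_integral_distr[OF Pair_measurable[OF assms(1)]]) (use assms(2) in simp)

lemma emeasure_iter_measure:
  fixes M :: "'a::t2_space measure" and N :: "'b::t2_space measure"
  assumes M: "sigma_radon M" and N: "sigma_radon N" and B: "B \<in> sets borel"
  shows "emeasure (iter_measure M N) B = (\<integral>\<^sup>+x. emeasure N (Pair x -` B) \<partial>M)"
  unfolding iter_measure_def emeasure_distr_Pair[OF N B, symmetric]
  by (rule emeasure_mixture[OF _ _ B])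
    (simp_all add: emeasure_distr_Pair[OF N] sigma_radon_measurable[OF M section_measure_measurable[OF N]])

lemma section_nn_integral_measurable:
  fixes h :: "'a::t2_space \<times> 'b::t2_space \<Rightarrow> ennreal"
  assumes N: "sigma_radon N" and h: "h \<in> borel_measurable borel"
  shows "(\<lambda>x. \<integral>\<^sup>+y. h (x, y) \<partial>N) \<in> borel_measurable borel"
  unfolding nn_integral_distr_Pair[OF N h, symmetric]
  by (rule nn_integral_mixture[OF _ _ h, THEN conjunct1])
    (simp_all add: emeasure_distr_Pair[OF N] section_measure_measurable[OF N])

lemma nn_integral_iter_measure:
  fixes h :: "'a::t2_space \<times> 'b::t2_space \<Rightarrow> ennreal"
  assumes M: "sigma_radon M" and N: "sigma_radon N" and h: "h \<in> borel_measurable borel"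
  shows "(\<integral>\<^sup>+z. h z \<partial>iter_measure M N) = (\<integral>\<^sup>+x. \<integral>\<^sup>+y. h (x, y) \<partial>N \<partial>M)"
  unfolding iter_measure_def nn_integral_distr_Pair[OF N h, symmetric]
  by (rule nn_integral_mixture[OF _ _ h, THEN conjunct2])
    (simp_all add: emeasure_distr_Pair[OF N] sigma_radon_measurable[OF M section_measure_measurable[OF N]])

lemma emeasure_iter_measure_Times:
  fixes M :: "'a::t2_space measure" and N :: "'b::t2_space measure"
  assumes M: "sigma_radon M" and N: "sigma_radon N" and B: "B \<in> sets borel" and C: "C \<in> sets borel"
  shows "emeasure (iter_measure M N) (B \<times> C) = emeasure M B * emeasure N C"
proof -
  have sec: "emeasure N (Pair x -` (B \<times> C)) = emeasure N C * indicator B x" for x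
    by (simp add: indicator_def)
  have "B \<in> sets M"
    using B sigma_radon_sets[OF M] by simp
  then show ?thesis
    unfolding emeasure_iter_measure[OF M N borel_Times[OF B C]] sec
    by (subst nn_integral_cmult_indicator) (simp_all only: mult.commute)
qed

text \<open>
  This is the step that makes the iterated integral Radon although its \<open>\<sigma>\<close>-algebra is larger than
  the product one. If \<open>U - Z\<close> had positive mass, then some level \<open>c\<close> would separate the measures of
  the sections of \<open>Z\<close> and \<open>U\<close> over a compact set \<open>D\<close> of positive measure. Around a point of \<open>D\<close> at
  which \<open>M\<close> does not vanish locally, the tube lemma yields a compact box in \<open>U\<close> whose vertical side
  already has measure above \<open>c\<close>; that box would have positive mass outside \<open>Z\<close>.
\<close>

lemma iter_measure_null_if_compacts_null:
  fixes M :: "'a::t2_space measure" and N :: "'b::t2_space measure"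
  assumes M: "sigma_radon M" and N: "finite_radon N" and U: "open U"
    and Z: "Z \<in> sets borel" "Z \<subseteq> U"
    and null: "\<And>Q. compact Q \<Longrightarrow> Q \<subseteq> U \<Longrightarrow> emeasure (iter_measure M N) (Q - Z) = 0"
  shows "emeasure (iter_measure M N) (U - Z) = 0"
proof -
  note sN = finite_radon_sigma_radon[OF N]
  note rM = sigma_radon_radon[OF M] and rN = sigma_radon_radon[OF sN]
  interpret N: finite_measure N
    by (rule finite_radon_finite_measure[OF N])
  note [simp] = radon_sets[OF rM] radon_sets[OF rN]
  have Ub: "U \<in> sets borel"
    using U by simp
  define u where "u x = emeasure N (Pair x -` U)" for x
  define z where "z x = emeasure N (Pair x -` Z)" for x
  have uz: "u \<in> borel_measurable borel" "z \<in> borel_measurable borel"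
    unfolding u_def[abs_def] z_def[abs_def]
    by (rule section_measure_measurable[OF sN Ub], rule section_measure_measurable[OF sN Z(1)])
  have level: "{x. z x \<le> c \<and> c < u x} \<in> sets borel" for c
  proof -
    have "{x \<in> space borel. z x \<le> c \<and> c < u x} \<in> sets borel"
      using uz by measurable
    then show ?thesis by simp
  qed
  have level_null: "emeasure M {x. z x \<le> c \<and> c < u x} = 0" (is "emeasure M ?D = 0") for c
  proof (rule ccontr)
    assume "emeasure M ?D \<noteq> 0"
    then have pos: "0 < emeasure M ?D" by (simp add: zero_less_iff_neq_zero)
    obtain D where D: "compact D" "D \<subseteq> ?D" "0 < emeasure M D"
      by (rule radon_inner_compact[OF rM level pos])
    have "\<exists>x\<in>D. \<forall>W. open W \<and> x \<in> W \<longrightarrow> emeasure M (D \<inter> W) \<noteq> 0"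
    proof (rule ccontr)
      assume "\<not> ?thesis"
      then have "emeasure M D = 0" by (intro null_if_locally_null[OF rM D(1)]) blast
      with D(3) show False
        by simp
    qed
    then obtain x where x: "x \<in> D" and charged: "\<And>W. open W \<Longrightarrow> x \<in> W \<Longrightarrow> emeasure M (D \<inter> W) \<noteq> 0"
      by blast
    have "c < emeasure N (Pair x -` U)"
      using D(2) x unfolding u_def by blast
    then obtain K where K: "compact K" "K \<subseteq> Pair x -` U" "c < emeasure N K"
      by (rule radon_inner_compact[OF rN section_borel[OF Ub]])
    have "{x} \<times> K \<subseteq> U"
      using K(2) by auto
    from Elementary_Topology.tube_lemma[OF K(1) U this]
    obtain W where W: "x \<in> W" "open W" "W \<times> K \<subseteq> U"
      by (elim exE conjE)
    have DW: "D \<inter> W \<in> sets borel"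
      by (rule sets.Int[OF compact_borel[OF D(1)] borel_open[OF W(2)]])
    have "0 < emeasure M (D \<inter> W)"
      using charged[OF W(2,1)] by (simp add: zero_less_iff_neq_zero)
    then obtain D' where D': "compact D'" "D' \<subseteq> D \<inter> W" "0 < emeasure M D'"
      by (rule radon_inner_compact[OF rM DW])
    define Q where "Q = D' \<times> K"
    have Q: "compact Q" "Q \<subseteq> U"
      unfolding Q_def by (rule compact_Times[OF D'(1) K(1)]) (use D'(2) W(3) in blast)
    have QZ: "Q - Z \<in> sets borel"
      using compact_borel[OF Q(1)] Z(1) by simp
    \<comment> \<open>Over \<open>D'\<close> the section of \<open>Q\<close> has measure above \<open>c\<close> and that of \<open>Z\<close> at most \<open>c\<close>.\<close>
    have "emeasure N (Pair y -` (Q - Z)) \<noteq> 0" if "y \<in> D'" for y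
    proof
      assume zero: "emeasure N (Pair y -` (Q - Z)) = 0"
      have "emeasure N K \<le> emeasure N (Pair y -` (Q - Z) \<union> Pair y -` Z)"
      proof (rule emeasure_mono)
        show "K \<subseteq> Pair y -` (Q - Z) \<union> Pair y -` Z"
          using that by (auto simp: Q_def)
        show "Pair y -` (Q - Z) \<union> Pair y -` Z \<in> sets N"
          using section_borel[OF QZ] section_borel[OF Z(1)] by (intro sets.Un) simp_all
      qed
      also have "\<dots> \<le> emeasure N (Pair y -` (Q - Z)) + emeasure N (Pair y -` Z)"
        using section_borel[OF QZ] section_borel[OF Z(1)] by (intro emeasure_subadditive) simp_all
      also have "\<dots> = z y"
        unfolding zero z_def by simp
      also have "\<dots> \<le> c"
        using that D'(2) D(2) by blast
      finally show False
        using K(3) by simp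
    qed
    moreover have "AE y in M. emeasure N (Pair y -` (Q - Z)) = 0"
      using null[OF Q] unfolding emeasure_iter_measure[OF M sN QZ]
      by (subst (asm) nn_integral_0_iff_AE) (use sigma_radon_measurable[OF M section_measure_measurable[OF sN QZ]] in simp_all)
    ultimately have "AE y in M. y \<notin> D'" by (elim eventually_mono) blast
    then have "emeasure M D' = 0"
      using compact_borel[OF D'(1)] by (subst (asm) AE_iff_measurable[of D']) (auto simp: radon_space[OF rM])
    with D'(3) show False
      by simp
  qed
  \<comment> \<open>Countably many levels suffice to separate \<open>z x < u x\<close>.\<close>
  have "AE x in M. \<forall>r::rat. \<not> (z x \<le> ennreal (real_of_rat r) \<and> ennreal (real_of_rat r) < u x)"
  proof (subst AE_all_countable, rule allI)
    fix r :: rat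
    show "AE x in M. \<not> (z x \<le> ennreal (real_of_rat r) \<and> ennreal (real_of_rat r) < u x)"
      using level_null[of "ennreal (real_of_rat r)"] level[of "ennreal (real_of_rat r)"]
      by (subst AE_iff_measurable[of "{x. z x \<le> ennreal (real_of_rat r) \<and> ennreal (real_of_rat r) < u x}"])
        (auto simp: radon_space[OF rM])
  qed
  then have "AE x in M. emeasure N (Pair x -` (U - Z)) = 0"
  proof (rule eventually_mono)
    fix x
    assume *: "\<forall>r::rat. \<not> (z x \<le> ennreal (real_of_rat r) \<and> ennreal (real_of_rat r) < u x)"
    have "\<not> z x < u x"
    proof
      assume "z x < u x"
      from ennreal_rat_dense[OF this]
      obtain r where r: "z x < ennreal (real_of_rat r)" "ennreal (real_of_rat r) < u x"
        by (elim exE conjE)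
      show False
        using spec[OF *, of r] less_imp_le[OF r(1)] r(2) by (elim notE) (rule conjI)
    qed
    then have le: "u x \<le> z x" by (rule leI)
    have "emeasure N (Pair x -` (U - Z)) = u x - z x"
      unfolding u_def z_def vimage_Diff
    proof (rule emeasure_Diff)
      show "Pair x -` Z \<subseteq> Pair x -` U"
        using Z(2) by blast
    qed (use section_borel[OF Ub] section_borel[OF Z(1)] in simp_all)
    also have "\<dots> = 0"
      using le by (simp only: diff_eq_0_iff_ennreal) (simp add: z_def u_def less_top[symmetric])
    finally show "emeasure N (Pair x -` (U - Z)) = 0" .
  qed
  moreover have UZ: "U - Z \<in> sets borel"
    using Ub Z(1) by simp
  ultimately show ?thesis
    unfolding emeasure_iter_measure[OF M sN UZ]
    by (subst nn_integral_0_iff_AE) (use sigma_radon_measurable[OF M section_measure_measurable[OF sN UZ]] in simp_all)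
qed

lemma iter_measure_radon_finite:
  fixes M :: "'a::t2_space measure" and N :: "'b::t2_space measure"
  assumes M: "finite_radon M" and N: "finite_radon N"
  shows "radon (iter_measure M N)"
proof -
  let ?J = "iter_measure M N"
  note sM = finite_radon_sigma_radon[OF M] and sN = finite_radon_sigma_radon[OF N]
  have "emeasure ?J (UNIV \<times> UNIV) = emeasure M UNIV * emeasure N UNIV"
    by (rule emeasure_iter_measure_Times[OF sM sN]) simp_all
  also have "\<dots> < \<infinity>"
    using M N unfolding finite_radon_def by (simp add: ennreal_mult_less_top)
  finally have UNIV: "emeasure ?J UNIV < \<infinity>" by simp
  have fin: "emeasure ?J B \<noteq> \<infinity>" for B
    using emeasure_space[of ?J B] UNIV by (auto simp: top_unique)
  show ?thesis
  proof (rule radonI_open[OF sets_iter_measure UNIV])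
    fix U :: "('a \<times> 'b) set" and e :: real
    assume U: "open U" and e: "0 < e"
    obtain Z where Z: "\<And>n. compact (Z n)" "\<And>n. Z n \<subseteq> U" "incseq Z"
      and null: "\<And>Q. compact Q \<Longrightarrow> Q \<subseteq> U \<Longrightarrow> emeasure ?J (Q - (\<Union>n. Z n)) = 0"
      using compact_exhaustion[OF sets_iter_measure UNIV, of U] by blast
    have Zb: "Z n \<in> sets borel" for n
      using Z(1) by (rule compact_borel)
    have null_U: "emeasure ?J (U - (\<Union>n. Z n)) = 0"
    proof (rule iter_measure_null_if_compacts_null[OF sM N U _ _ null])
      show "(\<Union>n. Z n) \<in> sets borel"
        using Zb by simp
      show "(\<Union>n. Z n) \<subseteq> U"
        using Z(2) by blast
    qed
    have "(\<lambda>n. emeasure ?J (U - Z n)) \<longlonglongrightarrow> emeasure ?J (\<Inter>n. U - Z n)"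
    proof (rule Lim_emeasure_decseq)
      show "range (\<lambda>n. U - Z n) \<subseteq> sets ?J"
        using U Zb by auto
      show "decseq (\<lambda>n. U - Z n)"
        using monoD[OF Z(3)] unfolding decseq_def by blast
    qed (rule fin)
    moreover have "(\<Inter>n. U - Z n) = U - (\<Union>n. Z n)" by blast
    ultimately have "(\<lambda>n. emeasure ?J (U - Z n)) \<longlonglongrightarrow> 0"
      using null_U by (simp only:)
    then have "\<forall>\<^sub>F n in sequentially. emeasure ?J (U - Z n) < ennreal e"
      by (rule order_tendstoD) (use e in simp)
    then obtain n where "emeasure ?J (U - Z n) < ennreal e"
      unfolding eventually_sequentially by blast
    then have "emeasure ?J (U - Z n) \<le> ennreal e" by (rule less_imp_le)
    with Z(1,2)[of n] have "compact (Z n) \<and> Z n \<subseteq> U \<and> emeasure ?J (U - Z n) \<le> ennreal e"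
      by (intro conjI)
    then show "\<exists>K. compact K \<and> K \<subseteq> U \<and> emeasure ?J (U - K) \<le> ennreal e"
      by (rule exI)
  qed
qed

lemma compact_subset_Times:
  fixes C :: "('a::t2_space \<times> 'b::t2_space) set"
  assumes "compact C"
  obtains K L where "compact K" "compact L" "C \<subseteq> K \<times> L"
proof
  show "compact (fst ` C)" "compact (snd ` C)"
    by (rule compact_continuous_image[OF _ assms], intro continuous_intros)+
  show "C \<subseteq> fst ` C \<times> snd ` C" by (rule subset_fst_snd)
qed

lemma incseq_Times_exhaust:
  fixes X :: "nat \<Rightarrow> 'a set" and Y :: "nat \<Rightarrow> 'b set"
  assumes X: "(\<Union>n. X n) = UNIV" "incseq X" and Y: "(\<Union>n. Y n) = UNIV" "incseq Y"
  obtains n where "z \<in> X n \<times> Y n"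
proof -
  have "fst z \<in> (\<Union>n. X n)" "snd z \<in> (\<Union>n. Y n)"
    unfolding X(1) Y(1) by simp_all
  then obtain m n where mn: "fst z \<in> X m" "snd z \<in> Y n" by blast
  have "fst z \<in> X (max m n)" "snd z \<in> Y (max m n)"
    using mn monoD[OF X(2), of m "max m n"] monoD[OF Y(2), of n "max m n"] by auto
  then show ?thesis
    using that by (simp add: mem_Times_iff)
qed

text \<open>
  Each truncation to a box of finite factors is Radon by the finite case and agrees with the full
  iterated integral on Borel subsets of the box.
\<close>

lemma iter_measure_radon:
  fixes M :: "'a::t2_space measure" and N :: "'b::t2_space measure"
  assumes M: "sigma_radon M" and N: "sigma_radon N"
  shows "radon (iter_measure M N)"
proof (rule radonI[OF sets_iter_measure])
  let ?J = "iter_measure M N"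
  note rM = sigma_radon_radon[OF M] and rN = sigma_radon_radon[OF N]
  fix C :: "('a \<times> 'b) set"
  assume "compact C"
  then obtain K L where KL: "compact K" "compact L" "C \<subseteq> K \<times> L"
    by (rule compact_subset_Times)
  have "emeasure ?J C \<le> emeasure ?J (K \<times> L)"
    by (rule emeasure_mono[OF KL(3)])
      (use borel_Times[OF compact_borel[OF KL(1)] compact_borel[OF KL(2)]] in simp)
  also have "\<dots> = emeasure M K * emeasure N L"
    by (rule emeasure_iter_measure_Times[OF M N compact_borel[OF KL(1)] compact_borel[OF KL(2)]])
  also have "\<dots> < \<infinity>"
    using radon_compact_finite[OF rM KL(1)] radon_compact_finite[OF rN KL(2)]
    by (simp add: ennreal_mult_less_top)
  finally show "emeasure ?J C < \<infinity>" .
next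
  let ?J = "iter_measure M N"
  note rM = sigma_radon_radon[OF M] and rN = sigma_radon_radon[OF N]
  fix B :: "('a \<times> 'b) set" and c
  assume B: "B \<in> sets borel" and c: "c < emeasure ?J B"
  obtain X :: "nat \<Rightarrow> 'a set" where X: "\<And>n. X n \<in> sets borel" "(\<Union>n. X n) = UNIV" "incseq X"
    "\<And>n. finite_radon (density M (indicator (X n)))"
    using sigma_radon_exhaust[OF M] by blast
  obtain Y :: "nat \<Rightarrow> 'b set" where Y: "\<And>n. Y n \<in> sets borel" "(\<Union>n. Y n) = UNIV" "incseq Y"
    "\<And>n. finite_radon (density N (indicator (Y n)))"
    using sigma_radon_exhaust[OF N] by blast
  let ?J' = "\<lambda>n. iter_measure (density M (indicator (X n))) (density N (indicator (Y n)))"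
  have Bn: "B \<inter> (X n \<times> Y n) \<in> sets borel" for n
    by (rule sets.Int[OF B borel_Times[OF X(1) Y(1)]])
  have restr: "emeasure (?J' n) D = emeasure ?J D" if D: "D \<in> sets borel" "D \<subseteq> X n \<times> Y n" for n D
  proof -
    have "emeasure (?J' n) D = (\<integral>\<^sup>+x. emeasure (density N (indicator (Y n))) (Pair x -` D) \<partial>density M (indicator (X n)))"
      by (rule emeasure_iter_measure[OF finite_radon_sigma_radon[OF X(4)] finite_radon_sigma_radon[OF Y(4)] D(1)])
    also have "\<dots> = (\<integral>\<^sup>+x. emeasure N (Pair x -` D) \<partial>density M (indicator (X n)))"
    proof (rule nn_integral_cong)
      fix x
      have "emeasure (density N (indicator (Y n))) (Pair x -` D) = emeasure N (Y n \<inter> Pair x -` D)"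
        by (rule emeasure_restricted) (use Y(1) section_borel[OF D(1)] sigma_radon_sets[OF N] in simp_all)
      also have "Y n \<inter> Pair x -` D = Pair x -` D"
        using D(2) by blast
      finally show "emeasure (density N (indicator (Y n))) (Pair x -` D) = emeasure N (Pair x -` D)" .
    qed
    also have "\<dots> = (\<integral>\<^sup>+x. indicator (X n) x * emeasure N (Pair x -` D) \<partial>M)"
      by (rule nn_integral_density)
        (use X(1) sigma_radon_sets[OF M] sigma_radon_measurable[OF M section_measure_measurable[OF N D(1)]] in simp_all)
    also have "\<dots> = (\<integral>\<^sup>+x. emeasure N (Pair x -` D) \<partial>M)"
    proof (rule nn_integral_cong)
      fix x
      show "indicator (X n) x * emeasure N (Pair x -` D) = emeasure N (Pair x -` D)"
      proof (cases "x \<in> X n")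
        case False
        then have "Pair x -` D = {}"
          using D(2) by blast
        then show ?thesis by simp
      qed simp
    qed
    also have "\<dots> = emeasure ?J D" by (rule emeasure_iter_measure[OF M N D(1), symmetric])
    finally show ?thesis .
  qed
  have "(SUP n. emeasure ?J (B \<inter> (X n \<times> Y n))) = emeasure ?J (\<Union>n. B \<inter> (X n \<times> Y n))"
  proof (rule SUP_emeasure_incseq)
    show "range (\<lambda>n. B \<inter> X n \<times> Y n) \<subseteq> sets ?J"
      using Bn by auto
    show "incseq (\<lambda>n. B \<inter> X n \<times> Y n)"
      using monoD[OF X(3)] monoD[OF Y(3)] unfolding incseq_def by blast
  qed
  also have "(\<Union>n. B \<inter> (X n \<times> Y n)) = B"
  proof (intro equalityI subsetI)
    fix z
    assume z: "z \<in> B"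
    obtain n where "z \<in> X n \<times> Y n"
      by (rule incseq_Times_exhaust[OF X(2,3) Y(2,3)])
    then show "z \<in> (\<Union>n. B \<inter> (X n \<times> Y n))"
      using z by blast
  qed blast
  finally have "c < (SUP n. emeasure ?J (B \<inter> (X n \<times> Y n)))"
    using c by simp
  then obtain n where "c < emeasure ?J (B \<inter> (X n \<times> Y n))"
    unfolding less_SUP_iff by (elim bexE)
  also have "\<dots> = emeasure (?J' n) (B \<inter> (X n \<times> Y n))"
    by (rule restr[symmetric, OF Bn]) simp
  finally have less: "c < emeasure (?J' n) (B \<inter> (X n \<times> Y n))" .
  obtain C where C: "compact C" "C \<subseteq> B \<inter> (X n \<times> Y n)" "c < emeasure (?J' n) C"
    by (rule radon_inner_compact[OF iter_measure_radon_finite[OF X(4) Y(4)] Bn less])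
  have "emeasure (?J' n) C = emeasure ?J C"
    by (rule restr[OF compact_borel[OF C(1)]]) (use C(2) in blast)
  with C show "\<exists>K. compact K \<and> K \<subseteq> B \<and> c < emeasure ?J K"
    by (intro exI[of _ C]) auto
qed

lemma radon_eqI_compact:
  fixes R R' :: "'a::t2_space measure"
  assumes R: "radon R" "radon R'" and eq: "\<And>C. compact C \<Longrightarrow> emeasure R C = emeasure R' C"
  shows "R = R'"
proof (rule measure_eqI)
  show "sets R = sets R'"
    using R by (simp add: radon_sets)
  fix B
  assume "B \<in> sets R"
  then have B: "B \<in> sets borel"
    using R by (simp add: radon_sets)
  have "emeasure R B = (SUP K \<in> {K. compact K \<and> K \<subseteq> B}. emeasure R K)"
    using R(1) B unfolding radon_def by blast
  also have "\<dots> = (SUP K \<in> {K. compact K \<and> K \<subseteq> B}. emeasure R' K)"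
    by (rule SUP_cong[OF refl], rule eq) simp
  also have "\<dots> = emeasure R' B"
    using R(2) B unfolding radon_def by simp
  finally show "emeasure R B = emeasure R' B" .
qed

text \<open>
  Compact boxes determine the measure on the product \<open>\<sigma>\<close>-algebra inside a fixed box \<open>K \<times> L\<close>. A
  compact subset of an open set \<open>U\<close> is covered by finitely many open boxes inside \<open>U\<close>, a set of that
  \<open>\<sigma>\<close>-algebra, so inner regularity carries the agreement to open sets, and passing to complements in
  \<open>K \<times> L\<close> to compact sets.
\<close>

lemma radon_eqI_boxes:
  fixes R R' :: "('a::t2_space \<times> 'b::t2_space) measure"
  assumes R: "radon R" and R': "radon R'"
    and eq: "\<And>K L. compact K \<Longrightarrow> compact L \<Longrightarrow> emeasure R (K \<times> L) = emeasure R' (K \<times> L)"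
  shows "R = R'"
proof (rule radon_eqI_compact[OF R R'])
  fix C :: "('a \<times> 'b) set"
  assume C: "compact C"
  obtain K L where KL: "compact K" "compact L" "C \<subseteq> K \<times> L"
    by (rule compact_subset_Times[OF C])
  let ?O = "K \<times> L"
  have O: "?O \<in> sets borel"
    by (rule borel_Times[OF compact_borel[OF KL(1)] compact_borel[OF KL(2)]])
  have fin: "emeasure Q S < \<infinity>" if "radon Q" "S \<subseteq> ?O" for Q :: "('a \<times> 'b) measure" and S
  proof -
    have "emeasure Q S \<le> emeasure Q ?O"
      by (rule emeasure_mono[OF that(2)]) (use O radon_sets[OF that(1)] in simp)
    also have "\<dots> < \<infinity>"
      by (rule radon_compact_finite[OF that(1) compact_Times[OF KL(1,2)]])
    finally show ?thesis .
  qed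
  define E where "E = {A \<times> B | (A :: 'a set) (B :: 'b set). closed A \<and> closed B}"
  have E_borel: "E \<subseteq> sets borel"
    unfolding E_def by (auto intro!: borel_Times)
  have agree: "emeasure R (?O \<inter> S) = emeasure R' (?O \<inter> S)" if S: "S \<in> sigma_sets UNIV E" for S
  proof -
    let ?D = "\<lambda>Q. distr (density Q (indicator ?O)) (sigma UNIV E) (\<lambda>z. z)"
    have D: "emeasure (?D Q) T = emeasure Q (?O \<inter> T)" if Q: "radon Q" and T: "T \<in> sigma_sets UNIV E"
      for Q :: "('a \<times> 'b) measure" and T
    proof -
      have Tb: "T \<in> sets borel"
        using sets.sigma_sets_subset[OF E_borel] T by auto
      have "(\<lambda>z. z) \<in> measurable borel (sigma UNIV E)"
        by (rule measurable_measure_of) (use E_borel in auto)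
      then have meas: "(\<lambda>z. z) \<in> measurable (density Q (indicator ?O)) (sigma UNIV E)"
        using radon_sets[OF Q] by (simp cong: measurable_cong_sets)
      have "emeasure (?D Q) T = emeasure (density Q (indicator ?O)) ((\<lambda>z. z) -` T \<inter> space (density Q (indicator ?O)))"
        by (rule emeasure_distr[OF meas]) (use T in simp)
      also have "(\<lambda>z. z) -` T \<inter> space (density Q (indicator ?O)) = T"
        using radon_space[OF Q] by simp
      also have "emeasure (density Q (indicator ?O)) T = emeasure Q (?O \<inter> T)"
        by (rule emeasure_restricted) (use radon_sets[OF Q] O Tb in simp_all)
      finally show ?thesis .
    qed
    have "?D R = ?D R'"
    proof (rule measure_eqI_generator_eq[where E=E and \<Omega>=UNIV and A="\<lambda>_. UNIV \<times> UNIV"])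
      show "Int_stable E"
      proof (rule Int_stableI)
        fix X Y
        assume "X \<in> E" "Y \<in> E"
        then obtain A B A' B' where "X = A \<times> B" "Y = A' \<times> B'" "closed A" "closed B" "closed A'" "closed B'"
          unfolding E_def by blast
        then have "X \<inter> Y = (A \<inter> A') \<times> (B \<inter> B')" "closed (A \<inter> A')" "closed (B \<inter> B')"
          by (simp_all add: Times_Int_Times closed_Int)
        then show "X \<inter> Y \<in> E"
          unfolding E_def by blast
      qed
      show "E \<subseteq> Pow UNIV" by simp
      fix X
      assume X: "X \<in> E"
      then obtain A B where AB: "X = A \<times> B" "closed A" "closed B"
        unfolding E_def by blast
      have "emeasure R (?O \<inter> X) = emeasure R' (?O \<inter> X)"
        unfolding AB(1) Times_Int_Times
        by (rule eq[OF compact_Int_closed[OF KL(1) AB(2)] compact_Int_closed[OF KL(2) AB(3)]])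
      then show "emeasure (?D R) X = emeasure (?D R') X"
        using D[OF R sigma_sets.Basic[OF X]] D[OF R' sigma_sets.Basic[OF X]] by simp
    next
      have "UNIV \<times> UNIV \<in> E"
        unfolding E_def by blast
      then show "range (\<lambda>_::nat. UNIV \<times> UNIV) \<subseteq> E" by blast
      show "emeasure (?D R) (UNIV \<times> UNIV) \<noteq> \<infinity>"
        using D[OF R sigma_sets.Basic[OF \<open>UNIV \<times> UNIV \<in> E\<close>]] fin[OF R, of "?O \<inter> UNIV \<times> UNIV"] by simp
    qed simp_all
    then show ?thesis
      using D[OF R S] D[OF R' S] by simp
  qed
  have open_box: "A \<times> B \<in> sigma_sets UNIV E" if "open A" "open B" for A B
  proof -
    interpret sigma_algebra UNIV "sigma_sets UNIV E"
      by (rule sigma_algebra_sigma_sets) simp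
    have "(- A) \<times> UNIV \<in> sigma_sets UNIV E" "UNIV \<times> (- B) \<in> sigma_sets UNIV E"
      using that unfolding E_def by (intro sigma_sets.Basic; blast)+
    then have "UNIV - ((- A) \<times> UNIV \<union> UNIV \<times> (- B)) \<in> sigma_sets UNIV E"
      by (intro compl_sets Un)
    also have "UNIV - ((- A) \<times> UNIV \<union> UNIV \<times> (- B)) = A \<times> B" by auto
    finally show ?thesis .
  qed
  have open_le: "emeasure Q (?O \<inter> U) \<le> emeasure Q' (?O \<inter> U)"
    if U: "open U" and Q: "radon Q" "radon Q'"
      and ag: "\<And>S. S \<in> sigma_sets UNIV E \<Longrightarrow> emeasure Q (?O \<inter> S) = emeasure Q' (?O \<inter> S)" for Q Q' U
  proof (rule ccontr)
    assume "\<not> ?thesis"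
    then have lt: "emeasure Q' (?O \<inter> U) < emeasure Q (?O \<inter> U)"
      by (rule not_le_imp_less)
    have OU: "?O \<inter> U \<in> sets borel"
      using O U by simp
    obtain D where D: "compact D" "D \<subseteq> ?O \<inter> U" "emeasure Q' (?O \<inter> U) < emeasure Q D"
      by (rule radon_inner_compact[OF Q(1) OU lt])
    have "\<exists>A B. open A \<and> open B \<and> z \<in> A \<times> B \<and> A \<times> B \<subseteq> U" if "z \<in> D" for z
      using U D(2) that unfolding open_prod_def by blast
    then obtain A B where AB: "\<And>z. z \<in> D \<Longrightarrow> open (A z)" "\<And>z. z \<in> D \<Longrightarrow> open (B z)"
      "\<And>z. z \<in> D \<Longrightarrow> z \<in> A z \<times> B z" "\<And>z. z \<in> D \<Longrightarrow> A z \<times> B z \<subseteq> U"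
      by metis
    have cover: "D \<subseteq> (\<Union>z\<in>D. A z \<times> B z)"
      using AB(3) by blast
    obtain F where F: "F \<subseteq> D" "finite F" "D \<subseteq> (\<Union>z\<in>F. A z \<times> B z)"
      by (rule compactE_image[OF D(1) open_Times[OF AB(1,2)] cover])
    let ?V = "\<Union>z\<in>F. A z \<times> B z"
    interpret sigma_algebra UNIV "sigma_sets UNIV E"
      by (rule sigma_algebra_sigma_sets) simp
    have V: "?V \<in> sigma_sets UNIV E"
      by (rule finite_UN[OF F(2)], rule open_box) (use AB(1,2) F(1) in blast)+
    have Vb: "?O \<inter> ?V \<in> sets borel"
      using O sets.sigma_sets_subset[OF E_borel] V by (intro sets.Int) auto
    have "emeasure Q D \<le> emeasure Q (?O \<inter> ?V)"
      by (rule emeasure_mono) (use D(2) F(3) Vb radon_sets[OF Q(1)] in auto)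
    also have "\<dots> = emeasure Q' (?O \<inter> ?V)" by (rule ag[OF V])
    also have "\<dots> \<le> emeasure Q' (?O \<inter> U)"
      by (rule emeasure_mono) (use AB(4) F(1) OU radon_sets[OF Q(2)] in auto)
    finally show False
      using D(3) by simp
  qed
  have split: "emeasure Q ?O = emeasure Q C + emeasure Q (?O \<inter> - C)" if "radon Q" for Q
  proof -
    have "C \<union> (?O \<inter> - C) = ?O"
      using KL(3) by blast
    then show ?thesis
      using plus_emeasure[of C Q "?O \<inter> - C"] compact_borel[OF C] O radon_sets[OF that] by simp
  qed
  have "emeasure R (?O \<inter> - C) = emeasure R' (?O \<inter> - C)"
  proof (rule antisym)
    have "open (- C)"
      using compact_imp_closed[OF C] by (rule open_Compl)
    then show "emeasure R (?O \<inter> - C) \<le> emeasure R' (?O \<inter> - C)" "emeasure R' (?O \<inter> - C) \<le> emeasure R (?O \<inter> - C)"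
      using R R' agree by (intro open_le; simp)+
  qed
  moreover have "emeasure R ?O = emeasure R' ?O" by (rule eq[OF KL(1,2)])
  ultimately have "emeasure R' (?O \<inter> - C) + emeasure R C = emeasure R' (?O \<inter> - C) + emeasure R' C"
    using split[OF R] split[OF R'] by (simp add: add.commute)
  then show "emeasure R C = emeasure R' C"
    using fin[OF R', of "?O \<inter> - C"] by (auto simp: ennreal_add_left_cancel)
qed

lemma radon_prod_eq:
  fixes M :: "'a::t2_space measure" and N :: "'b::t2_space measure"
  assumes M: "sigma_radon M" and N: "sigma_radon N"
  shows "radon_prod M N = iter_measure M N"
  unfolding radon_prod_def
proof (rule the_equality)
  have box: "emeasure (iter_measure M N) (K \<times> L) = emeasure M K * emeasure N L" if "compact K" "compact L" for K L
    by (rule emeasure_iter_measure_Times[OF M N compact_borel[OF that(1)] compact_borel[OF that(2)]])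
  then show "radon (iter_measure M N) \<and> (\<forall>K L. compact K \<and> compact L \<longrightarrow>
      emeasure (iter_measure M N) (K \<times> L) = emeasure M K * emeasure N L)"
    using iter_measure_radon[OF M N] by simp
  fix R
  assume R: "radon R \<and> (\<forall>K L. compact K \<and> compact L \<longrightarrow> emeasure R (K \<times> L) = emeasure M K * emeasure N L)"
  show "R = iter_measure M N"
    by (rule radon_eqI_boxes[OF conjunct1[OF R] iter_measure_radon[OF M N]]) (use R box in simp)
qed

text \<open>
  Interchanging the coordinates of \<open>N \<otimes> M\<close> gives a Radon measure with the values of \<open>M \<otimes> N\<close> on compact
  boxes, so uniqueness yields Tonelli's theorem for all Borel functions on the product space.
\<close>

lemma nn_integral_iter_measure_swap:
  fixes M :: "'a::t2_space measure" and N :: "'b::t2_space measure" and h :: "'a \<times> 'b \<Rightarrow> ennreal"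
  assumes M: "sigma_radon M" and N: "sigma_radon N" and h: "h \<in> borel_measurable borel"
  shows "(\<integral>\<^sup>+x. \<integral>\<^sup>+y. h (x, y) \<partial>N \<partial>M) = (\<integral>\<^sup>+y. \<integral>\<^sup>+x. h (x, y) \<partial>M \<partial>N)"
proof -
  let ?s = "\<lambda>(y, x). (x, y) :: 'a \<times> 'b"
  have cont: "continuous_on UNIV ?s"
    unfolding case_prod_unfold by (intro continuous_intros)
  then have sb: "?s \<in> measurable borel borel" by (rule borel_measurable_continuous_onI)
  then have s: "?s \<in> measurable (iter_measure N M) borel"
    using measurable_cong_sets[OF sets_iter_measure refl, of N M borel] by blast
  let ?R = "distr (iter_measure N M) borel ?s"
  have emR: "emeasure ?R B = emeasure (iter_measure N M) (?s -` B)" if "B \<in> sets borel" for B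
    using emeasure_distr[OF s that] by simp
  have "radon ?R"
  proof (rule radonI)
    show "sets ?R = sets borel" by simp
    fix C :: "('a \<times> 'b) set"
    assume C: "compact C"
    have vim: "?s -` C = (\<lambda>(x, y). (y, x)) ` C" by force
    have "compact ((\<lambda>(x, y). (y, x)) ` C :: ('b \<times> 'a) set)"
      unfolding case_prod_unfold by (rule compact_continuous_image[OF _ C]) (intro continuous_intros)
    then show "emeasure ?R C < \<infinity>"
      unfolding emR[OF compact_borel[OF C]] vim
      by (rule radon_compact_finite[OF iter_measure_radon[OF N M]])
  next
    fix B :: "('a \<times> 'b) set" and c
    assume B: "B \<in> sets borel" and c: "c < emeasure ?R B"
    then have c: "c < emeasure (iter_measure N M) (?s -` B)"
      using emR[OF B] by simp
    obtain K where K: "compact K" "K \<subseteq> ?s -` B" "c < emeasure (iter_measure N M) K"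
      by (rule radon_inner_compact[OF iter_measure_radon[OF N M] measurable_sets_borel[OF sb B] c])
    have cK: "compact (?s ` K)"
      by (rule compact_continuous_image[OF continuous_on_subset[OF cont] K(1)]) simp
    have "?s -` (?s ` K) = K" by force
    then have "c < emeasure ?R (?s ` K)"
      using K(3) emR[OF compact_borel[OF cK]] by simp
    moreover have "?s ` K \<subseteq> B"
      using K(2) by blast
    ultimately show "\<exists>K. compact K \<and> K \<subseteq> B \<and> c < emeasure ?R K"
      using cK by blast
  qed
  then have "?R = iter_measure M N"
  proof (rule radon_eqI_boxes[OF _ iter_measure_radon[OF M N]])
    fix K :: "'a set" and L :: "'b set"
    assume "compact K" "compact L"
    then have KL: "K \<in> sets borel" "L \<in> sets borel" by (simp_all add: compact_borel)
    have "?s -` (K \<times> L) = L \<times> K" by auto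
    then show "emeasure ?R (K \<times> L) = emeasure (iter_measure M N) (K \<times> L)"
      unfolding emR[OF borel_Times[OF KL]]
      by (simp add: emeasure_iter_measure_Times[OF N M KL(2,1)] emeasure_iter_measure_Times[OF M N KL] mult.commute)
  qed
  have "(\<integral>\<^sup>+x. \<integral>\<^sup>+y. h (x, y) \<partial>N \<partial>M) = (\<integral>\<^sup>+z. h z \<partial>iter_measure M N)"
    by (rule nn_integral_iter_measure[OF M N h, symmetric])
  also have "\<dots> = (\<integral>\<^sup>+z. h z \<partial>?R)"
    unfolding \<open>?R = iter_measure M N\<close> ..
  also have "\<dots> = (\<integral>\<^sup>+w. h (?s w) \<partial>iter_measure N M)"
    by (rule nn_integral_distr[OF s]) (use h in simp)
  also have "\<dots> = (\<integral>\<^sup>+y. \<integral>\<^sup>+x. h (?s (y, x)) \<partial>M \<partial>N)"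
    by (rule nn_integral_iter_measure[OF N M measurable_compose[OF sb h]])
  finally show ?thesis by simp
qed

section \<open>Mutual energies as double integrals\<close>

definition double_integral :: "('a \<times> 'b \<Rightarrow> ennreal) \<Rightarrow> 'a measure \<Rightarrow> 'b measure \<Rightarrow> ennreal" where
  "double_integral h M N = (\<integral>\<^sup>+x. \<integral>\<^sup>+y. h (x, y) \<partial>N \<partial>M)"

lemma borel_slice:
  fixes h :: "'a::topological_space \<times> 'b::topological_space \<Rightarrow> 'c::topological_space"
  assumes "h \<in> borel_measurable borel"
  shows "(\<lambda>y. h (x, y)) \<in> borel_measurable borel"
proof -
  have "(Pair x :: 'b \<Rightarrow> 'a \<times> 'b) \<in> borel_measurable borel"
    by (intro borel_measurable_continuous_onI continuous_intros)
  from measurable_compose[OF this assms] show ?thesis .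
qed

lemma double_integral_sym:
  fixes M N :: "'a::t2_space measure"
  assumes "sigma_radon M" "sigma_radon N" "h \<in> borel_measurable borel" "\<And>x y. h (x, y) = h (y, x)"
  shows "double_integral h M N = double_integral h N M"
proof -
  have "double_integral h M N = (\<integral>\<^sup>+y. \<integral>\<^sup>+x. h (x, y) \<partial>M \<partial>N)"
    unfolding double_integral_def by (rule nn_integral_iter_measure_swap[OF assms(1-3)])
  also have "\<dots> = double_integral h N M"
    unfolding double_integral_def by (subst assms(4)) (rule refl)
  finally show ?thesis .
qed

lemma nn_integral_density_add:
  assumes "u \<in> borel_measurable S" "v \<in> borel_measurable S" "f \<in> borel_measurable S"
  shows "(\<integral>\<^sup>+x. f x \<partial>density S (\<lambda>x. u x + v x)) = (\<integral>\<^sup>+x. f x \<partial>density S u) + (\<integral>\<^sup>+x. f x \<partial>density S v)"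
proof -
  have "(\<integral>\<^sup>+x. f x \<partial>density S (\<lambda>x. u x + v x)) = (\<integral>\<^sup>+x. u x * f x + v x * f x \<partial>S)"
    using assms by (subst nn_integral_density) (simp_all add: distrib_right)
  also have "\<dots> = (\<integral>\<^sup>+x. u x * f x \<partial>S) + (\<integral>\<^sup>+x. v x * f x \<partial>S)"
    using assms by (intro nn_integral_add) simp_all
  also have "\<dots> = (\<integral>\<^sup>+x. f x \<partial>density S u) + (\<integral>\<^sup>+x. f x \<partial>density S v)"
    using assms by (simp add: nn_integral_density)
  finally show ?thesis .
qed

lemma double_integral_density_add_left:
  fixes X :: "'b::t2_space measure" and S :: "'a::t2_space measure"
  assumes "sigma_radon X" "sets S = sets borel" "u \<in> borel_measurable borel" "v \<in> borel_measurable borel"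
    "h \<in> borel_measurable borel"
  shows "double_integral h (density S (\<lambda>x. u x + v x)) X
    = double_integral h (density S u) X + double_integral h (density S v) X"
  unfolding double_integral_def
  by (rule nn_integral_density_add; rule measurable_if_sets_borel[OF assms(2)])
    (rule assms section_nn_integral_measurable[OF assms(1,5)])+

lemma double_integral_density_add_right:
  fixes X :: "'a::t2_space measure" and S :: "'b::t2_space measure"
  assumes X: "sigma_radon X" and S: "sets S = sets borel"
    and u: "u \<in> borel_measurable borel" and v: "v \<in> borel_measurable borel"
    and su: "sigma_radon (density S u)" and sv: "sigma_radon (density S v)"
    and h: "h \<in> borel_measurable borel"
  shows "double_integral h X (density S (\<lambda>x. u x + v x))
    = double_integral h X (density S u) + double_integral h X (density S v)"
proof -
  have "(\<integral>\<^sup>+y. h (x, y) \<partial>density S (\<lambda>x. u x + v x))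
      = (\<integral>\<^sup>+y. h (x, y) \<partial>density S u) + (\<integral>\<^sup>+y. h (x, y) \<partial>density S v)" for x
    by (rule nn_integral_density_add; rule measurable_if_sets_borel[OF S])
      (rule u v borel_slice[OF h])+
  then show ?thesis
    unfolding double_integral_def
    by (simp only:, intro nn_integral_add sigma_radon_measurable[OF X] section_nn_integral_measurable su sv h)
qed

abbreviation sum_measure :: "'i set \<Rightarrow> ('i \<Rightarrow> 'a::topological_space measure) \<Rightarrow> 'a measure" where
  "sum_measure I p \<equiv> mixture (count_space I) p"

lemma emeasure_sum_measure:
  assumes "\<And>i. i \<in> I \<Longrightarrow> sets (p i) = sets borel" "B \<in> sets borel"
  shows "emeasure (sum_measure I p) B = (\<integral>\<^sup>+i. emeasure (p i) B \<partial>count_space I)"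
  by (rule emeasure_mixture) (use assms in simp_all)

lemma nn_integral_sum_measure:
  assumes "\<And>i. i \<in> I \<Longrightarrow> sets (p i) = sets borel" "h \<in> borel_measurable borel"
  shows "(\<integral>\<^sup>+x. h x \<partial>sum_measure I p) = (\<integral>\<^sup>+i. \<integral>\<^sup>+x. h x \<partial>p i \<partial>count_space I)"
  by (rule nn_integral_mixture[THEN conjunct2]) (use assms in simp_all)

lemma finite_radon_sum_measure:
  assumes I: "finite I" and p: "\<And>i. i \<in> I \<Longrightarrow> finite_radon (p i :: 'a::t2_space measure)"
  shows "finite_radon (sum_measure I p)"
proof -
  have r: "radon (p i)" and f: "emeasure (p i) UNIV < \<infinity>" if "i \<in> I" for i
    using p[OF that] unfolding finite_radon_def by auto
  have sp: "sets (p i) = sets borel" if "i \<in> I" for i by (rule radon_sets[OF r[OF that]])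
  have em: "emeasure (sum_measure I p) B = (\<Sum>i\<in>I. emeasure (p i) B)" if "B \<in> sets borel" for B
    using emeasure_sum_measure[where p=p and I=I, OF sp that] by (simp add: nn_integral_count_space_finite[OF I])
  have le: "emeasure (p i) B \<le> emeasure (p i) UNIV" if "i \<in> I" for i B
    using emeasure_space[of "p i" B] radon_space[OF r[OF that]] by simp
  have fin: "emeasure (p i) B < \<infinity>" if "i \<in> I" for i B
    using le_less_trans[OF le[OF that] f[OF that]] .
  have UNIV: "emeasure (sum_measure I p) UNIV < \<infinity>"
    using em[of UNIV] f I by (simp add: less_top[symmetric])
  moreover have "radon (sum_measure I p)"
  proof (rule radonI_tight[OF sets_mixture])
    fix K :: "'a set"
    assume "compact K"
    then show "emeasure (sum_measure I p) K < \<infinity>"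
      using em[OF compact_borel] fin I by (simp add: less_top[symmetric])
  next
    fix B :: "'a set" and e :: real
    assume B: "B \<in> sets borel" and e: "0 < e"
    define d where "d = e / (card I + 1)"
    have d: "0 < d"
      using e unfolding d_def by simp
    have "\<exists>K. compact K \<and> K \<subseteq> B \<and> emeasure (p i) (B - K) \<le> ennreal d" if "i \<in> I" for i
      by (rule radon_tight[OF r[OF that] B fin[OF that] d]) (intro exI conjI)
    then have "\<exists>K. \<forall>i\<in>I. compact (K i) \<and> K i \<subseteq> B \<and> emeasure (p i) (B - K i) \<le> ennreal d"
      by (intro bchoice ballI)
    then obtain K where "\<forall>i\<in>I. compact (K i) \<and> K i \<subseteq> B \<and> emeasure (p i) (B - K i) \<le> ennreal d"
      by (elim exE)
    then have K: "\<And>i. i \<in> I \<Longrightarrow> compact (K i)" "\<And>i. i \<in> I \<Longrightarrow> K i \<subseteq> B"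
      "\<And>i. i \<in> I \<Longrightarrow> emeasure (p i) (B - K i) \<le> ennreal d"
      by simp_all
    let ?K = "\<Union>i\<in>I. K i"
    have cK: "compact ?K" by (rule compact_UN[OF I K(1)])
    have "emeasure (sum_measure I p) (B - ?K) = (\<Sum>i\<in>I. emeasure (p i) (B - ?K))"
      by (rule em) (use B compact_borel[OF cK] in simp)
    also have "\<dots> \<le> (\<Sum>i\<in>I. ennreal d)"
    proof (rule sum_mono)
      fix i
      assume i: "i \<in> I"
      have "emeasure (p i) (B - ?K) \<le> emeasure (p i) (B - K i)"
        by (rule emeasure_mono) (use i B compact_borel[OF K(1)[OF i]] sp[OF i] in auto)
      also have "\<dots> \<le> ennreal d" by (rule K(3)[OF i])
      finally show "emeasure (p i) (B - ?K) \<le> ennreal d" .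
    qed
    also have "\<dots> = ennreal (card I * d)"
      using d by (simp add: ennreal_mult ennreal_of_nat_eq_real_of_nat)
    also have "\<dots> \<le> ennreal e"
      using e unfolding d_def by (intro ennreal_leI) (simp add: field_simps)
    finally have "emeasure (sum_measure I p) (B - ?K) \<le> ennreal e" .
    moreover have "?K \<subseteq> B"
      using K(2) by blast
    ultimately show "\<exists>K. compact K \<and> K \<subseteq> B \<and> emeasure (sum_measure I p) (B - K) \<le> ennreal e"
      using cK by blast
  qed
  ultimately show ?thesis
    unfolding finite_radon_def by blast
qed

lemma double_integral_sum_measure:
  fixes p :: "'i \<Rightarrow> 'a::t2_space measure" and q :: "'j \<Rightarrow> 'b::t2_space measure"
  assumes p: "\<And>i. i \<in> I \<Longrightarrow> sigma_radon (p i)" and q: "\<And>j. j \<in> J \<Longrightarrow> sigma_radon (q j)"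
    and J: "sigma_radon (sum_measure J q)" "countable J" and h: "h \<in> borel_measurable borel"
  shows "double_integral h (sum_measure I p) (sum_measure J q)
    = (\<integral>\<^sup>+i. \<integral>\<^sup>+j. double_integral h (p i) (q j) \<partial>count_space J \<partial>count_space I)"
proof -
  have "double_integral h (sum_measure I p) (sum_measure J q)
      = (\<integral>\<^sup>+i. \<integral>\<^sup>+x. \<integral>\<^sup>+y. h (x, y) \<partial>sum_measure J q \<partial>p i \<partial>count_space I)"
    unfolding double_integral_def
    by (rule nn_integral_sum_measure) (use sigma_radon_sets[OF p] section_nn_integral_measurable[OF J(1) h] in simp_all)
  also have "\<dots> = (\<integral>\<^sup>+i. \<integral>\<^sup>+j. double_integral h (p i) (q j) \<partial>count_space J \<partial>count_space I)"
  proof (rule nn_integral_cong)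
    fix i
    assume "i \<in> space (count_space I)"
    then have i: "i \<in> I" by simp
    have "(\<integral>\<^sup>+x. \<integral>\<^sup>+y. h (x, y) \<partial>sum_measure J q \<partial>p i)
        = (\<integral>\<^sup>+x. \<integral>\<^sup>+j. \<integral>\<^sup>+y. h (x, y) \<partial>q j \<partial>count_space J \<partial>p i)"
      by (rule nn_integral_cong, rule nn_integral_sum_measure) (use sigma_radon_sets[OF q] borel_slice[OF h] in simp_all)
    also have "\<dots> = (\<integral>\<^sup>+j. \<integral>\<^sup>+x. \<integral>\<^sup>+y. h (x, y) \<partial>q j \<partial>p i \<partial>count_space J)"
      by (rule nn_integral_count_space_nn_integral[OF J(2)], rule sigma_radon_measurable[OF p[OF i]],
          rule section_nn_integral_measurable[OF q h])
    finally show "(\<integral>\<^sup>+x. \<integral>\<^sup>+y. h (x, y) \<partial>sum_measure J q \<partial>p i)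
        = (\<integral>\<^sup>+j. double_integral h (p i) (q j) \<partial>count_space J)"
      unfolding double_integral_def .
  qed
  finally show ?thesis .
qed

section \<open>Kernels\<close>

lemma enn2ereal_eq_enn2real: "x < \<infinity> \<Longrightarrow> enn2ereal x = ereal (enn2real x)"
  by (cases x) simp_all

lemma lower_semicontinuous_borel:
  assumes "lower_semicontinuous u"
  shows "u \<in> borel_measurable borel"
  using assms unfolding lower_semicontinuous_def by (intro borel_measurableI_greater) simp

text \<open>
  On a compact space the open sets \<open>{x. - c < u x}\<close>, for natural numbers \<open>c\<close>, cover everything.
\<close>

lemma Phi_lower_bound:
  fixes u :: "'a::topological_space \<Rightarrow> ereal"
  assumes u: "u \<in> Phi"
  shows "(\<forall>x. 0 \<le> u x) \<or> (compact (UNIV :: 'a set) \<and> (\<exists>c::nat. \<forall>x. - ereal (real c) \<le> u x))"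
proof (rule disjCI)
  assume "\<not> (compact (UNIV :: 'a set) \<and> (\<exists>c::nat. \<forall>x. - ereal (real c) \<le> u x))"
  moreover have "\<exists>c::nat. \<forall>x. - ereal (real c) \<le> u x" if K: "compact (UNIV :: 'a set)"
  proof -
    have opn: "open {x. - ereal (real c) < u x}" for c :: nat
      using u unfolding Phi_def lower_semicontinuous_def by blast
    have "\<exists>c::nat. - ereal (real c) < u x" for x
    proof (cases "u x")
      case (real r)
      obtain c :: nat where "- r < real c"
        using reals_Archimedean2 by (elim exE[OF reals_Archimedean2])
      then show ?thesis
        using real by (intro exI[of _ c]) simp
    next
      case PInf
      then show ?thesis by simp
    next
      case MInf
      then show ?thesis
        using u unfolding Phi_def by simp
    qed
    then have "UNIV \<subseteq> (\<Union>c. {x. - ereal (real c) < u x})" by blast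
    then obtain C where C: "finite C" "UNIV \<subseteq> (\<Union>c\<in>C. {x. - ereal (real c) < u x})"
      by (rule compactE_image[OF K opn])
    have "- ereal (real (Max C)) \<le> u x" for x
    proof -
      obtain c where c: "c \<in> C" "- ereal (real c) < u x"
        using C(2) by blast
      have "- ereal (real (Max C)) \<le> - ereal (real c)"
        using Max_ge[OF C(1) c(1)] by simp
      also have "\<dots> \<le> u x"
        using c(2) by (rule less_imp_le)
      finally show ?thesis .
    qed
    then show ?thesis by (intro exI allI)
  qed
  ultimately have "\<not> compact (UNIV :: 'a set)" by blast
  then show "\<forall>x. 0 \<le> u x"
    using u unfolding Phi_def by simp
qed

definition pos_part :: "('a \<Rightarrow> ereal) \<Rightarrow> 'a \<Rightarrow> ennreal" where
  "pos_part u z = e2ennreal (u z)"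

definition neg_part :: "('a \<Rightarrow> ereal) \<Rightarrow> 'a \<Rightarrow> ennreal" where
  "neg_part u z = e2ennreal (- u z)"

text \<open>
  The mutual energy as a real number; it has this meaning when the integral of the positive part is
  finite, that of the negative part being always finite (\<open>Dn_finite\<close> below).
\<close>

definition real_energy :: "'a kernel \<Rightarrow> 'a measure \<Rightarrow> 'a measure \<Rightarrow> real" where
  "real_energy \<kappa> M N = enn2real (double_integral (pos_part \<kappa>) M N) - enn2real (double_integral (neg_part \<kappa>) M N)"

locale positive_kernel =
  fixes \<kappa> :: "'a::t2_space kernel"
  assumes Phi: "\<kappa> \<in> Phi" and pd: "positive_definite \<kappa>"
begin

abbreviation "Dp \<equiv> double_integral (pos_part \<kappa>)"
abbreviation "Dn \<equiv> double_integral (neg_part \<kappa>)"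

lemma kernel_borel: "\<kappa> \<in> borel_measurable borel"
  using Phi unfolding Phi_def by (simp add: lower_semicontinuous_borel)

lemma parts_borel: "pos_part \<kappa> \<in> borel_measurable borel" "neg_part \<kappa> \<in> borel_measurable borel"
  using kernel_borel unfolding pos_part_def[abs_def] neg_part_def[abs_def] by simp_all

lemma kernel_sym: "\<kappa> (x, y) = \<kappa> (y, x)"
  using pd unfolding positive_definite_def by simp

lemma parts_sym: "pos_part \<kappa> (x, y) = pos_part \<kappa> (y, x)" "neg_part \<kappa> (x, y) = neg_part \<kappa> (y, x)"
  unfolding pos_part_def neg_part_def using kernel_sym[of x y] by simp_all

lemma compact_or_nonneg:
  "(\<forall>z. neg_part \<kappa> z = 0) \<or> (compact (UNIV :: 'a set) \<and> (\<exists>c::nat. \<forall>z. neg_part \<kappa> z \<le> of_nat c))"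
  using Phi_lower_bound[OF Phi]
proof (elim disjE conjE exE)
  assume "\<forall>z. 0 \<le> \<kappa> z"
  then have "- \<kappa> z \<le> 0" for z by (metis ereal_uminus_le_0_iff)
  then have "neg_part \<kappa> z = 0" for z
    unfolding neg_part_def by (rule e2ennreal_neg)
  then show ?thesis by blast
next
  fix c :: nat
  assume K: "compact (UNIV :: ('a \<times> 'a) set)" and c: "\<forall>z. - ereal (real c) \<le> \<kappa> z"
  have "compact (fst ` (UNIV :: ('a \<times> 'a) set))"
    by (rule compact_continuous_image[OF _ K]) (intro continuous_intros)
  then have "compact (UNIV :: 'a set)" by simp
  moreover have "neg_part \<kappa> z \<le> of_nat c" for z
  proof -
    have "- \<kappa> z \<le> ereal (real c)"
      using spec[OF c, of z] by (subst ereal_uminus_le_reorder)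
    then have "e2ennreal (- \<kappa> z) \<le> e2ennreal (ereal (real c))" by (rule e2ennreal_mono)
    also have "\<dots> = of_nat c" by (simp add: ennreal_of_nat_eq_real_of_nat)
    finally show ?thesis
      unfolding neg_part_def .
  qed
  ultimately show ?thesis by blast
qed

text \<open>
  Either the kernel is nonnegative, or the space is compact, and then the negative part is bounded
  and all Radon measures are finite.
\<close>

lemma Dn_finite:
  assumes M: "sigma_radon M" and N: "sigma_radon N"
  shows "Dn M N < \<infinity>"
  using compact_or_nonneg
proof (elim disjE conjE exE)
  assume "\<forall>z. neg_part \<kappa> z = 0"
  then show ?thesis
    unfolding double_integral_def by simp
next
  fix c :: nat
  assume K: "compact (UNIV :: 'a set)" and c: "\<forall>z. neg_part \<kappa> z \<le> of_nat c"
  have "Dn M N \<le> (\<integral>\<^sup>+x. \<integral>\<^sup>+y. of_nat c \<partial>N \<partial>M)"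
    unfolding double_integral_def by (intro nn_integral_mono) (use c in blast)
  also have "\<dots> = of_nat c * emeasure N UNIV * emeasure M UNIV"
    using radon_space[OF sigma_radon_radon[OF M]] radon_space[OF sigma_radon_radon[OF N]] by simp
  also have "\<dots> < \<infinity>"
    using radon_compact_finite[OF sigma_radon_radon[OF M] K] radon_compact_finite[OF sigma_radon_radon[OF N] K]
    by (simp add: ennreal_mult_less_top of_nat_less_top)
  finally show ?thesis .
qed

lemma D_sym:
  assumes "sigma_radon M" "sigma_radon N"
  shows "Dp M N = Dp N M" "Dn M N = Dn N M"
  by (rule double_integral_sym[OF assms parts_borel(1) parts_sym(1)])
    (rule double_integral_sym[OF assms parts_borel(2) parts_sym(2)])

lemma real_energy_sym: "sigma_radon M \<Longrightarrow> sigma_radon N \<Longrightarrow> real_energy \<kappa> M N = real_energy \<kappa> N M"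
  unfolding real_energy_def using D_sym[of M N] by simp

lemma mutual_energy_eq:
  assumes M: "sigma_radon M" and N: "sigma_radon N"
  shows "mutual_energy \<kappa> M N = enn2ereal (Dp M N) - enn2ereal (Dn M N)"
  unfolding mutual_energy_def ext_integral_def radon_prod_eq[OF M N] double_integral_def
    nn_integral_iter_measure[OF M N parts_borel(1), symmetric] nn_integral_iter_measure[OF M N parts_borel(2), symmetric]
  unfolding pos_part_def neg_part_def ..

lemma mutual_energy_finite:
  assumes M: "sigma_radon M" and N: "sigma_radon N" and fin: "Dp M N < \<infinity>"
  shows "mutual_energy \<kappa> M N = ereal (real_energy \<kappa> M N)"
proof -
  have "enn2ereal (Dp M N) = ereal (enn2real (Dp M N))" "enn2ereal (Dn M N) = ereal (enn2real (Dn M N))"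
    using fin Dn_finite[OF M N] by (simp_all add: enn2ereal_eq_enn2real)
  then show ?thesis
    unfolding mutual_energy_eq[OF M N] real_energy_def by simp
qed

lemma mutual_energy_infinite:
  assumes M: "sigma_radon M" and N: "sigma_radon N"
  shows "Dp M N = \<infinity> \<Longrightarrow> mutual_energy \<kappa> M N = \<infinity>" "mutual_energy \<kappa> M N \<noteq> - \<infinity>"
    "mutual_energy \<kappa> M N < \<infinity> \<Longrightarrow> Dp M N < \<infinity>"
proof -
  have n: "enn2ereal (Dn M N) = ereal (enn2real (Dn M N))"
    using Dn_finite[OF M N] by (simp add: enn2ereal_eq_enn2real)
  show inf: "mutual_energy \<kappa> M N = \<infinity>" if "Dp M N = \<infinity>"
    unfolding mutual_energy_eq[OF M N] n that by simp
  show "mutual_energy \<kappa> M N \<noteq> - \<infinity>"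
  proof (cases "Dp M N = \<infinity>")
    case True
    then show ?thesis using inf by simp
  next
    case False
    then show ?thesis using mutual_energy_finite[OF M N] by (simp add: less_top)
  qed
  show "Dp M N < \<infinity>" if "mutual_energy \<kappa> M N < \<infinity>"
    using inf that by (cases "Dp M N = \<infinity>") (auto simp: less_top)
qed

end

section \<open>Positive definiteness for pairs that are not mutually singular\<close>

context positive_kernel
begin

text \<open>
  An infinite mutual energy is excluded as well: the energy of \<open>P - N\<close> would then be defined and
  equal to \<open>- \<infinity>\<close>.
\<close>

lemma singular_energy_inequality:
  assumes P: "sigma_radon P" and N: "sigma_radon N" and sing: "(P, N) \<in> signed_radon"
    and fP: "Dp P P < \<infinity>" and fN: "Dp N N < \<infinity>"
  shows "Dp P N < \<infinity>" and "2 * real_energy \<kappa> P N \<le> real_energy \<kappa> P P + real_energy \<kappa> N N"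
proof -
  have PP: "mutual_energy \<kappa> P P = ereal (real_energy \<kappa> P P)" and NN: "mutual_energy \<kappa> N N = ereal (real_energy \<kappa> N N)"
    by (rule mutual_energy_finite[OF P P fP], rule mutual_energy_finite[OF N N fN])
  have def: "signed_energy_defined \<kappa> (P, N)"
    unfolding signed_energy_defined_def by (simp add: PP NN)
  then have nonneg: "0 \<le> signed_energy \<kappa> (P, N)"
    using pd sing unfolding positive_definite_def by blast
  show fin: "Dp P N < \<infinity>"
  proof (rule ccontr)
    assume "\<not> ?thesis"
    then have "Dp P N = \<infinity>" by (simp add: less_top[symmetric])
    then have "mutual_energy \<kappa> P N = \<infinity>" by (rule mutual_energy_infinite(1)[OF P N])
    then have "signed_energy \<kappa> (P, N) = - \<infinity>"
      unfolding signed_energy_def by (simp add: PP NN)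
    with nonneg show False
      by simp
  qed
  have "mutual_energy \<kappa> P N = ereal (real_energy \<kappa> P N)"
    by (rule mutual_energy_finite[OF P N fin])
  moreover have "mutual_energy \<kappa> N P = ereal (real_energy \<kappa> P N)"
    using mutual_energy_finite[OF N P] fin D_sym(1)[OF P N] real_energy_sym[OF P N] by simp
  ultimately show "2 * real_energy \<kappa> P N \<le> real_energy \<kappa> P P + real_energy \<kappa> N N"
    using nonneg unfolding signed_energy_def by (simp add: PP NN)
qed

lemma real_energy_split:
  assumes "Dp A B = Dp C D + Dp E F + Dp G H + Dp I J" "Dp A B < \<infinity>"
    and "Dn A B = Dn C D + Dn E F + Dn G H + Dn I J" "Dn A B < \<infinity>"
  shows "real_energy \<kappa> A B = real_energy \<kappa> C D + real_energy \<kappa> E F + real_energy \<kappa> G H + real_energy \<kappa> I J"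
proof -
  have "enn2real (Dp A B) = enn2real (Dp C D) + enn2real (Dp E F) + enn2real (Dp G H) + enn2real (Dp I J)"
    using assms(2) unfolding assms(1) by (simp add: enn2real_plus)
  moreover have "enn2real (Dn A B) = enn2real (Dn C D) + enn2real (Dn E F) + enn2real (Dn G H) + enn2real (Dn I J)"
    using assms(4) unfolding assms(3) by (simp add: enn2real_plus)
  ultimately show ?thesis
    unfolding real_energy_def by simp
qed

text \<open>
  With densities \<open>p\<close> and \<open>q\<close> of \<open>P\<close> and \<open>N\<close> with respect to \<open>S = P + N\<close>, the common part \<open>R\<close> has density
  \<open>min p q\<close>, and \<open>P' = P - R\<close> and \<open>N' = N - R\<close> are mutually singular. Expanding all energies
  bilinearly, the terms with \<open>R\<close> cancel from \<open>\<kappa>(P, P) + \<kappa>(N, N) - 2 \<kappa>(P, N)\<close>, which leaves the same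
  expression for \<open>P'\<close> and \<open>N'\<close>.
\<close>

lemma energy_inequality:
  assumes P: "finite_radon P" and N: "finite_radon N"
    and fP: "Dp P P < \<infinity>" and fN: "Dp N N < \<infinity>"
  shows "Dp P N < \<infinity>" and "2 * real_energy \<kappa> P N \<le> real_energy \<kappa> P P + real_energy \<kappa> N N"
proof -
  define S where "S = sum_measure UNIV (\<lambda>b. if b then P else N)"
  have S: "finite_radon S"
    unfolding S_def by (rule finite_radon_sum_measure) (use P N in simp_all)
  have sP: "sets P = sets borel" and sN: "sets N = sets borel" and sS: "sets S = sets borel"
    using P N S unfolding finite_radon_def by (simp_all add: radon_sets)
  have S_eq: "emeasure S B = emeasure P B + emeasure N B" if "B \<in> sets borel" for B
    unfolding S_def using sP sN that
    by (subst emeasure_sum_measure) (simp_all add: nn_integral_count_space_finite UNIV_bool add.commute)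
  interpret S: finite_measure S
    by (rule finite_radon_finite_measure[OF S])
  have ac: "absolutely_continuous S P" "absolutely_continuous S N"
    unfolding absolutely_continuous_def null_sets_def using S_eq sP sN sS by auto
  obtain p where p: "p \<in> borel_measurable S" "density S p = P"
    using S.Radon_Nikodym[OF ac(1)] sP sS by auto
  obtain q where q: "q \<in> borel_measurable S" "density S q = N"
    using S.Radon_Nikodym[OF ac(2)] sN sS by auto
  have p': "p \<in> borel_measurable borel" and q': "q \<in> borel_measurable borel"
    using p(1) q(1) sS by (simp_all cong: measurable_cong_sets)
  define R where "R = density S (\<lambda>x. min (p x) (q x))"
  define P' where "P' = density S (\<lambda>x. p x - q x)"
  define N' where "N' = density S (\<lambda>x. q x - p x)"
  have mR: "(\<lambda>x. min (p x) (q x)) \<in> borel_measurable borel" and mP: "(\<lambda>x. p x - q x) \<in> borel_measurable borel"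
    and mN: "(\<lambda>x. q x - p x) \<in> borel_measurable borel"
    using p' q' by simp_all
  \<comment> \<open>True for infinite values too, since \<open>\<infinity> - \<infinity> = \<infinity>\<close> in the extended nonnegative reals.\<close>
  have sub: "a - b + min a b = a" for a b :: ennreal
    by (cases "a \<le> b") (auto simp: min_def diff_eq_0_iff_ennreal diff_add_cancel_ennreal ennreal_top_minus less_top[symmetric])
  have P_eq: "P = density S (\<lambda>x. (p x - q x) + min (p x) (q x))"
    unfolding sub by (rule p(2)[symmetric])
  have N_eq: "N = density S (\<lambda>x. (q x - p x) + min (p x) (q x))"
    unfolding min.commute[of "p _"] sub by (rule q(2)[symmetric])
  have density_radon: "finite_radon (density S u)"
    if u: "u \<in> borel_measurable borel" and M: "finite_radon (density S v)" and v: "v \<in> borel_measurable borel"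
      and le: "\<And>x. u x \<le> v x" for u v
  proof -
    have u': "u \<in> borel_measurable S" and v': "v \<in> borel_measurable S"
      by (rule measurable_if_sets_borel[OF sS u], rule measurable_if_sets_borel[OF sS v])
    have em: "emeasure (density S u) B \<le> emeasure (density S v) B" if "B \<in> sets borel" for B
      using that u' v' sS le by (subst (1 2) emeasure_density) (auto intro!: nn_integral_mono mult_right_mono)
    have "radon (density S u)"
      by (rule radon_mono[where M="density S v"]) (use M em sS in \<open>simp_all add: finite_radon_def\<close>)
    moreover have "emeasure (density S u) UNIV < \<infinity>"
      using em[of UNIV] M unfolding finite_radon_def by (auto intro: le_less_trans)
    ultimately show ?thesis
      unfolding finite_radon_def by blast
  qed
  have le: "a - b \<le> a" for a b :: ennreal
    by (metis add_increasing2 order_refl sub zero_le)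
  have P'r: "finite_radon P'" and N'r: "finite_radon N'" and Rr: "finite_radon R"
    unfolding P'_def N'_def R_def
    using density_radon[OF mP _ p' le] density_radon[OF mN _ q' le] density_radon[OF mR _ p'] P N p(2) q(2)
    by simp_all
  note sr = finite_radon_sigma_radon
  have "(P', N') \<in> signed_radon"
  proof -
    let ?B = "{x. p x \<le> q x}"
    have "?B = {x \<in> space borel. p x \<le> q x}" by simp
    also have "\<dots> \<in> sets borel"
      using p' q' by measurable
    finally have B: "?B \<in> sets borel" .
    have "(\<integral>\<^sup>+x. p x \<partial>S) = emeasure P UNIV"
    proof -
      have "emeasure (density S p) UNIV = (\<integral>\<^sup>+x. p x * indicator UNIV x \<partial>S)"
        by (rule emeasure_density) (use p sS in simp_all)
      then show ?thesis
        unfolding p(2) by simp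
    qed
    then have "(\<integral>\<^sup>+x. p x \<partial>S) \<noteq> \<infinity>"
      using P unfolding finite_radon_def by (simp add: less_top)
    then have "AE x in S. p x \<noteq> \<infinity>" by (rule nn_integral_PInf_AE[OF p(1)])
    then have "AE x in S. (p x - q x) * indicator ?B x = 0"
    proof (rule eventually_mono)
      fix x
      assume "p x \<noteq> \<infinity>"
      then show "(p x - q x) * indicator ?B x = 0"
        by (simp add: indicator_def diff_eq_0_iff_ennreal less_top)
    qed
    moreover have "(\<lambda>x. (p x - q x) * indicator ?B x) \<in> borel_measurable S"
      by (rule measurable_if_sets_borel[OF sS]) (use mP B in simp)
    ultimately have P'0: "emeasure P' ?B = 0"
      unfolding P'_def using B sS measurable_if_sets_borel[OF sS mP]
      by (subst emeasure_density) (simp_all add: nn_integral_0_iff_AE)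
    have "(q x - p x) * indicator (- ?B) x = 0" for x
    proof (cases "x \<in> ?B")
      case False
      then have "q x < p x" by simp
      then show ?thesis
        by (simp add: diff_eq_0_iff_ennreal less_imp_le less_top[symmetric]) (metis not_less_iff_gr_or_eq top.not_eq_extremum)
    qed simp
    then have zero: "(\<lambda>x. (q x - p x) * indicator (- ?B) x) = (\<lambda>_. 0)" by (rule ext)
    have "emeasure N' (- ?B) = (\<integral>\<^sup>+x. (q x - p x) * indicator (- ?B) x \<partial>S)"
      unfolding N'_def using B sS measurable_if_sets_borel[OF sS mN] by (intro emeasure_density) simp_all
    then have N'0: "emeasure N' (- ?B) = 0"
      unfolding zero by simp
    have null: "emeasure M C = 0" if "C \<subseteq> D" "emeasure M D = 0" "finite_radon M" "D \<in> sets borel" for M C and D :: "'a set"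
      using emeasure_mono[OF that(1), of M] that radon_sets[of M] unfolding finite_radon_def by simp
    have "emeasure P' (K \<inter> ?B) = 0" "emeasure N' (K - ?B) = 0" for K
      using null[OF _ P'0 P'r B, of "K \<inter> ?B"] null[OF _ N'0 N'r, of "K - ?B"] B by auto
    then show ?thesis
      unfolding signed_radon_def using P'r N'r B unfolding finite_radon_def by blast
  qed
  note singular = singular_energy_inequality[OF sr[OF P'r] sr[OF N'r] this]
  have left: "double_integral h P X = double_integral h P' X + double_integral h R X"
    "double_integral h N X = double_integral h N' X + double_integral h R X"
    if "sigma_radon X" "h \<in> borel_measurable borel" for X and h :: "'a \<times> 'a \<Rightarrow> ennreal"
    unfolding P'_def R_def N'_def
    by (subst P_eq, rule double_integral_density_add_left[OF that(1) sS mP mR that(2)])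
      (subst N_eq, rule double_integral_density_add_left[OF that(1) sS mN mR that(2)])
  have right: "double_integral h X P = double_integral h X P' + double_integral h X R"
    "double_integral h X N = double_integral h X N' + double_integral h X R"
    if "sigma_radon X" "h \<in> borel_measurable borel" for X and h :: "'a \<times> 'a \<Rightarrow> ennreal"
    unfolding P'_def R_def N'_def
    by (subst P_eq, rule double_integral_density_add_right[OF that(1) sS mP mR
          sr[OF P'r, unfolded P'_def] sr[OF Rr, unfolded R_def] that(2)])
      (subst N_eq, rule double_integral_density_add_right[OF that(1) sS mN mR
          sr[OF N'r, unfolded N'_def] sr[OF Rr, unfolded R_def] that(2)])
  note expand = left[OF sr[OF P]] left[OF sr[OF N]] right[OF sr[OF P'r]] right[OF sr[OF N'r]] right[OF sr[OF Rr]]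
  have PP: "double_integral h P P = double_integral h P' P' + double_integral h P' R + double_integral h R P' + double_integral h R R"
    and NN: "double_integral h N N = double_integral h N' N' + double_integral h N' R + double_integral h R N' + double_integral h R R"
    and PN: "double_integral h P N = double_integral h P' N' + double_integral h P' R + double_integral h R N' + double_integral h R R"
    if "h \<in> borel_measurable borel" for h :: "'a \<times> 'a \<Rightarrow> ennreal"
    by (simp_all only: expand[OF that] add.assoc)
  have finP: "Dp P' P' < \<infinity>" "Dp P' R < \<infinity>" "Dp R P' < \<infinity>" "Dp R R < \<infinity>"
    using fP unfolding PP[OF parts_borel(1)] by simp_all
  have finN: "Dp N' N' < \<infinity>" "Dp N' R < \<infinity>" "Dp R N' < \<infinity>"
    using fN unfolding NN[OF parts_borel(1)] by simp_all
  show fPN: "Dp P N < \<infinity>"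
    unfolding PN[OF parts_borel(1)] using singular(1)[OF finP(1) finN(1)] finP finN by simp
  note split = real_energy_split[OF _ _ _ Dn_finite]
  have "real_energy \<kappa> P P = real_energy \<kappa> P' P' + real_energy \<kappa> P' R + real_energy \<kappa> R P' + real_energy \<kappa> R R"
    by (rule split[OF PP[OF parts_borel(1)] fP PP[OF parts_borel(2)] sr[OF P] sr[OF P]])
  moreover have "real_energy \<kappa> N N = real_energy \<kappa> N' N' + real_energy \<kappa> N' R + real_energy \<kappa> R N' + real_energy \<kappa> R R"
    by (rule split[OF NN[OF parts_borel(1)] fN NN[OF parts_borel(2)] sr[OF N] sr[OF N]])
  moreover have "real_energy \<kappa> P N = real_energy \<kappa> P' N' + real_energy \<kappa> P' R + real_energy \<kappa> R N' + real_energy \<kappa> R R"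
    by (rule split[OF PN[OF parts_borel(1)] fPN PN[OF parts_borel(2)] sr[OF P] sr[OF N]])
  moreover have "real_energy \<kappa> R P' = real_energy \<kappa> P' R" "real_energy \<kappa> R N' = real_energy \<kappa> N' R"
    by (rule real_energy_sym[OF sr[OF Rr] sr[OF P'r]], rule real_energy_sym[OF sr[OF Rr] sr[OF N'r]])
  ultimately show "2 * real_energy \<kappa> P N \<le> real_energy \<kappa> P P + real_energy \<kappa> N N"
    using singular(2)[OF finP(1) finN(1)] by simp
qed

end

section \<open>Supports, capacity and finite energy\<close>

lemma null_outside_msupport:
  fixes M :: "'a::t2_space measure"
  assumes M: "radon M" and supp: "msupport M \<subseteq> E" and E: "closed E"
  shows "emeasure M (- E) = 0"
proof (rule ccontr)
  assume "emeasure M (- E) \<noteq> 0"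
  then have pos: "0 < emeasure M (- E)" by (simp add: zero_less_iff_neq_zero)
  have b: "- E \<in> sets borel"
    using E by simp
  obtain K where K: "compact K" "K \<subseteq> - E" "0 < emeasure M K"
    by (rule radon_inner_compact[OF M b pos])
  have "emeasure M K = 0"
  proof (rule null_if_locally_null[OF M K(1)])
    fix x
    assume "x \<in> K"
    then have "x \<notin> msupport M"
      using K(2) supp by blast
    then obtain U where U: "open U" "x \<in> U" "\<not> 0 < emeasure M U"
      unfolding msupport_def by blast
    have "emeasure M (K \<inter> U) \<le> emeasure M U"
      using U(1) radon_sets[OF M] by (intro emeasure_mono) simp_all
    with U show "\<exists>U. open U \<and> x \<in> U \<and> emeasure M (K \<inter> U) = 0"
      by (intro exI[of _ U]) (simp add: zero_less_iff_neq_zero)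
  qed
  with K(3) show False
    by simp
qed

text \<open>
  The sets \<open>{x \<in> E. 1 / (n + 1) < g x}\<close> have finite measure and exhaust \<open>E\<close>.
\<close>

lemma sigma_radon_if_weighted_mass_finite:
  fixes M :: "'a::t2_space measure" and g :: "'a \<Rightarrow> real"
  assumes M: "radon M" and supp: "msupport M \<subseteq> E" and E: "closed E"
    and g: "continuous_on E g" "\<And>x. x \<in> E \<Longrightarrow> 0 < g x"
    and mass: "(\<integral>\<^sup>+x \<in> E. ennreal (g x) \<partial>M) < \<infinity>"
  shows "sigma_radon M"
proof -
  have Eb: "E \<in> sets borel"
    using E by simp
  let ?u = "\<lambda>x. indicator E x *\<^sub>R g x"
  have u: "?u \<in> borel_measurable borel"
    by (rule borel_measurable_continuous_on_indicator[OF Eb g(1)])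
  define X where "X n = {x \<in> E. inverse (real (Suc n)) < ?u x} \<union> - E" for n :: nat
  have L: "{x \<in> E. inverse (real (Suc n)) < ?u x} \<in> sets borel" for n
  proof -
    have "{x \<in> space borel. inverse (real (Suc n)) < ?u x} \<in> sets borel"
      using u by measurable
    then have "E \<inter> {x \<in> space borel. inverse (real (Suc n)) < ?u x} \<in> sets borel"
      by (rule sets.Int[OF Eb])
    then show ?thesis by (simp add: Collect_conj_eq)
  qed
  have Xb: "X n \<in> sets M" for n
    unfolding X_def using L Eb radon_sets[OF M] by simp
  have "emeasure M (X n) < \<infinity>" for n
  proof -
    let ?L = "{x \<in> E. inverse (real (Suc n)) < ?u x}"
    have "ennreal (inverse (real (Suc n))) * emeasure M ?L = (\<integral>\<^sup>+x. ennreal (inverse (real (Suc n))) * indicator ?L x \<partial>M)"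
      by (rule nn_integral_cmult_indicator[symmetric]) (use L radon_sets[OF M] in simp)
    also have "\<dots> \<le> (\<integral>\<^sup>+x \<in> E. ennreal (g x) \<partial>M)"
      by (rule nn_integral_mono) (auto simp: indicator_def intro!: ennreal_leI)
    also have "\<dots> < \<infinity>" by (rule mass)
    finally have "emeasure M ?L < \<infinity>" by (auto simp: ennreal_mult_less_top)
    moreover have "emeasure M (X n) \<le> emeasure M ?L + emeasure M (- E)"
      unfolding X_def using L Eb radon_sets[OF M] by (intro emeasure_subadditive) simp_all
    ultimately show ?thesis
      using null_outside_msupport[OF M supp E] by (simp add: le_less_trans)
  qed
  moreover have "(\<Union>n. X n) = UNIV"
  proof (intro equalityI subsetI)
    fix x
    show "x \<in> (\<Union>n. X n)"
    proof (cases "x \<in> E")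
      case True
      then obtain n where "inverse (real (Suc n)) < g x"
        using reals_Archimedean[OF g(2)[OF True]] by blast
      then show ?thesis
        using True by (intro UN_I[of n]) (simp_all add: X_def)
    qed (simp add: X_def)
  qed simp
  ultimately have "sigma_finite_measure M"
    using Xb radon_space[OF M]
    by (intro sigma_finite_measure.intro exI[of _ "range X"]) (auto simp: less_top)
  then show ?thesis
    using M unfolding sigma_radon_def by simp
qed

lemma double_integral_restrict:
  fixes M :: "'a::t2_space measure" and N :: "'b::t2_space measure"
  assumes M: "sigma_radon M" and N: "sigma_radon N" and h: "h \<in> borel_measurable borel"
    and X: "X \<in> sets borel" and Y: "Y \<in> sets borel"
  shows "double_integral h (density M (indicator X)) (density N (indicator Y))
    = double_integral (\<lambda>z. indicator (X \<times> Y) z * h z) M N"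
proof -
  note [simp] = sigma_radon_sets[OF M] sigma_radon_sets[OF N]
  have hs: "(\<lambda>y. h (x, y)) \<in> borel_measurable N" for x
    by (rule sigma_radon_measurable[OF N borel_slice[OF h]])
  have k: "(\<lambda>z. indicator (UNIV \<times> Y) z * h z) \<in> borel_measurable borel"
    using h borel_measurable_indicator[OF borel_Times[OF _ Y, of UNIV]] by (intro borel_measurable_times_ennreal) simp_all
  have inner: "(\<integral>\<^sup>+y. h (x, y) \<partial>density N (indicator Y)) = (\<integral>\<^sup>+y. indicator (UNIV \<times> Y) (x, y) * h (x, y) \<partial>N)" for x
    using sigma_radon_measurable[OF N borel_measurable_indicator[OF Y]] hs
    by (subst nn_integral_density) (simp_all add: indicator_times)
  have m: "(\<lambda>x. \<integral>\<^sup>+y. indicator (UNIV \<times> Y) (x, y) * h (x, y) \<partial>N) \<in> borel_measurable M"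
    by (rule sigma_radon_measurable[OF M section_nn_integral_measurable[OF N k]])
  have "double_integral h (density M (indicator X)) (density N (indicator Y))
      = (\<integral>\<^sup>+x. indicator X x * (\<integral>\<^sup>+y. indicator (UNIV \<times> Y) (x, y) * h (x, y) \<partial>N) \<partial>M)"
    unfolding double_integral_def inner by (rule nn_integral_density[OF sigma_radon_measurable[OF M borel_measurable_indicator[OF X]] m])
  also have "\<dots> = (\<integral>\<^sup>+x. \<integral>\<^sup>+y. indicator (X \<times> Y) (x, y) * h (x, y) \<partial>N \<partial>M)"
    by (rule nn_integral_cong) (simp add: indicator_times split: split_indicator)
  finally show ?thesis
    unfolding double_integral_def .
qed

lemma double_integral_mono:
  "(\<And>z. h z \<le> k z) \<Longrightarrow> double_integral h M N \<le> double_integral k M N"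
  unfolding double_integral_def by (intro nn_integral_mono)

lemma double_integral_restrict_le:
  fixes M :: "'a::t2_space measure" and N :: "'b::t2_space measure"
  assumes M: "sigma_radon M" and N: "sigma_radon N" and h: "h \<in> borel_measurable borel"
    and X: "X \<in> sets borel" and Y: "Y \<in> sets borel"
  shows "double_integral h (density M (indicator X)) (density N (indicator Y)) \<le> double_integral h M N"
  unfolding double_integral_restrict[OF assms] by (rule double_integral_mono) (simp add: indicator_def)

lemma double_integral_exhaust:
  fixes M :: "'a::t2_space measure" and N :: "'b::t2_space measure"
  assumes M: "sigma_radon M" and N: "sigma_radon N" and h: "h \<in> borel_measurable borel"
    and X: "\<And>n. X n \<in> sets borel" "(\<Union>n. X n) = UNIV" "incseq X"
    and Y: "\<And>n. Y n \<in> sets borel" "(\<Union>n. Y n) = UNIV" "incseq Y"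
  shows "incseq (\<lambda>n. double_integral h (density M (indicator (X n))) (density N (indicator (Y n))))"
    and "(SUP n. double_integral h (density M (indicator (X n))) (density N (indicator (Y n)))) = double_integral h M N"
proof -
  let ?h = "\<lambda>n z. indicator (X n \<times> Y n) z * h z"
  have hb: "?h n \<in> borel_measurable borel" for n
    using h borel_measurable_indicator[OF borel_Times[OF X(1) Y(1)]] by (intro borel_measurable_times_ennreal)
  have mono: "?h n z \<le> ?h (Suc n) z" for n z
    using monoD[OF X(3), of n "Suc n"] monoD[OF Y(3), of n "Suc n"]
    by (intro mult_right_mono) (auto split: split_indicator)
  have eq: "double_integral h (density M (indicator (X n))) (density N (indicator (Y n))) = double_integral (?h n) M N" for n
    by (rule double_integral_restrict[OF M N h X(1) Y(1)])
  show "incseq (\<lambda>n. double_integral h (density M (indicator (X n))) (density N (indicator (Y n))))"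
    unfolding eq by (rule incseq_SucI, rule double_integral_mono, rule mono)
  have sup: "(SUP n. ?h n z) = h z" for z
  proof (rule antisym)
    show "(SUP n. ?h n z) \<le> h z" by (rule SUP_least) (simp split: split_indicator)
    obtain n where "z \<in> X n \<times> Y n"
      by (rule incseq_Times_exhaust[OF X(2,3) Y(2,3)])
    then have "h z = ?h n z" by simp
    then show "h z \<le> (SUP n. ?h n z)" by (intro SUP_upper2[of n]) simp_all
  qed
  have iter: "double_integral k M N = (\<integral>\<^sup>+z. k z \<partial>iter_measure M N)" if "k \<in> borel_measurable borel" for k
    unfolding double_integral_def by (rule nn_integral_iter_measure[OF M N that, symmetric])
  have "double_integral h M N = (\<integral>\<^sup>+z. (SUP n. ?h n z) \<partial>iter_measure M N)"
    unfolding sup by (rule iter[OF h])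
  also have "\<dots> = (SUP n. \<integral>\<^sup>+z. ?h n z \<partial>iter_measure M N)"
    by (rule nn_integral_monotone_convergence_SUP)
      (rule incseq_SucI, rule le_funI, rule mono, rule measurable_if_sets_borel[OF sets_iter_measure hb])
  also have "\<dots> = (SUP n. double_integral h (density M (indicator (X n))) (density N (indicator (Y n))))"
    unfolding eq iter[OF hb] ..
  finally show "(SUP n. double_integral h (density M (indicator (X n))) (density N (indicator (Y n)))) = double_integral h M N" ..
qed

lemma finite_radon_scale:
  fixes M :: "'a::t2_space measure"
  assumes M: "finite_radon M" and r: "0 \<le> r"
  shows "finite_radon (scale_measure (ennreal r) M)"
proof -
  have rM: "radon M" and fM: "emeasure M UNIV < \<infinity>"
    using M unfolding finite_radon_def by auto
  have fin: "emeasure M B < \<infinity>" for B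
    using emeasure_space[of M B] fM radon_space[OF rM] by (simp add: le_less_trans)
  have "radon (scale_measure (ennreal r) M)"
  proof (rule radonI_tight)
    show "sets (scale_measure (ennreal r) M) = sets borel"
      using radon_sets[OF rM] by simp
    show "emeasure (scale_measure (ennreal r) M) K < \<infinity>" for K
      using fin[of K] by (simp add: ennreal_mult_less_top)
    fix B :: "'a set" and e :: real
    assume B: "B \<in> sets borel" and e: "0 < e"
    have d: "0 < e / (r + 1)"
      using e r by simp
    obtain K where K: "compact K" "K \<subseteq> B" "emeasure M (B - K) \<le> ennreal (e / (r + 1))"
      by (rule radon_tight[OF rM B fin d])
    have "emeasure (scale_measure (ennreal r) M) (B - K) \<le> ennreal r * ennreal (e / (r + 1))"
      using K(3) by (simp add: mult_left_mono)
    also have "\<dots> = ennreal (r * (e / (r + 1)))"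
      by (rule ennreal_mult[symmetric, OF r less_imp_le[OF d]])
    also have "\<dots> \<le> ennreal e"
      using e r by (intro ennreal_leI) (simp add: field_simps)
    finally show "\<exists>K. compact K \<and> K \<subseteq> B \<and> emeasure (scale_measure (ennreal r) M) (B - K) \<le> ennreal e"
      using K(1,2) by blast
  qed
  then show ?thesis
    using fM unfolding finite_radon_def by (simp add: ennreal_mult_less_top)
qed

context positive_kernel
begin

lemma real_energy_nonneg:
  assumes M: "finite_radon M" and fin: "Dp M M < \<infinity>"
  shows "0 \<le> real_energy \<kappa> M M"
proof -
  let ?N = "null_measure borel :: 'a measure"
  have N: "finite_radon ?N"
    using M radon_mono[of M ?N] unfolding finite_radon_def by simp
  have "double_integral h ?N ?N = 0" "double_integral h M ?N = 0" for h
    unfolding double_integral_def by simp_all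
  then show ?thesis
    using energy_inequality(2)[OF M N fin] unfolding real_energy_def by simp
qed

text \<open>
  Otherwise \<open>B\<close> contains a compact set of positive measure, and \<open>M\<close> restricted to it and normalized
  competes in the definition of the capacity of \<open>B\<close> with finite energy. Positive definiteness bounds
  the energies of all competitors below by \<open>0\<close>, so the infimum is a real number and its inverse is
  not \<open>0\<close>.
\<close>

lemma null_if_capacity_zero:
  assumes M: "sigma_radon M" and fin: "Dp M M < \<infinity>" and B: "B \<in> sets borel"
    and cap: "interior_capacity \<kappa> B = 0"
  shows "emeasure M B = 0"
proof (rule ccontr)
  assume "emeasure M B \<noteq> 0"
  then have pos: "0 < emeasure M B" by (simp add: zero_less_iff_neq_zero)
  note rM = sigma_radon_radon[OF M]
  obtain K where K: "compact K" "K \<subseteq> B" "0 < emeasure M K"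
    by (rule radon_inner_compact[OF rM B pos])
  have Kb: "K \<in> sets borel" by (rule compact_borel[OF K(1)])
  define c where "c = measure M K"
  have "emeasure M K = ennreal c"
    unfolding c_def by (rule emeasure_eq_ennreal_measure) (use radon_compact_finite[OF rM K(1)] in simp)
  moreover from this have "0 < c"
    using K(3) by simp
  ultimately have c: "emeasure M K = ennreal c" "0 < c" by simp_all
  let ?Q = "density M (indicator K)"
  define V where "V = scale_measure (ennreal (1 / c)) ?Q"
  have emQ: "emeasure ?Q S = emeasure M (K \<inter> S)" if "S \<in> sets borel" for S
    by (rule emeasure_restricted) (use Kb that sigma_radon_sets[OF M] in simp_all)
  have Q: "finite_radon ?Q"
    using radon_restrict[OF rM Kb] emQ[of UNIV] c unfolding finite_radon_def by simp
  have V: "finite_radon V"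
    unfolding V_def by (rule finite_radon_scale[OF Q]) (use c in simp)
  have V1: "emeasure V UNIV = 1"
    using emQ[of UNIV] c unfolding V_def by (simp add: ennreal_mult[symmetric])
  have supp: "msupport V \<subseteq> K"
  proof
    fix x
    assume x: "x \<in> msupport V"
    show "x \<in> K"
    proof (rule ccontr)
      assume "x \<notin> K"
      moreover have o: "open (- K)"
        using compact_imp_closed[OF K(1)] by (rule open_Compl)
      ultimately have "0 < emeasure V (- K)"
        using x unfolding msupport_def by blast
      then show False
        unfolding V_def using emQ[of "- K"] o by simp
    qed
  qed
  have "closed (msupport V)"
  proof -
    have "- msupport V = \<Union>{U. open U \<and> emeasure V U = 0}"
    proof (intro equalityI subsetI)
      fix x
      assume "x \<in> - msupport V"
      then obtain U where "open U" "x \<in> U" "\<not> 0 < emeasure V U"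
        unfolding msupport_def by blast
      then show "x \<in> \<Union>{U. open U \<and> emeasure V U = 0}"
        by (intro UnionI[of U]) (simp_all add: zero_less_iff_neq_zero)
    next
      fix x
      assume "x \<in> \<Union>{U. open U \<and> emeasure V U = 0}"
      then obtain U where "open U" "x \<in> U" "emeasure V U = 0" by blast
      then show "x \<in> - msupport V"
        unfolding msupport_def by force
    qed
    also have "open \<dots>" by (rule open_Union) simp
    finally show ?thesis
      unfolding closed_def .
  qed
  then have "compact (K \<inter> msupport V)" by (rule compact_Int_closed[OF K(1)])
  then have comp: "compact (msupport V)"
    using supp by (simp add: Int_absorb1)
  note sV = finite_radon_sigma_radon[OF V] and sQ = finite_radon_sigma_radon[OF Q]
  have "Dp V V < \<infinity>"
  proof -
    have in_Q: "(\<integral>\<^sup>+x. u x \<partial>V) = ennreal (1 / c) * (\<integral>\<^sup>+x. u x \<partial>?Q)" if "u \<in> borel_measurable borel" for u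
      unfolding V_def by (rule nn_integral_scale_measure[OF sigma_radon_measurable[OF sQ that]])
    have m: "(\<lambda>x. \<integral>\<^sup>+y. pos_part \<kappa> (x, y) \<partial>?Q) \<in> borel_measurable borel"
      by (rule section_nn_integral_measurable[OF sQ parts_borel(1)])
    have "Dp V V = (\<integral>\<^sup>+x. ennreal (1 / c) * (\<integral>\<^sup>+y. pos_part \<kappa> (x, y) \<partial>?Q) \<partial>V)"
      unfolding double_integral_def in_Q[OF borel_slice[OF parts_borel(1)]] ..
    also have "\<dots> = ennreal (1 / c) * (\<integral>\<^sup>+x. ennreal (1 / c) * (\<integral>\<^sup>+y. pos_part \<kappa> (x, y) \<partial>?Q) \<partial>?Q)"
      by (rule in_Q) (use m in measurable)
    also have "\<dots> = ennreal (1 / c) * (ennreal (1 / c) * Dp ?Q ?Q)"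
      unfolding double_integral_def
      by (subst nn_integral_cmult[OF sigma_radon_measurable[OF sQ m]]) (rule refl)
    also have "\<dots> < \<infinity>"
      using le_less_trans[OF double_integral_restrict_le[OF M M parts_borel(1) Kb Kb] fin]
      by (simp add: ennreal_mult_less_top)
    finally show ?thesis .
  qed
  then have energy: "mutual_energy \<kappa> V V = ereal (real_energy \<kappa> V V)"
    by (rule mutual_energy_finite[OF sV sV])
  let ?S = "{M \<in> Eplus \<kappa>. emeasure M UNIV = 1 \<and> compact (msupport M) \<and> msupport M \<subseteq> B}"
  have "V \<in> ?S"
    using V V1 supp comp K(2) energy unfolding Eplus_def Mplus_def finite_radon_def by auto
  then have upper: "(INF M\<in>?S. mutual_energy \<kappa> M M) \<le> ereal (real_energy \<kappa> V V)"
    unfolding energy[symmetric] by (rule INF_lower)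
  have lower: "0 \<le> (INF M\<in>?S. mutual_energy \<kappa> M M)"
  proof (rule INF_greatest)
    fix N
    assume N: "N \<in> ?S"
    then have fr: "finite_radon N"
      unfolding Eplus_def Mplus_def finite_radon_def by simp
    note sN = finite_radon_sigma_radon[OF fr]
    have "Dp N N < \<infinity>"
      using N unfolding Eplus_def by (intro mutual_energy_infinite(3)[OF sN sN]) simp
    then show "0 \<le> mutual_energy \<kappa> N N"
      using mutual_energy_finite[OF sN sN] real_energy_nonneg[OF fr] by simp
  qed
  obtain r where "(INF M\<in>?S. mutual_energy \<kappa> M M) = ereal r"
    using upper lower by (cases "INF M\<in>?S. mutual_energy \<kappa> M M") auto
  then have "interior_capacity \<kappa> B \<noteq> 0"
    unfolding interior_capacity_def by (cases "r = 0") (simp_all)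
  with cap show False
    by simp
qed

end

section \<open>Families of measures\<close>

lemma integral_enn2real:
  assumes f: "f \<in> borel_measurable M" and fin: "(\<integral>\<^sup>+x. f x \<partial>M) < \<infinity>"
  shows "integrable M (\<lambda>x. enn2real (f x))" and "(\<integral>x. enn2real (f x) \<partial>M) = enn2real (\<integral>\<^sup>+x. f x \<partial>M)"
    and "AE x in M. f x < \<infinity>"
proof -
  have "AE x in M. f x \<noteq> \<infinity>" by (rule nn_integral_PInf_AE[OF f]) (use fin in simp)
  then show ae: "AE x in M. f x < \<infinity>" by (simp add: less_top)
  have eq: "(\<integral>\<^sup>+x. ennreal (enn2real (f x)) \<partial>M) = (\<integral>\<^sup>+x. f x \<partial>M)"
    by (rule nn_integral_cong_AE, rule eventually_mono[OF ae]) simp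
  have m: "(\<lambda>x. enn2real (f x)) \<in> borel_measurable M"
    using f by simp
  show "integrable M (\<lambda>x. enn2real (f x))"
    by (rule integrableI_nonneg[OF m]) (use fin eq in simp_all)
  show "(\<integral>x. enn2real (f x) \<partial>M) = enn2real (\<integral>\<^sup>+x. f x \<partial>M)"
    using integral_eq_nn_integral[OF m] eq by simp
qed

lemma nn_integral_count_space_subset:
  "B \<subseteq> A \<Longrightarrow> (\<integral>\<^sup>+x. f x \<partial>count_space B) = (\<integral>\<^sup>+x. f x * indicator B x \<partial>count_space A)"
  using nn_integral_restrict_space[of B "count_space A" f]
  by (simp add: restrict_count_space Int_absorb1 Int_absorb2)

text \<open>
  All mutual energies of two families together. They are summed over the pairs of indices in
  the extended nonnegative reals, so no question of convergence arises.
\<close>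

definition total :: "('a \<times> 'a \<Rightarrow> ennreal) \<Rightarrow> 'i set \<Rightarrow> ('i \<Rightarrow> 'a measure) \<Rightarrow> ('i \<Rightarrow> 'a measure) \<Rightarrow> ennreal" where
  "total h I p q = (\<integral>\<^sup>+ij. double_integral h (p (fst ij)) (q (snd ij)) \<partial>count_space (I \<times> I))"

lemma total_finite_sum:
  assumes "finite I"
  shows "total h I p q = (\<Sum>i\<in>I. \<Sum>j\<in>I. double_integral h (p i) (q j))"
  unfolding total_def using assms
  by (subst nn_integral_count_space_finite) (simp_all add: sum.cartesian_product case_prod_unfold)

lemma total_sum_measure:
  fixes p q :: "'i \<Rightarrow> 'a::t2_space measure"
  assumes I: "finite I" and p: "\<And>i. i \<in> I \<Longrightarrow> finite_radon (p i)" and q: "\<And>i. i \<in> I \<Longrightarrow> finite_radon (q i)"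
    and h: "h \<in> borel_measurable borel"
  shows "double_integral h (sum_measure I p) (sum_measure I q) = total h I p q"
proof -
  have "double_integral h (sum_measure I p) (sum_measure I q)
      = (\<integral>\<^sup>+i. \<integral>\<^sup>+j. double_integral h (p i) (q j) \<partial>count_space I \<partial>count_space I)"
    by (rule double_integral_sum_measure[OF finite_radon_sigma_radon[OF p] finite_radon_sigma_radon[OF q]
          finite_radon_sigma_radon[OF finite_radon_sum_measure[OF I q]] countable_finite[OF I] h])
  then show ?thesis
    unfolding total_finite_sum[OF I] by (simp add: nn_integral_count_space_finite[OF I])
qed

context positive_kernel
begin

abbreviation "Tp \<equiv> total (pos_part \<kappa>)"
abbreviation "Tn \<equiv> total (neg_part \<kappa>)"

definition total_energy :: "nat set \<Rightarrow> (nat \<Rightarrow> 'a measure) \<Rightarrow> (nat \<Rightarrow> 'a measure) \<Rightarrow> real" where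
  "total_energy I p q = enn2real (Tp I p q) - enn2real (Tn I p q)"

lemma total_neg_finite:
  assumes p: "\<And>i. i \<in> I \<Longrightarrow> sigma_radon (p i)" and q: "\<And>i. i \<in> I \<Longrightarrow> sigma_radon (q i)"
    and I: "compact (UNIV :: 'a set) \<Longrightarrow> finite I"
  shows "Tn I p q < \<infinity>"
  using compact_or_nonneg
proof (elim disjE conjE)
  assume "\<forall>z. neg_part \<kappa> z = 0"
  then show ?thesis
    unfolding total_def double_integral_def by simp
next
  assume "compact (UNIV :: 'a set)"
  then have "finite I" by (rule I)
  then show ?thesis
    unfolding total_finite_sum[OF \<open>finite I\<close>] using Dn_finite[OF p q]
    by (simp add: less_top[symmetric])
qed

lemma integral_real_energy:
  fixes p q :: "nat \<Rightarrow> 'a measure"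
  assumes "Tp I p q < \<infinity>" "Tn I p q < \<infinity>"
  shows "integrable (count_space (I \<times> I)) (\<lambda>ij. real_energy \<kappa> (p (fst ij)) (q (snd ij)))"
    and "(\<integral>ij. real_energy \<kappa> (p (fst ij)) (q (snd ij)) \<partial>count_space (I \<times> I)) = total_energy I p q"
proof -
  note pos = integral_enn2real[OF _ assms(1)[unfolded total_def], simplified]
  note neg = integral_enn2real[OF _ assms(2)[unfolded total_def], simplified]
  show "integrable (count_space (I \<times> I)) (\<lambda>ij. real_energy \<kappa> (p (fst ij)) (q (snd ij)))"
    unfolding real_energy_def by (rule Bochner_Integration.integrable_diff[OF pos(1) neg(1)])
  show "(\<integral>ij. real_energy \<kappa> (p (fst ij)) (q (snd ij)) \<partial>count_space (I \<times> I)) = total_energy I p q"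
    unfolding real_energy_def total_energy_def total_def
    by (subst Bochner_Integration.integral_diff[OF pos(1) neg(1)]) (simp only: pos(2) neg(2))
qed

lemma finite_family_energy_inequality:
  assumes I: "finite I" and p: "\<And>i. i \<in> I \<Longrightarrow> finite_radon (p i)" and q: "\<And>i. i \<in> I \<Longrightarrow> finite_radon (q i)"
    and fp: "Tp I p p < \<infinity>" and fq: "Tp I q q < \<infinity>"
  shows "Tp I p q < \<infinity>" and "2 * total_energy I p q \<le> total_energy I p p + total_energy I q q"
proof -
  let ?P = "sum_measure I p" and ?Q = "sum_measure I q"
  note eq = total_sum_measure[OF I p p] total_sum_measure[OF I q q] total_sum_measure[OF I p q]
  have "Dp ?P ?P < \<infinity>" "Dp ?Q ?Q < \<infinity>"
    using fp fq by (simp_all only: eq[OF _ _ parts_borel(1)])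
  note ineq = energy_inequality[OF finite_radon_sum_measure[OF I p] finite_radon_sum_measure[OF I q] this]
  show "Tp I p q < \<infinity>"
    using ineq(1) by (simp only: eq[OF _ _ parts_borel(1)])
  show "2 * total_energy I p q \<le> total_energy I p p + total_energy I q q"
    using ineq(2) by (simp only: real_energy_def total_energy_def eq[OF _ _ parts_borel(1)] eq[OF _ _ parts_borel(2)])
qed

text \<open>
  Each component is truncated to sets of finite measure and the families to finitely many indices.
  For a nonnegative kernel the truncated energies increase to the full ones, so the inequality for
  finite families passes to the limit on the left and its right-hand side stays below the full one.
\<close>

lemma nonneg_family_energy_inequality:
  fixes I :: "nat set"
  assumes nonneg: "\<And>z. neg_part \<kappa> z = 0"
    and p: "\<And>i. i \<in> I \<Longrightarrow> sigma_radon (p i)" and q: "\<And>i. i \<in> I \<Longrightarrow> sigma_radon (q i)"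
    and fp: "Tp I p p < \<infinity>" and fq: "Tp I q q < \<infinity>"
  shows "2 * Tp I p q \<le> Tp I p p + Tp I q q"
proof -
  have "\<exists>X. (\<forall>n. X n \<in> sets borel) \<and> (\<Union>n. X n) = UNIV \<and> incseq X \<and>
      (\<forall>n. finite_radon (density M (indicator (X n))))" if M: "sigma_radon M" for M :: "'a measure"
    by (rule sigma_radon_exhaust[OF M]) (intro exI conjI allI)
  note exhaust = this
  have ex: "\<exists>X. \<forall>i\<in>I. (\<forall>n. X i n \<in> sets borel) \<and> (\<Union>n. X i n) = UNIV \<and> incseq (X i) \<and>
      (\<forall>n. finite_radon (density (r i) (indicator (X i n))))"
    if "\<forall>i\<in>I. sigma_radon (r i)" for r :: "nat \<Rightarrow> 'a measure"
    by (rule bchoice, rule ballI, rule exhaust, rule bspec[OF that])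
  have pr: "\<forall>i\<in>I. sigma_radon (p i)" and qr: "\<forall>i\<in>I. sigma_radon (q i)"
    by (intro ballI p q; assumption)+
  obtain X where "\<forall>i\<in>I. (\<forall>n. X i n \<in> sets borel) \<and> (\<Union>n. X i n) = UNIV \<and> incseq (X i) \<and>
      (\<forall>n. finite_radon (density (p i) (indicator (X i n))))"
    using ex[OF pr] by (elim exE)
  then have X: "\<And>i n. i \<in> I \<Longrightarrow> X i n \<in> sets borel" "\<And>i. i \<in> I \<Longrightarrow> (\<Union>n. X i n) = UNIV" "\<And>i. i \<in> I \<Longrightarrow> incseq (X i)"
    "\<And>i n. i \<in> I \<Longrightarrow> finite_radon (density (p i) (indicator (X i n)))"
    by simp_all
  obtain Y where "\<forall>i\<in>I. (\<forall>n. Y i n \<in> sets borel) \<and> (\<Union>n. Y i n) = UNIV \<and> incseq (Y i) \<and>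
      (\<forall>n. finite_radon (density (q i) (indicator (Y i n))))"
    using ex[OF qr] by (elim exE)
  then have Y: "\<And>i n. i \<in> I \<Longrightarrow> Y i n \<in> sets borel" "\<And>i. i \<in> I \<Longrightarrow> (\<Union>n. Y i n) = UNIV" "\<And>i. i \<in> I \<Longrightarrow> incseq (Y i)"
    "\<And>i n. i \<in> I \<Longrightarrow> finite_radon (density (q i) (indicator (Y i n)))"
    by simp_all
  define p' where "p' n i = density (p i) (indicator (X i n))" for n i
  define q' where "q' n i = density (q i) (indicator (Y i n))" for n i
  define F where "F n = I \<inter> {..<n}" for n
  have F: "finite (F n)" "F n \<subseteq> I" for n
    unfolding F_def by auto
  have p'r: "finite_radon (p' n i)" and q'r: "finite_radon (q' n i)" if "i \<in> F n" for n i
    unfolding p'_def q'_def using X(4)[of i n] Y(4)[of i n] that subsetD[OF F(2)] by simp_all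
  have FI: "F n \<times> F n \<subseteq> I \<times> I" for n
    using F(2) by blast
  have sub_total: "Tp (F n) r r \<le> Tp I s s"
    if "\<And>i j. i \<in> F n \<Longrightarrow> j \<in> F n \<Longrightarrow> Dp (r i) (r j) \<le> Dp (s i) (s j)" for n r s
  proof -
    have "Tp (F n) r r \<le> Tp (F n) s s"
      unfolding total_def by (rule nn_integral_mono) (use that in auto)
    also have "\<dots> \<le> Tp I s s"
      unfolding total_def nn_integral_count_space_subset[OF FI]
      by (rule nn_integral_mono) (simp split: split_indicator)
    finally show ?thesis .
  qed
  have trunc: "2 * Tp (F n) (p' n) (q' n) \<le> Tp I p p + Tp I q q" for n
  proof -
    have lp: "Tp (F n) (p' n) (p' n) \<le> Tp I p p"
    proof (rule sub_total)
      fix i j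
      assume "i \<in> F n" "j \<in> F n"
      then have "i \<in> I" "j \<in> I"
        using F(2) by blast+
      then show "Dp (p' n i) (p' n j) \<le> Dp (p i) (p j)"
        unfolding p'_def by (intro double_integral_restrict_le p X(1) parts_borel(1))
    qed
    have lq: "Tp (F n) (q' n) (q' n) \<le> Tp I q q"
    proof (rule sub_total)
      fix i j
      assume "i \<in> F n" "j \<in> F n"
      then have "i \<in> I" "j \<in> I"
        using F(2) by blast+
      then show "Dp (q' n i) (q' n j) \<le> Dp (q i) (q j)"
        unfolding q'_def by (intro double_integral_restrict_le q Y(1) parts_borel(1))
    qed
    note fin = le_less_trans[OF lp fp] le_less_trans[OF lq fq]
    note ineq = finite_family_energy_inequality[OF F(1) p'r q'r fin]
    have zero: "Tn J r s = 0" for J :: "nat set" and r s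
      unfolding total_def double_integral_def nonneg by simp
    have real: "t = ennreal (enn2real t)" if "t < \<infinity>" for t
      using that by simp
    have "2 * enn2real (Tp (F n) (p' n) (q' n))
        \<le> enn2real (Tp (F n) (p' n) (p' n)) + enn2real (Tp (F n) (q' n) (q' n))"
      using ineq(2) unfolding total_energy_def zero by simp
    then have "ennreal (2 * enn2real (Tp (F n) (p' n) (q' n)))
        \<le> ennreal (enn2real (Tp (F n) (p' n) (p' n)) + enn2real (Tp (F n) (q' n) (q' n)))"
      by (rule ennreal_leI)
    then have "2 * Tp (F n) (p' n) (q' n)
        \<le> Tp (F n) (p' n) (p' n) + Tp (F n) (q' n) (q' n)"
      using real[OF ineq(1)] real[OF fin(1)] real[OF fin(2)] by (simp add: ennreal_mult)
    also have "\<dots> \<le> Tp I p p + Tp I q q" by (rule add_mono[OF lp lq])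
    finally show ?thesis .
  qed
  let ?d = "\<lambda>n ij. Dp (p' n (fst ij)) (q' n (snd ij))"
  let ?e = "\<lambda>n ij. ?d n ij * indicator (F n \<times> F n) ij"
  have d: "incseq (\<lambda>n. ?d n ij)" "(SUP n. ?d n ij) = Dp (p (fst ij)) (q (snd ij))" if "ij \<in> I \<times> I" for ij
  proof -
    have ij: "fst ij \<in> I" "snd ij \<in> I"
      using that by auto
    note ex = double_integral_exhaust[OF p[OF ij(1)] q[OF ij(2)] parts_borel(1) X(1)[OF ij(1)] X(2)[OF ij(1)] X(3)[OF ij(1)]
      Y(1)[OF ij(2)] Y(2)[OF ij(2)] Y(3)[OF ij(2)]]
    show "incseq (\<lambda>n. ?d n ij)"
      unfolding p'_def q'_def by (rule ex(1))
    show "(SUP n. ?d n ij) = Dp (p (fst ij)) (q (snd ij))"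
      unfolding p'_def q'_def by (rule ex(2))
  qed
  have F_mono: "F m \<subseteq> F n" if "m \<le> n" for m n
    unfolding F_def using that by auto
  have e_inc: "?e m ij \<le> ?e n ij" if "m \<le> n" "ij \<in> I \<times> I" for m n ij
    using F_mono[OF that(1)] incseqD[OF d(1)[OF that(2)] that(1)]
    by (intro mult_mono) (auto split: split_indicator)
  have e_sup: "(SUP n. ?e n ij) = Dp (p (fst ij)) (q (snd ij))" if "ij \<in> I \<times> I" for ij
  proof (rule antisym)
    show "(SUP n. ?e n ij) \<le> Dp (p (fst ij)) (q (snd ij))"
      unfolding d(2)[OF that, symmetric] 
      by (rule SUP_mono, rule_tac x=n in bexI) (simp_all split: split_indicator)
    show "Dp (p (fst ij)) (q (snd ij)) \<le> (SUP n. ?e n ij)"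
      unfolding d(2)[OF that, symmetric]
    proof (rule SUP_least)
      fix n
      let ?m = "max n (Suc (max (fst ij) (snd ij)))"
      have "ij \<in> F ?m \<times> F ?m"
        using that unfolding F_def by (auto simp: mem_Times_iff)
      then have "?d n ij \<le> ?e ?m ij"
        using incseqD[OF d(1)[OF that], of n ?m] by simp
      then show "?d n ij \<le> (SUP n. ?e n ij)" by (rule SUP_upper2[OF UNIV_I])
    qed
  qed
  have e_total: "(\<integral>\<^sup>+ij. ?e n ij \<partial>count_space (I \<times> I)) = Tp (F n) (p' n) (q' n)" for n
    unfolding total_def nn_integral_count_space_subset[OF FI] ..
  have "Tp I p q = (\<integral>\<^sup>+ij. (SUP n. ?e n ij) \<partial>count_space (I \<times> I))"
    unfolding total_def by (rule nn_integral_cong) (use e_sup in simp)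
  also have "\<dots> = (SUP n. \<integral>\<^sup>+ij. ?e n ij \<partial>count_space (I \<times> I))"
  proof (rule nn_integral_monotone_convergence_SUP_AE)
    show "AE ij in count_space (I \<times> I). ?e n ij \<le> ?e (Suc n) ij" for n
      using e_inc[of n "Suc n"] by (intro AE_I2) simp
  qed simp
  also have "\<dots> = (SUP n. Tp (F n) (p' n) (q' n))"
    unfolding e_total ..
  finally have "2 * Tp I p q = (SUP n. 2 * Tp (F n) (p' n) (q' n))"
    by (simp only: SUP_mult_left_ennreal)
  also have "\<dots> \<le> Tp I p p + Tp I q q" by (rule SUP_least) (rule trunc)
  finally show ?thesis .
qed

lemma family_energy_inequality:
  assumes p: "\<And>i. i \<in> I \<Longrightarrow> sigma_radon (p i)" and q: "\<And>i. i \<in> I \<Longrightarrow> sigma_radon (q i)"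
    and I: "compact (UNIV :: 'a set) \<Longrightarrow> finite I"
    and fp: "Tp I p p < \<infinity>" and fq: "Tp I q q < \<infinity>"
  shows "Tp I p q < \<infinity> \<and> 2 * total_energy I p q \<le> total_energy I p p + total_energy I q q"
  using compact_or_nonneg
proof (elim disjE conjE)
  assume nonneg: "\<forall>z. neg_part \<kappa> z = 0"
  have zero: "Tn I r s = 0" for r s
    unfolding total_def double_integral_def using nonneg by simp
  have ineq: "2 * Tp I p q \<le> Tp I p p + Tp I q q"
    by (rule nonneg_family_energy_inequality[OF spec[OF nonneg] p q fp fq])
  also have "\<dots> < \<infinity>"
    using fp fq by simp
  finally have fin: "Tp I p q < \<infinity>" by (auto simp: ennreal_mult_less_top)
  have "enn2real (2 * Tp I p q) \<le> enn2real (Tp I p p + Tp I q q)"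
    by (rule enn2real_mono[OF ineq]) (use fp fq in simp)
  then have "2 * enn2real (Tp I p q) \<le> enn2real (Tp I p p) + enn2real (Tp I q q)"
    using fp fq by (simp add: enn2real_mult enn2real_plus)
  then show ?thesis
    unfolding total_energy_def zero using fin by simp
next
  assume K: "compact (UNIV :: 'a set)"
  have fin: "finite_radon M" if "sigma_radon M" for M :: "'a measure"
    using radon_compact_finite[OF sigma_radon_radon[OF that] K] sigma_radon_radon[OF that]
    unfolding finite_radon_def by simp
  show ?thesis
    using finite_family_energy_inequality[OF I[OF K] fin[OF p] fin[OF q] fp fq] by blast
qed

end

section \<open>Extended integrals as Bochner integrals\<close>

lemma real_of_ereal_parts: "real_of_ereal u = enn2real (e2ennreal u) - enn2real (e2ennreal (- u))"
proof (cases u)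
  case (real r)
  then show ?thesis by (cases "0 \<le> r") (simp_all add: ennreal_neg)
qed (simp_all add: e2ennreal_neg)

lemma ext_integral_finiteD:
  assumes "ext_integral_finite M u"
  shows "integrable M (\<lambda>x. real_of_ereal (u x))"
    and "ext_integral M u = ereal (\<integral>x. real_of_ereal (u x) \<partial>M)"
    and "AE x in M. \<bar>u x\<bar> \<noteq> \<infinity>"
proof -
  have u: "u \<in> borel_measurable M" and fin: "(\<integral>\<^sup>+x. e2ennreal (u x) \<partial>M) < \<infinity>" "(\<integral>\<^sup>+x. e2ennreal (- u x) \<partial>M) < \<infinity>"
    using assms unfolding ext_integral_finite_def by auto
  have m: "(\<lambda>x. e2ennreal (u x)) \<in> borel_measurable M" "(\<lambda>x. e2ennreal (- u x)) \<in> borel_measurable M"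
    using u by simp_all
  note pos = integral_enn2real[OF m(1) fin(1)] and neg = integral_enn2real[OF m(2) fin(2)]
  show "integrable M (\<lambda>x. real_of_ereal (u x))"
    unfolding real_of_ereal_parts by (rule Bochner_Integration.integrable_diff[OF pos(1) neg(1)])
  have "(\<integral>x. real_of_ereal (u x) \<partial>M) = enn2real (\<integral>\<^sup>+x. e2ennreal (u x) \<partial>M) - enn2real (\<integral>\<^sup>+x. e2ennreal (- u x) \<partial>M)"
    unfolding real_of_ereal_parts by (subst Bochner_Integration.integral_diff[OF pos(1) neg(1)]) (simp only: pos(2) neg(2))
  then show "ext_integral M u = ereal (\<integral>x. real_of_ereal (u x) \<partial>M)"
    unfolding ext_integral_def using enn2ereal_eq_enn2real[OF fin(1)] enn2ereal_eq_enn2real[OF fin(2)] by simp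
  show "AE x in M. \<bar>u x\<bar> \<noteq> \<infinity>"
    using pos(3) neg(3)
  proof eventually_elim
    case (elim x)
    then show ?case by (cases "u x") simp_all
  qed
qed

lemma ext_integral_AE_real:
  fixes v :: "'a \<Rightarrow> real"
  assumes v: "integrable M v" and u: "u \<in> borel_measurable M" and eq: "AE x in M. u x = ereal (v x)"
  shows "ext_integral_finite M u" and "ext_integral M u = ereal (\<integral>x. v x \<partial>M)"
proof -
  have norm: "(\<integral>\<^sup>+x. ennreal (norm (v x)) \<partial>M) < \<infinity>"
    using v by (simp add: integrable_iff_bounded)
  have "(\<integral>\<^sup>+x. e2ennreal (u x) \<partial>M) \<le> (\<integral>\<^sup>+x. ennreal (norm (v x)) \<partial>M)"
    "(\<integral>\<^sup>+x. e2ennreal (- u x) \<partial>M) \<le> (\<integral>\<^sup>+x. ennreal (norm (v x)) \<partial>M)"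
    using eq by (intro nn_integral_mono_AE; eventually_elim; simp add: ennreal_leI)+
  then show fin: "ext_integral_finite M u"
    unfolding ext_integral_finite_def using u norm by (simp add: le_less_trans)
  have "(\<integral>x. real_of_ereal (u x) \<partial>M) = (\<integral>x. v x \<partial>M)"
    by (rule integral_cong_AE) (use u v eq in auto)
  then show "ext_integral M u = ereal (\<integral>x. v x \<partial>M)"
    using ext_integral_finiteD(2)[OF fin] by simp
qed

lemma ext_sum_real:
  fixes v :: "'i \<Rightarrow> real"
  assumes "integrable (count_space I) v" and "\<And>i. i \<in> I \<Longrightarrow> t i = ereal (v i)"
  shows "ext_sum_finite I t" and "ext_sum I t = ereal (\<integral>i. v i \<partial>count_space I)"
  using ext_integral_AE_real[of "count_space I" v t] assms by (simp_all add: AE_count_space)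

lemma ext_sum_finiteD:
  assumes "ext_sum_finite I t"
  shows "integrable (count_space I) (\<lambda>i. real_of_ereal (t i))"
    and "ext_sum I t = ereal (\<integral>i. real_of_ereal (t i) \<partial>count_space I)"
    and "\<And>i. i \<in> I \<Longrightarrow> t i = ereal (real_of_ereal (t i))"
  using ext_integral_finiteD[OF assms] by (auto simp: AE_count_space ereal_real')

text \<open>
  The \<open>\<eta>\<^sub>i\<close> are not assumed summable. Their positive parts are dominated by those of \<open>w\<^sub>i\<close>, and divergent
  negative parts would make the sum \<open>- \<infinity>\<close>.
\<close>

lemma ext_sum_eq_imp_eq:
  fixes w \<eta> :: "'i \<Rightarrow> real"
  assumes w: "integrable (count_space I) w" and le: "\<And>i. i \<in> I \<Longrightarrow> \<eta> i \<le> w i"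
    and ge: "ereal (\<integral>i. w i \<partial>count_space I) \<le> ext_sum I (\<lambda>i. ereal (\<eta> i))"
  shows "\<forall>i\<in>I. \<eta> i = w i" and "ext_sum I (\<lambda>i. ereal (\<eta> i)) = ereal (\<integral>i. w i \<partial>count_space I)"
proof -
  have "(\<integral>\<^sup>+i. e2ennreal (ereal (\<eta> i)) \<partial>count_space I) \<le> (\<integral>\<^sup>+i. ennreal (norm (w i)) \<partial>count_space I)"
    by (rule nn_integral_mono) (use le in \<open>fastforce intro!: ennreal_leI\<close>)
  also have "\<dots> < \<infinity>"
    using w by (simp add: integrable_iff_bounded)
  finally have pos: "(\<integral>\<^sup>+i. e2ennreal (ereal (\<eta> i)) \<partial>count_space I) < \<infinity>" .
  have neg: "(\<integral>\<^sup>+i. e2ennreal (- ereal (\<eta> i)) \<partial>count_space I) < \<infinity>"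
  proof (rule ccontr)
    assume "\<not> ?thesis"
    then have "(\<integral>\<^sup>+i. e2ennreal (- ereal (\<eta> i)) \<partial>count_space I) = top"
      by (simp add: less_top[symmetric])
    then have "ext_sum I (\<lambda>i. ereal (\<eta> i)) = - \<infinity>"
      unfolding ext_integral_def using enn2ereal_eq_enn2real[OF pos] by simp
    with ge show False
      by simp
  qed
  have "ext_sum_finite I (\<lambda>i. ereal (\<eta> i))"
    unfolding ext_integral_finite_def using pos neg by simp
  note \<eta> = ext_integral_finiteD[OF this, simplified]
  have "(\<integral>i. \<eta> i \<partial>count_space I) \<le> (\<integral>i. w i \<partial>count_space I)"
    by (rule integral_mono[OF \<eta>(1) w]) (use le in simp)
  then have eq: "(\<integral>i. w i \<partial>count_space I) = (\<integral>i. \<eta> i \<partial>count_space I)"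
    using ge \<eta>(2) by simp
  then show "ext_sum I (\<lambda>i. ereal (\<eta> i)) = ereal (\<integral>i. w i \<partial>count_space I)"
    using \<eta>(2) by simp
  have "(\<integral>i. w i - \<eta> i \<partial>count_space I) = 0"
    using eq by (subst Bochner_Integration.integral_diff[OF w \<eta>(1)]) simp
  then have "AE i in count_space I. w i - \<eta> i = 0"
    using w \<eta>(1) le by (subst (asm) integral_nonneg_eq_0_iff_AE) (auto simp: AE_count_space)
  then show "\<forall>i\<in>I. \<eta> i = w i" by (auto simp: AE_count_space)
qed

lemma ext_sum_eq_imp_eq':
  fixes w \<eta> :: "'i \<Rightarrow> real"
  assumes w: "integrable (count_space I) w" and ge: "\<And>i. i \<in> I \<Longrightarrow> w i \<le> \<eta> i"
    and le: "ext_sum I (\<lambda>i. ereal (\<eta> i)) \<le> ereal (\<integral>i. w i \<partial>count_space I)"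
  shows "\<forall>i\<in>I. \<eta> i = w i" and "ext_sum I (\<lambda>i. ereal (\<eta> i)) = ereal (\<integral>i. w i \<partial>count_space I)"
proof -
  have "(\<integral>\<^sup>+i. e2ennreal (- ereal (\<eta> i)) \<partial>count_space I) \<le> (\<integral>\<^sup>+i. ennreal (norm (w i)) \<partial>count_space I)"
    by (rule nn_integral_mono) (use ge in \<open>fastforce intro!: ennreal_leI\<close>)
  also have "\<dots> < \<infinity>"
    using w by (simp add: integrable_iff_bounded)
  finally have neg: "(\<integral>\<^sup>+i. e2ennreal (- ereal (\<eta> i)) \<partial>count_space I) < \<infinity>" .
  let ?p = "enn2ereal (\<integral>\<^sup>+i. e2ennreal (ereal (\<eta> i)) \<partial>count_space I)"
  let ?n = "enn2ereal (\<integral>\<^sup>+i. e2ennreal (- ereal (\<eta> i)) \<partial>count_space I)"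
  have uminus: "ext_sum I (\<lambda>i. ereal (- \<eta> i)) = - ext_sum I (\<lambda>i. ereal (\<eta> i))"
  proof -
    have "?n - ?p = - (?p - ?n)"
      using enn2ereal_eq_enn2real[OF neg] by (cases ?p) simp_all
    then show ?thesis
      unfolding ext_integral_def by simp
  qed
  have minus: "ereal (\<integral>i. - w i \<partial>count_space I) = - ereal (\<integral>i. w i \<partial>count_space I)"
    by simp
  have w': "integrable (count_space I) (\<lambda>i. - w i)"
    using w by simp
  have le': "- \<eta> i \<le> - w i" if "i \<in> I" for i
    using ge[OF that] by simp
  have ge': "ereal (\<integral>i. - w i \<partial>count_space I) \<le> ext_sum I (\<lambda>i. ereal (- \<eta> i))"
    unfolding uminus minus using le by (simp only: ereal_minus_le_minus)
  note * = ext_sum_eq_imp_eq[OF w' le' ge']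
  show "\<forall>i\<in>I. \<eta> i = w i"
    using *(1) by simp
  show "ext_sum I (\<lambda>i. ereal (\<eta> i)) = ereal (\<integral>i. w i \<partial>count_space I)"
    using *(2) unfolding uminus minus by (simp only: ereal_uminus_eq_iff)
qed

section \<open>Admissible vector measures\<close>

locale condenser_problem = positive_kernel \<kappa> for \<kappa> :: "'a::t2_space kernel" +
  fixes Ip In :: "nat set" and A :: "nat \<Rightarrow> 'a set" and f1 f2 :: "nat \<Rightarrow> 'a \<Rightarrow> ereal"
    and a :: "nat \<Rightarrow> real" and g :: "nat \<Rightarrow> 'a \<Rightarrow> real"
  assumes cond: "condenser Ip In A"
    and field: "external_field \<kappa> (Ip \<union> In) f1 f2"
    and weight: "\<forall>i \<in> Ip \<union> In. continuous_on (A i) (g i) \<and> (\<forall>x \<in> A i. 0 < g i x)"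
    and mass: "\<forall>i \<in> Ip \<union> In. 0 < a i"
begin

abbreviation "I \<equiv> Ip \<union> In"
abbreviation "Adm \<equiv> admissible \<kappa> Ip In f1 f2 A a g"

text \<open>The real number \<open>\<alpha>\<^sub>i\<close>; it allows signed energies to be summed as Bochner integrals.\<close>

definition sgn_of :: "nat \<Rightarrow> real" where
  "sgn_of i = (if i \<in> Ip then 1 else - 1)"

abbreviation sgn2 :: "nat \<times> nat \<Rightarrow> real" where
  "sgn2 ij \<equiv> sgn_of (fst ij) * sgn_of (snd ij)"

lemma plate_sign_eq: "plate_sign Ip i = ereal (sgn_of i)"
  unfolding plate_sign_def sgn_of_def by (simp add: one_ereal_def)

lemma abs_sgn_of [simp]: "\<bar>sgn_of i\<bar> = 1"
  unfolding sgn_of_def by simp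

lemma closed_plate: "i \<in> I \<Longrightarrow> closed (A i)"
  and plate_nonempty: "i \<in> I \<Longrightarrow> A i \<noteq> {}"
  and plates_locally_finite: "compact K \<Longrightarrow> finite {i \<in> I. A i \<inter> K \<noteq> {}}"
  using cond unfolding condenser_def by simp_all

lemma compact_finite:
  assumes "compact (UNIV :: 'a set)"
  shows "finite I"
proof -
  have "{i \<in> I. A i \<inter> UNIV \<noteq> {}} = I"
    using plate_nonempty by auto
  then show ?thesis
    using plates_locally_finite[OF assms] by (simp only:)
qed

lemma admissible_measure:
  assumes \<nu>: "\<nu> \<in> Adm" and i: "i \<in> I"
  shows "sigma_radon (\<nu> i)" and "AE x in \<nu> i. x \<in> A i"
proof -
  have M: "\<nu> i \<in> Mplus (A i)"
    using \<nu> i unfolding admissible_def vec_finite_energy_def vec_measures_def by blast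
  then have r: "radon (\<nu> i)" and s: "msupport (\<nu> i) \<subseteq> A i"
    unfolding Mplus_def by auto
  have "(\<integral>\<^sup>+x \<in> A i. ennreal (g i x) \<partial>\<nu> i) = ennreal (a i)"
    using \<nu> i unfolding admissible_def by blast
  then have fin: "(\<integral>\<^sup>+x \<in> A i. ennreal (g i x) \<partial>\<nu> i) < \<infinity>"
    by simp
  have g: "continuous_on (A i) (g i)" "\<And>x. x \<in> A i \<Longrightarrow> 0 < g i x"
    using weight i by blast+
  show "sigma_radon (\<nu> i)"
    by (rule sigma_radon_if_weighted_mass_finite[OF r s closed_plate[OF i] g fin])
  have "emeasure (\<nu> i) (- A i) = 0" by (rule null_outside_msupport[OF r s closed_plate[OF i]])
  then show "AE x in \<nu> i. x \<in> A i"
    using closed_plate[OF i] radon_sets[OF r] radon_space[OF r]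
    by (intro AE_I[of _ _ "- A i"]) auto
qed

lemma vec_energy_term_eq:
  assumes "sigma_radon (\<nu> i)" "sigma_radon (\<mu> j)" "Dp (\<nu> i) (\<mu> j) < \<infinity>"
  shows "vec_energy_term \<kappa> Ip \<nu> \<mu> (i, j) = ereal (sgn2 (i, j) * real_energy \<kappa> (\<nu> i) (\<mu> j))"
  unfolding vec_energy_term_def by (simp add: plate_sign_eq mutual_energy_finite[OF assms])

text \<open>
  Absolute convergence of the energy gives the integrals of the kernel; that of its positive part
  differs from them by the negative part, whose total is finite in any case.
\<close>

lemma admissible_energy:
  assumes \<nu>: "\<nu> \<in> Adm"
  shows "Tp I \<nu> \<nu> < \<infinity>"
proof -
  have fin: "ext_sum_finite (I \<times> I) (vec_energy_term \<kappa> Ip \<nu> \<nu>)"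
    using \<nu> unfolding admissible_def vec_finite_energy_def by blast
  note sr = admissible_measure(1)[OF \<nu>]
  have Dp_fin: "Dp (\<nu> i) (\<nu> j) < \<infinity>" if "i \<in> I" "j \<in> I" for i j
  proof (rule ccontr)
    assume "\<not> ?thesis"
    then have "Dp (\<nu> i) (\<nu> j) = \<infinity>" by (simp add: less_top[symmetric])
    then have inf: "mutual_energy \<kappa> (\<nu> i) (\<nu> j) = \<infinity>"
      by (rule mutual_energy_infinite(1)[OF sr[OF that(1)] sr[OF that(2)]])
    have "(i, j) \<in> I \<times> I"
      using that by simp
    then obtain r where "vec_energy_term \<kappa> Ip \<nu> \<nu> (i, j) = ereal r"
      using ext_sum_finiteD(3)[OF fin] by blast
    moreover have "\<bar>vec_energy_term \<kappa> Ip \<nu> \<nu> (i, j)\<bar> = \<infinity>"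
      unfolding vec_energy_term_def by (simp add: inf plate_sign_eq sgn_of_def)
    ultimately show False by simp
  qed
  have t_eq: "real_of_ereal (vec_energy_term \<kappa> Ip \<nu> \<nu> ij) = sgn2 ij * real_energy \<kappa> (\<nu> (fst ij)) (\<nu> (snd ij))"
    if "ij \<in> I \<times> I" for ij
    using vec_energy_term_eq[of \<nu> "fst ij" \<nu> "snd ij"] sr[of "fst ij"] sr[of "snd ij"]
      Dp_fin[of "fst ij" "snd ij"] that by (simp add: mem_Times_iff)
  have neg: "Tn I \<nu> \<nu> < \<infinity>" by (rule total_neg_finite[OF sr sr compact_finite])
  have "integrable (count_space (I \<times> I)) (\<lambda>ij. real_of_ereal (vec_energy_term \<kappa> Ip \<nu> \<nu> ij))"
    by (rule ext_sum_finiteD(1)[OF fin])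
  then have norm: "(\<integral>\<^sup>+ij. ennreal (norm (real_of_ereal (vec_energy_term \<kappa> Ip \<nu> \<nu> ij))) \<partial>count_space (I \<times> I)) < \<infinity>"
    by (simp add: integrable_iff_bounded)
  have "Tp I \<nu> \<nu>
      \<le> (\<integral>\<^sup>+ij. ennreal (norm (real_of_ereal (vec_energy_term \<kappa> Ip \<nu> \<nu> ij))) + Dn (\<nu> (fst ij)) (\<nu> (snd ij)) \<partial>count_space (I \<times> I))"
    unfolding total_def
  proof (rule nn_integral_mono)
    fix ij
    assume "ij \<in> space (count_space (I \<times> I))"
    then have ij: "ij \<in> I \<times> I" "fst ij \<in> I" "snd ij \<in> I" by auto
    have p: "Dp (\<nu> (fst ij)) (\<nu> (snd ij)) = ennreal (enn2real (Dp (\<nu> (fst ij)) (\<nu> (snd ij))))"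
      using Dp_fin[OF ij(2,3)] by simp
    have n: "Dn (\<nu> (fst ij)) (\<nu> (snd ij)) = ennreal (enn2real (Dn (\<nu> (fst ij)) (\<nu> (snd ij))))"
      using Dn_finite[OF sr[OF ij(2)] sr[OF ij(3)]] by simp
    have "norm (real_of_ereal (vec_energy_term \<kappa> Ip \<nu> \<nu> ij)) = \<bar>real_energy \<kappa> (\<nu> (fst ij)) (\<nu> (snd ij))\<bar>"
      unfolding t_eq[OF ij(1)] by (simp add: abs_mult)
    then have "enn2real (Dp (\<nu> (fst ij)) (\<nu> (snd ij)))
        \<le> norm (real_of_ereal (vec_energy_term \<kappa> Ip \<nu> \<nu> ij)) + enn2real (Dn (\<nu> (fst ij)) (\<nu> (snd ij)))"
      unfolding real_energy_def by linarith
    then have "ennreal (enn2real (Dp (\<nu> (fst ij)) (\<nu> (snd ij))))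
        \<le> ennreal (norm (real_of_ereal (vec_energy_term \<kappa> Ip \<nu> \<nu> ij)) + enn2real (Dn (\<nu> (fst ij)) (\<nu> (snd ij))))"
      by (rule ennreal_leI)
    also have "\<dots> = ennreal (norm (real_of_ereal (vec_energy_term \<kappa> Ip \<nu> \<nu> ij)))
        + ennreal (enn2real (Dn (\<nu> (fst ij)) (\<nu> (snd ij))))"
      by (rule ennreal_plus[OF norm_ge_zero enn2real_nonneg])
    finally show "Dp (\<nu> (fst ij)) (\<nu> (snd ij))
        \<le> ennreal (norm (real_of_ereal (vec_energy_term \<kappa> Ip \<nu> \<nu> ij))) + Dn (\<nu> (fst ij)) (\<nu> (snd ij))"
      unfolding p[symmetric] n[symmetric] .
  qed
  also have "\<dots> = (\<integral>\<^sup>+ij. ennreal (norm (real_of_ereal (vec_energy_term \<kappa> Ip \<nu> \<nu> ij))) \<partial>count_space (I \<times> I))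
      + Tn I \<nu> \<nu>"
    unfolding total_def by (rule nn_integral_add) simp_all
  also have "\<dots> < \<infinity>"
    using norm neg by simp
  finally show ?thesis .
qed

text \<open>The mutual energy of two vector measures.\<close>

definition signed_total :: "(nat \<Rightarrow> 'a measure) \<Rightarrow> (nat \<Rightarrow> 'a measure) \<Rightarrow> real" where
  "signed_total p q = (\<integral>ij. sgn2 ij * real_energy \<kappa> (p (fst ij)) (q (snd ij)) \<partial>count_space (I \<times> I))"

lemma admissible_mutual:
  assumes \<nu>: "\<nu> \<in> Adm" and \<mu>: "\<mu> \<in> Adm"
  shows "Tp I \<nu> \<mu> < \<infinity>" and "Tn I \<nu> \<mu> < \<infinity>"
    and "integrable (count_space (I \<times> I)) (\<lambda>ij. sgn2 ij * real_energy \<kappa> (\<nu> (fst ij)) (\<mu> (snd ij)))"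
proof -
  note sr = admissible_measure(1)[OF \<nu>] admissible_measure(1)[OF \<mu>]
  show pos: "Tp I \<nu> \<mu> < \<infinity>"
    using family_energy_inequality[OF sr compact_finite admissible_energy[OF \<nu>] admissible_energy[OF \<mu>]] by (rule conjunct1)
  show neg: "Tn I \<nu> \<mu> < \<infinity>" by (rule total_neg_finite[OF sr compact_finite])
  show "integrable (count_space (I \<times> I)) (\<lambda>ij. sgn2 ij * real_energy \<kappa> (\<nu> (fst ij)) (\<mu> (snd ij)))"
    by (rule Bochner_Integration.integrable_bound[OF integral_real_energy(1)[OF pos neg]])
      (simp_all add: abs_mult)
qed

lemma vec_energy_eq:
  assumes \<nu>: "\<nu> \<in> Adm"
  shows "vec_energy \<kappa> Ip In \<nu> \<nu> = ereal (signed_total \<nu> \<nu>)"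
  unfolding vec_energy_def signed_total_def
proof (rule ext_sum_real(2)[OF admissible_mutual(3)[OF \<nu> \<nu>]])
  fix ij
  assume ij: "ij \<in> I \<times> I"
  note sr = admissible_measure(1)[OF \<nu>]
  have "AE ij in count_space (I \<times> I). Dp (\<nu> (fst ij)) (\<nu> (snd ij)) < \<infinity>"
    using admissible_energy[OF \<nu>] unfolding total_def by (intro integral_enn2real(3)) simp_all
  then have "Dp (\<nu> (fst ij)) (\<nu> (snd ij)) < \<infinity>"
    using ij unfolding AE_count_space by blast
  then show "vec_energy_term \<kappa> Ip \<nu> \<nu> ij = ereal (sgn2 ij * real_energy \<kappa> (\<nu> (fst ij)) (\<nu> (snd ij)))"
    using vec_energy_term_eq[of \<nu> "fst ij" \<nu> "snd ij"] sr[of "fst ij"] sr[of "snd ij"] ij by (simp add: mem_Times_iff)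
qed

lemma signed_total_sym:
  assumes \<nu>: "\<nu> \<in> Adm" and \<mu>: "\<mu> \<in> Adm"
  shows "signed_total \<nu> \<mu> = signed_total \<mu> \<nu>"
proof -
  have "bij_betw prod.swap (I \<times> I) (I \<times> I)"
    by (rule bij_betwI[where g=prod.swap]) auto
  then have "signed_total \<nu> \<mu> = (\<integral>ij. sgn2 (prod.swap ij) * real_energy \<kappa> (\<nu> (fst (prod.swap ij))) (\<mu> (snd (prod.swap ij))) \<partial>count_space (I \<times> I))"
    unfolding signed_total_def by (rule integral_bij_count_space[symmetric])
  also have "\<dots> = signed_total \<mu> \<nu>"
    unfolding signed_total_def
  proof (rule Bochner_Integration.integral_cong[OF refl])
    fix ij
    assume "ij \<in> space (count_space (I \<times> I))"
    then have "fst ij \<in> I" "snd ij \<in> I" by auto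
    then have "real_energy \<kappa> (\<nu> (snd ij)) (\<mu> (fst ij)) = real_energy \<kappa> (\<mu> (fst ij)) (\<nu> (snd ij))"
      by (intro real_energy_sym admissible_measure(1)[OF \<nu>] admissible_measure(1)[OF \<mu>])
    then show "sgn2 (prod.swap ij) * real_energy \<kappa> (\<nu> (fst (prod.swap ij))) (\<mu> (snd (prod.swap ij)))
        = sgn2 ij * real_energy \<kappa> (\<mu> (fst ij)) (\<nu> (snd ij))"
      by simp
  qed
  finally show ?thesis .
qed

text \<open>
  The energy of \<open>\<nu> - \<mu>\<close> is that of the difference of the families \<open>p\<close> and \<open>q\<close>, which exchange \<open>\<nu>\<^sup>i\<close> and
  \<open>\<mu>\<^sup>i\<close> according to the sign of the plate; thereby the signs \<open>\<alpha>\<^sub>i \<alpha>\<^sub>j\<close> disappear.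
\<close>

lemma signed_total_inequality:
  assumes \<nu>: "\<nu> \<in> Adm" and \<mu>: "\<mu> \<in> Adm"
  shows "2 * signed_total \<nu> \<mu> \<le> signed_total \<nu> \<nu> + signed_total \<mu> \<mu>"
proof -
  define p where "p i = (if i \<in> Ip then \<mu> i else \<nu> i)" for i
  define q where "q i = (if i \<in> Ip then \<nu> i else \<mu> i)" for i
  have p: "sigma_radon (p i)" and q: "sigma_radon (q i)" if "i \<in> I" for i
    using admissible_measure(1)[OF \<nu> that] admissible_measure(1)[OF \<mu> that] unfolding p_def q_def by simp_all
  let ?T = "\<lambda>r s ij. Dp (r (fst ij)) (s (snd ij))"
  have mixed: "Tp I r s < \<infinity>"
    if rs: "\<And>i. r i = \<mu> i \<or> r i = \<nu> i" "\<And>i. s i = \<mu> i \<or> s i = \<nu> i" for r s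
  proof -
    have "Tp I r s \<le> (\<integral>\<^sup>+ij. (?T \<mu> \<mu> ij + ?T \<mu> \<nu> ij) + (?T \<nu> \<mu> ij + ?T \<nu> \<nu> ij) \<partial>count_space (I \<times> I))"
      unfolding total_def
    proof (rule nn_integral_mono)
      fix ij
      have le: "x1 \<le> (x1 + x2) + (x3 + x4)" "x2 \<le> (x1 + x2) + (x3 + x4)" "x3 \<le> (x1 + x2) + (x3 + x4)" "x4 \<le> (x1 + x2) + (x3 + x4)"
        for x1 x2 x3 x4 :: ennreal
        by (intro add_increasing2[OF zero_le add_increasing2[OF zero_le order_refl]]
            add_increasing2[OF zero_le add_increasing[OF zero_le order_refl]]
            add_increasing[OF zero_le add_increasing2[OF zero_le order_refl]]
            add_increasing[OF zero_le add_increasing[OF zero_le order_refl]])+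
      show "?T r s ij \<le> (?T \<mu> \<mu> ij + ?T \<mu> \<nu> ij) + (?T \<nu> \<mu> ij + ?T \<nu> \<nu> ij)"
        using rs(1)[of "fst ij"] rs(2)[of "snd ij"] by (elim disjE) (simp_all only: le)
    qed
    also have "\<dots> = (Tp I \<mu> \<mu> + Tp I \<mu> \<nu>) + (Tp I \<nu> \<mu> + Tp I \<nu> \<nu>)"
      unfolding total_def by (simp add: nn_integral_add)
    also have "\<dots> < \<infinity>"
      using admissible_mutual(1)[OF \<mu> \<mu>] admissible_mutual(1)[OF \<mu> \<nu>] admissible_mutual(1)[OF \<nu> \<mu>] admissible_mutual(1)[OF \<nu> \<nu>]
      by simp
    finally show ?thesis .
  qed
  have pr: "p i = \<mu> i \<or> p i = \<nu> i" and qr: "q i = \<mu> i \<or> q i = \<nu> i" for i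
    unfolding p_def q_def by simp_all
  note fin = mixed[OF pr pr] mixed[OF qr qr] mixed[OF pr qr] mixed[OF qr pr]
  note neg = total_neg_finite[OF p p compact_finite] total_neg_finite[OF q q compact_finite]
    total_neg_finite[OF p q compact_finite] total_neg_finite[OF q p compact_finite]
  note R = integral_real_energy[OF fin(1) neg(1)] integral_real_energy[OF fin(2) neg(2)]
    integral_real_energy[OF fin(3) neg(3)] integral_real_energy[OF fin(4) neg(4)]
  note S = admissible_mutual(3)[OF \<mu> \<mu>] admissible_mutual(3)[OF \<nu> \<nu>] admissible_mutual(3)[OF \<mu> \<nu>] admissible_mutual(3)[OF \<nu> \<mu>]
  let ?R = "\<lambda>r s ij. real_energy \<kappa> (r (fst ij)) (s (snd ij))"
  have "2 * total_energy I p q \<le> total_energy I p p + total_energy I q q"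
    using family_energy_inequality[OF p q compact_finite fin(1,2)] by (rule conjunct2)
  moreover have "2 * total_energy I q p \<le> total_energy I q q + total_energy I p p"
    using family_energy_inequality[OF q p compact_finite fin(2,1)] by (rule conjunct2)
  ultimately have "0 \<le> (total_energy I p p + total_energy I q q) - (total_energy I p q + total_energy I q p)"
    by simp
  also have "\<dots> = (\<integral>ij. (?R p p ij + ?R q q ij) - (?R p q ij + ?R q p ij) \<partial>count_space (I \<times> I))"
    by (simp only: R Bochner_Integration.integrable_add
        Bochner_Integration.integral_add Bochner_Integration.integral_diff)
  also have "\<dots> = (\<integral>ij. (sgn2 ij * ?R \<mu> \<mu> ij + sgn2 ij * ?R \<nu> \<nu> ij) - (sgn2 ij * ?R \<mu> \<nu> ij + sgn2 ij * ?R \<nu> \<mu> ij) \<partial>count_space (I \<times> I))"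
    by (rule Bochner_Integration.integral_cong[OF refl]) (simp add: p_def q_def sgn_of_def)
  also have "\<dots> = (signed_total \<mu> \<mu> + signed_total \<nu> \<nu>) - (signed_total \<mu> \<nu> + signed_total \<nu> \<mu>)"
    unfolding signed_total_def by (simp only: S Bochner_Integration.integrable_add
        Bochner_Integration.integral_add Bochner_Integration.integral_diff)
  finally show ?thesis
    using signed_total_sym[OF \<nu> \<mu>] by simp
qed

end

section \<open>Integrating weighted potentials\<close>

context condenser_problem
begin

abbreviation "V \<equiv> vec_potential \<kappa> Ip In"
abbreviation "V_term \<equiv> vec_potential_term \<kappa> Ip"
abbreviation "W \<equiv> weighted_potential \<kappa> Ip In f1 f2"
abbreviation "W_defined \<equiv> weighted_potential_defined \<kappa> Ip In f1 f2"

definition pot_pos :: "'a measure \<Rightarrow> 'a \<Rightarrow> ennreal" where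
  "pot_pos M x = (\<integral>\<^sup>+y. pos_part \<kappa> (x, y) \<partial>M)"

definition pot_neg :: "'a measure \<Rightarrow> 'a \<Rightarrow> ennreal" where
  "pot_neg M x = (\<integral>\<^sup>+y. neg_part \<kappa> (x, y) \<partial>M)"

definition real_pot :: "'a measure \<Rightarrow> 'a \<Rightarrow> real" where
  "real_pot M x = enn2real (pot_pos M x) - enn2real (pot_neg M x)"

lemma pot_borel:
  assumes "sigma_radon M"
  shows "pot_pos M \<in> borel_measurable borel" "pot_neg M \<in> borel_measurable borel"
  unfolding pot_pos_def[abs_def] pot_neg_def[abs_def]
  by (rule section_nn_integral_measurable[OF assms parts_borel(1)], rule section_nn_integral_measurable[OF assms parts_borel(2)])

lemma potential_eq: "potential \<kappa> M x = enn2ereal (pot_pos M x) - enn2ereal (pot_neg M x)"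
  unfolding potential_def ext_integral_def pot_pos_def pot_neg_def pos_part_def neg_part_def ..

lemma potential_borel:
  assumes "sigma_radon M"
  shows "potential \<kappa> M \<in> borel_measurable borel"
  unfolding potential_eq[abs_def] using pot_borel[OF assms] by simp

definition vp_pos :: "(nat \<Rightarrow> 'a measure) \<Rightarrow> nat \<Rightarrow> 'a \<Rightarrow> ennreal" where
  "vp_pos \<mu> i x = (\<integral>\<^sup>+j. e2ennreal (V_term \<mu> i x j) \<partial>count_space I)"

definition vp_neg :: "(nat \<Rightarrow> 'a measure) \<Rightarrow> nat \<Rightarrow> 'a \<Rightarrow> ennreal" where
  "vp_neg \<mu> i x = (\<integral>\<^sup>+j. e2ennreal (- V_term \<mu> i x j) \<partial>count_space I)"

lemma vp_borel:
  assumes \<mu>: "\<mu> \<in> Adm"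
  shows "vp_pos \<mu> i \<in> borel_measurable borel" "vp_neg \<mu> i \<in> borel_measurable borel"
proof -
  interpret count: sigma_finite_measure "count_space I"
    by (rule sigma_finite_measure_count_space_countable) simp
  have t: "(\<lambda>x. V_term \<mu> i x j) \<in> borel_measurable borel" if "j \<in> I" for j
    unfolding vec_potential_term_def
    using potential_borel[OF admissible_measure(1)[OF \<mu> that]] by measurable
  have "(\<lambda>xj. e2ennreal (V_term \<mu> i (fst xj) (snd xj))) \<in> borel_measurable (borel \<Otimes>\<^sub>M count_space I)"
    "(\<lambda>xj. e2ennreal (- V_term \<mu> i (fst xj) (snd xj))) \<in> borel_measurable (borel \<Otimes>\<^sub>M count_space I)"
    using t
    by (intro measurable_compose_countable'[where f="\<lambda>j xj. e2ennreal (V_term \<mu> i (fst xj) j)" and g=snd and I=I]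
        measurable_compose_countable'[where f="\<lambda>j xj. e2ennreal (- V_term \<mu> i (fst xj) j)" and g=snd and I=I];
        simp)+
  then show "vp_pos \<mu> i \<in> borel_measurable borel" "vp_neg \<mu> i \<in> borel_measurable borel"
    unfolding vp_pos_def[abs_def] vp_neg_def[abs_def]
    by (intro count.borel_measurable_nn_integral; simp add: case_prod_unfold)+
qed

lemma vec_potential_eq: "V \<mu> i x = enn2ereal (vp_pos \<mu> i x) - enn2ereal (vp_neg \<mu> i x)"
  unfolding vec_potential_def ext_integral_def vp_pos_def vp_neg_def ..

lemma vec_potential_defined_iff:
  "vec_potential_defined \<kappa> Ip In \<mu> i x \<longleftrightarrow> \<not> (vp_pos \<mu> i x = \<infinity> \<and> vp_neg \<mu> i x = \<infinity>)"
  unfolding vec_potential_defined_def ext_integral_defined_def vp_pos_def vp_neg_def by simp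

lemma vec_potential_borel:
  assumes \<mu>: "\<mu> \<in> Adm"
  shows "V \<mu> i \<in> borel_measurable borel"
  unfolding vec_potential_eq[abs_def] using vp_borel[OF \<mu>] by simp

lemma field_borel:
  assumes "i \<in> I"
  shows "f1 i \<in> borel_measurable borel" "f2 i \<in> borel_measurable borel"
    "field_fun f1 f2 i \<in> borel_measurable borel"
proof -
  show *: "f1 i \<in> borel_measurable borel" "f2 i \<in> borel_measurable borel"
    using field assms unfolding external_field_def Phi_def by (auto intro: lower_semicontinuous_borel)
  then show "field_fun f1 f2 i \<in> borel_measurable borel"
    unfolding field_fun_def[abs_def] by simp
qed

lemma weighted_potential_borel:
  assumes "\<mu> \<in> Adm" "i \<in> I"
  shows "W \<mu> i \<in> borel_measurable borel"
  unfolding weighted_potential_def[abs_def] using vec_potential_borel[OF assms(1)] field_borel(3)[OF assms(2)] by simp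

lemma admissible_slice:
  assumes \<nu>: "\<nu> \<in> Adm" and \<mu>: "\<mu> \<in> Adm" and i: "i \<in> I"
  shows "(\<integral>\<^sup>+j. Dp (\<nu> i) (\<mu> j) \<partial>count_space I) < \<infinity>" "(\<integral>\<^sup>+j. Dn (\<nu> i) (\<mu> j) \<partial>count_space I) < \<infinity>"
proof -
  have slice: "(\<integral>\<^sup>+j. double_integral h (\<nu> i) (\<mu> j) \<partial>count_space I) < \<infinity>" if "total h I \<nu> \<mu> < \<infinity>" for h
  proof -
    have inj: "inj_on (Pair i) I" by (rule inj_onI) simp
    have "(\<integral>\<^sup>+j. double_integral h (\<nu> i) (\<mu> j) \<partial>count_space I)
        = (\<integral>\<^sup>+ij. double_integral h (\<nu> (fst ij)) (\<mu> (snd ij)) \<partial>count_space (Pair i ` I))"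
      using nn_integral_bij_count_space[OF inj_on_imp_bij_betw[OF inj], of "\<lambda>ij. double_integral h (\<nu> (fst ij)) (\<mu> (snd ij))"]
      by simp
    also have "\<dots> \<le> total h I \<nu> \<mu>"
    proof -
      have "Pair i ` I \<subseteq> I \<times> I"
        using i by auto
      then show ?thesis
        unfolding total_def
        by (subst nn_integral_count_space_subset, assumption, intro nn_integral_mono) (simp split: split_indicator)
    qed
    finally show ?thesis
      using that by (rule le_less_trans)
  qed
  show "(\<integral>\<^sup>+j. Dp (\<nu> i) (\<mu> j) \<partial>count_space I) < \<infinity>" "(\<integral>\<^sup>+j. Dn (\<nu> i) (\<mu> j) \<partial>count_space I) < \<infinity>"
    by (rule slice[OF admissible_mutual(1)[OF \<nu> \<mu>]], rule slice[OF admissible_mutual(2)[OF \<nu> \<mu>]])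
qed

text \<open>
  Fubini's theorem for the counting measure on the indices and \<open>\<nu>\<^sup>i\<close>. Since the mutual energies of the
  two vector measures are absolutely summable, \<open>\<nu>\<^sup>i\<close>-almost everywhere all potentials of the \<open>\<mu>\<^sup>j\<close> are
  finite and their sum converges absolutely.
\<close>

lemma vec_potential_integral:
  assumes \<nu>: "\<nu> \<in> Adm" and \<mu>: "\<mu> \<in> Adm" and i: "i \<in> I"
  shows "ext_integral_finite (\<nu> i) (V \<mu> i)"
    and "ext_integral (\<nu> i) (V \<mu> i)
      = ereal (\<integral>j. sgn2 (i, j) * real_energy \<kappa> (\<nu> i) (\<mu> j) \<partial>count_space I)"
proof -
  note M = admissible_measure(1)[OF \<nu> i] and N = admissible_measure(1)[OF \<mu>]
  interpret M: sigma_finite_measure "\<nu> i"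
    using M unfolding sigma_radon_def by blast
  interpret count: sigma_finite_measure "count_space I"
    by (rule sigma_finite_measure_count_space_countable) simp
  interpret pair: pair_sigma_finite "count_space I" "\<nu> i" ..
  note slice = admissible_slice[OF \<nu> \<mu> i]
  have pot_M: "pot_pos (\<mu> j) \<in> borel_measurable (\<nu> i)" "pot_neg (\<mu> j) \<in> borel_measurable (\<nu> i)" if "j \<in> I" for j
    using pot_borel[OF N[OF that]] sigma_radon_measurable[OF M] by blast+
  have D_eq: "(\<integral>\<^sup>+x. pot_pos (\<mu> j) x \<partial>\<nu> i) = Dp (\<nu> i) (\<mu> j)" "(\<integral>\<^sup>+x. pot_neg (\<mu> j) x \<partial>\<nu> i) = Dn (\<nu> i) (\<mu> j)" for j
    unfolding double_integral_def pot_pos_def pot_neg_def by simp_all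
  have "AE j in count_space I. Dp (\<nu> i) (\<mu> j) < \<infinity>" "AE j in count_space I. Dn (\<nu> i) (\<mu> j) < \<infinity>"
    by (rule integral_enn2real(3)[OF _ slice(1)], simp, rule integral_enn2real(3)[OF _ slice(2)], simp)
  then have D_fin: "Dp (\<nu> i) (\<mu> j) < \<infinity>" "Dn (\<nu> i) (\<mu> j) < \<infinity>" if "j \<in> I" for j
    using that unfolding AE_count_space by blast+
  note pos = integral_enn2real[OF pot_M(1), unfolded D_eq, OF _ D_fin(1)]
  note neg = integral_enn2real[OF pot_M(2), unfolded D_eq, OF _ D_fin(2)]
  define F where "F j x = sgn2 (i, j) * real_pot (\<mu> j) x" for j x
  have F_int: "(\<integral>x. F j x \<partial>\<nu> i) = sgn2 (i, j) * real_energy \<kappa> (\<nu> i) (\<mu> j)" if "j \<in> I" for j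
    unfolding F_def real_pot_def real_energy_def
    by (simp add: Bochner_Integration.integral_diff[OF pos(1)[OF that that] neg(1)[OF that that]] pos(2)[OF that that] neg(2)[OF that that])
  have F_meas: "F j \<in> borel_measurable (\<nu> i)" if "j \<in> I" for j
    unfolding F_def[abs_def] real_pot_def[abs_def] using pot_M[OF that] by simp
  have F_pair: "case_prod F \<in> borel_measurable (count_space I \<Otimes>\<^sub>M \<nu> i)"
    by (rule measurable_pair_measure_countable1) (simp_all add: F_meas)
  have "integrable (count_space I \<Otimes>\<^sub>M \<nu> i) (case_prod F)"
    unfolding integrable_iff_bounded
  proof (intro conjI F_pair)
    have "(\<integral>\<^sup>+jx. ennreal (norm (case_prod F jx)) \<partial>(count_space I \<Otimes>\<^sub>M \<nu> i))
        = (\<integral>\<^sup>+j. \<integral>\<^sup>+x. ennreal (norm (case_prod F (j, x))) \<partial>\<nu> i \<partial>count_space I)"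
      by (rule M.nn_integral_fst[symmetric]) (use F_pair in measurable)
    also have "\<dots> \<le> (\<integral>\<^sup>+j. Dp (\<nu> i) (\<mu> j) + Dn (\<nu> i) (\<mu> j) \<partial>count_space I)"
    proof (rule nn_integral_mono)
      fix j
      assume "j \<in> space (count_space I)"
      then have j: "j \<in> I" by simp
      have "(\<integral>\<^sup>+x. ennreal (norm (case_prod F (j, x))) \<partial>\<nu> i) \<le> (\<integral>\<^sup>+x. pot_pos (\<mu> j) x + pot_neg (\<mu> j) x \<partial>\<nu> i)"
      proof (rule nn_integral_mono_AE)
        show "AE x in \<nu> i. ennreal (norm (case_prod F (j, x))) \<le> pot_pos (\<mu> j) x + pot_neg (\<mu> j) x"
          using pos(3)[OF j j] neg(3)[OF j j]
        proof eventually_elim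
          case (elim x)
          have "norm (case_prod F (j, x)) \<le> enn2real (pot_pos (\<mu> j) x) + enn2real (pot_neg (\<mu> j) x)"
            unfolding F_def real_pot_def by (simp add: abs_mult abs_le_iff)
          then have "ennreal (norm (case_prod F (j, x))) \<le> ennreal (enn2real (pot_pos (\<mu> j) x) + enn2real (pot_neg (\<mu> j) x))"
            by (rule ennreal_leI)
          then show ?case
            using elim by simp
        qed
      qed
      also have "\<dots> = Dp (\<nu> i) (\<mu> j) + Dn (\<nu> i) (\<mu> j)"
        unfolding D_eq[symmetric] by (rule nn_integral_add[OF pot_M[OF j]])
      finally show "(\<integral>\<^sup>+x. ennreal (norm (case_prod F (j, x))) \<partial>\<nu> i) \<le> Dp (\<nu> i) (\<mu> j) + Dn (\<nu> i) (\<mu> j)" .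
    qed
    also have "\<dots> = (\<integral>\<^sup>+j. Dp (\<nu> i) (\<mu> j) \<partial>count_space I) + (\<integral>\<^sup>+j. Dn (\<nu> i) (\<mu> j) \<partial>count_space I)"
      by (rule nn_integral_add) simp_all
    also have "\<dots> < \<infinity>"
      using slice by simp
    finally show "(\<integral>\<^sup>+jx. ennreal (norm (case_prod F jx)) \<partial>(count_space I \<Otimes>\<^sub>M \<nu> i)) < \<infinity>" .
  qed
  note F_integrable = this
  have "AE x in \<nu> i. \<forall>j\<in>I. pot_pos (\<mu> j) x < \<infinity> \<and> pot_neg (\<mu> j) x < \<infinity>"
    using pos(3) neg(3) by (intro AE_ball_countable' ) auto
  with pair.AE_integrable_snd[OF F_integrable]
  have ae: "AE x in \<nu> i. V \<mu> i x = ereal (\<integral>j. F j x \<partial>count_space I)"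
  proof eventually_elim
    case (elim x)
    have "V_term \<mu> i x j = ereal (F j x)" if "j \<in> I" for j
    proof -
      have "pot_pos (\<mu> j) x < \<infinity>" "pot_neg (\<mu> j) x < \<infinity>"
        using elim(2) that by blast+
      then show ?thesis
        unfolding vec_potential_term_def potential_eq F_def real_pot_def
        by (simp add: enn2ereal_eq_enn2real plate_sign_eq)
    qed
    then show ?case
      unfolding vec_potential_def by (rule ext_sum_real(2)[OF elim(1)])
  qed
  have int: "integrable (\<nu> i) (\<lambda>x. \<integral>j. F j x \<partial>count_space I)"
    by (rule pair.integrable_snd[OF F_integrable])
  have m: "V \<mu> i \<in> borel_measurable (\<nu> i)"
    by (rule sigma_radon_measurable[OF M vec_potential_borel[OF \<mu>]])
  show "ext_integral_finite (\<nu> i) (V \<mu> i)" by (rule ext_integral_AE_real(1)[OF int m ae])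
  have "ext_integral (\<nu> i) (V \<mu> i) = ereal (\<integral>x. \<integral>j. F j x \<partial>count_space I \<partial>\<nu> i)"
    by (rule ext_integral_AE_real(2)[OF int m ae])
  also have "(\<integral>x. \<integral>j. F j x \<partial>count_space I \<partial>\<nu> i) = (\<integral>j. \<integral>x. F j x \<partial>\<nu> i \<partial>count_space I)"
    by (rule pair.Fubini_integral[OF F_integrable])
  also have "\<dots> = (\<integral>j. sgn2 (i, j) * real_energy \<kappa> (\<nu> i) (\<mu> j) \<partial>count_space I)"
    by (rule Bochner_Integration.integral_cong[OF refl]) (simp add: F_int)
  finally show "ext_integral (\<nu> i) (V \<mu> i)
      = ereal (\<integral>j. sgn2 (i, j) * real_energy \<kappa> (\<nu> i) (\<mu> j) \<partial>count_space I)" .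
qed

end

section \<open>The variational identity\<close>

context condenser_problem
begin

text \<open>
  The pairings of the component \<open>\<nu>\<^sup>i\<close> with \<open>f\<^sub>i\<close> and, by \<open>weighted_potential_integral\<close> below, with
  \<open>W\<^sub>\<mu>\<^sup>i\<close>.
\<close>

definition field_mass :: "(nat \<Rightarrow> 'a measure) \<Rightarrow> nat \<Rightarrow> real" where
  "field_mass \<nu> i = real_of_ereal (ext_integral (\<nu> i) (field_fun f1 f2 i))"

definition potential_mass :: "(nat \<Rightarrow> 'a measure) \<Rightarrow> (nat \<Rightarrow> 'a measure) \<Rightarrow> nat \<Rightarrow> real" where
  "potential_mass \<nu> \<mu> i = (\<integral>j. sgn2 (i, j) * real_energy \<kappa> (\<nu> i) (\<mu> j) \<partial>count_space I) + field_mass \<nu> i"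

definition field_total :: "(nat \<Rightarrow> 'a measure) \<Rightarrow> real" where
  "field_total \<nu> = (\<integral>i. field_mass \<nu> i \<partial>count_space I)"

lemma field_pairing_eq:
  assumes \<nu>: "\<nu> \<in> Adm"
  shows "integrable (count_space I) (field_mass \<nu>)" and "field_pairing I f1 f2 \<nu> = ereal (field_total \<nu>)"
    and "i \<in> I \<Longrightarrow> ext_integral_finite (\<nu> i) (field_fun f1 f2 i)"
    and "i \<in> I \<Longrightarrow> ext_integral (\<nu> i) (field_fun f1 f2 i) = ereal (field_mass \<nu> i)"
proof -
  have fin: "field_pairing_finite I f1 f2 \<nu>"
    using \<nu> unfolding admissible_def by blast
  then have sum: "ext_sum_finite I (\<lambda>i. ext_integral (\<nu> i) (field_fun f1 f2 i))"
    unfolding field_pairing_finite_def by blast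
  note D = ext_sum_finiteD[OF sum]
  show "integrable (count_space I) (field_mass \<nu>)"
    unfolding field_mass_def[abs_def] by (rule D(1))
  show "field_pairing I f1 f2 \<nu> = ereal (field_total \<nu>)"
    unfolding field_pairing_def field_total_def field_mass_def by (rule D(2))
  assume i: "i \<in> I"
  show eq: "ext_integral (\<nu> i) (field_fun f1 f2 i) = ereal (field_mass \<nu> i)"
    unfolding field_mass_def by (rule D(3)[OF i])
  have def: "ext_integral_defined (\<nu> i) (field_fun f1 f2 i)"
    using fin i unfolding field_pairing_finite_def pairing_defined_def by blast
  let ?p = "\<integral>\<^sup>+x. e2ennreal (field_fun f1 f2 i x) \<partial>\<nu> i" and ?n = "\<integral>\<^sup>+x. e2ennreal (- field_fun f1 f2 i x) \<partial>\<nu> i"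
  have "?p < \<infinity> \<and> ?n < \<infinity>"
  proof (cases "?p = \<infinity>")
    case True
    then have "?n < \<infinity>"
      using def unfolding ext_integral_defined_def by (simp add: less_top)
    then have "ext_integral (\<nu> i) (field_fun f1 f2 i) = \<infinity>"
      unfolding ext_integral_def True by (simp add: enn2ereal_eq_enn2real)
    with eq show ?thesis
      by simp
  next
    case False
    then have p: "?p < \<infinity>" by (simp add: less_top)
    moreover have "?n < \<infinity>"
    proof (rule ccontr)
      assume "\<not> ?thesis"
      then have n: "?n = \<infinity>" by (simp add: less_top[symmetric])
      have "ext_integral (\<nu> i) (field_fun f1 f2 i) = - \<infinity>"
        unfolding ext_integral_def n using p by (simp add: enn2ereal_eq_enn2real)
      with eq show False
        by simp
    qed
    ultimately show ?thesis by blast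
  qed
  then show "ext_integral_finite (\<nu> i) (field_fun f1 f2 i)"
    using def unfolding ext_integral_finite_def ext_integral_defined_def by blast
qed

lemma weighted_potential_integral:
  assumes \<nu>: "\<nu> \<in> Adm" and \<mu>: "\<mu> \<in> Adm" and i: "i \<in> I"
  shows "ext_integral_finite (\<nu> i) (W \<mu> i)"
    and "ext_integral (\<nu> i) (W \<mu> i) = ereal (potential_mass \<nu> \<mu> i)"
proof -
  note V = vec_potential_integral[OF \<nu> \<mu> i] and F = field_pairing_eq(3,4)[OF \<nu> i]
  note VD = ext_integral_finiteD[OF V(1)] and FD = ext_integral_finiteD[OF F(1)]
  let ?v = "\<lambda>x. real_of_ereal (V \<mu> i x)" and ?f = "\<lambda>x. real_of_ereal (field_fun f1 f2 i x)"
  have int: "integrable (\<nu> i) (\<lambda>x. ?v x + ?f x)"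
    by (rule Bochner_Integration.integrable_add[OF VD(1) FD(1)])
  have m: "W \<mu> i \<in> borel_measurable (\<nu> i)"
    by (rule sigma_radon_measurable[OF admissible_measure(1)[OF \<nu> i] weighted_potential_borel[OF \<mu> i]])
  have ae: "AE x in \<nu> i. W \<mu> i x = ereal (?v x + ?f x)"
    using VD(3) FD(3)
  proof eventually_elim
    case (elim x)
    then show ?case
      unfolding weighted_potential_def
      by (cases "V \<mu> i x"; cases "field_fun f1 f2 i x") simp_all
  qed
  show "ext_integral_finite (\<nu> i) (W \<mu> i)" by (rule ext_integral_AE_real(1)[OF int m ae])
  have "ext_integral (\<nu> i) (W \<mu> i) = ereal ((\<integral>x. ?v x \<partial>\<nu> i) + (\<integral>x. ?f x \<partial>\<nu> i))"
    using ext_integral_AE_real(2)[OF int m ae] Bochner_Integration.integral_add[OF VD(1) FD(1)] by simp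
  then show "ext_integral (\<nu> i) (W \<mu> i) = ereal (potential_mass \<nu> \<mu> i)"
    using VD(2) FD(2) V(2) F(2) unfolding potential_mass_def by simp
qed

lemma potential_mass_sum:
  assumes \<nu>: "\<nu> \<in> Adm" and \<mu>: "\<mu> \<in> Adm"
  shows "integrable (count_space I) (potential_mass \<nu> \<mu>)"
    and "(\<integral>i. potential_mass \<nu> \<mu> i \<partial>count_space I) = signed_total \<nu> \<mu> + field_total \<nu>"
proof -
  interpret count: sigma_finite_measure "count_space I"
    by (rule sigma_finite_measure_count_space_countable) simp
  interpret pair: pair_sigma_finite "count_space I" "count_space I" ..
  let ?E = "\<lambda>ij. sgn2 ij * real_energy \<kappa> (\<nu> (fst ij)) (\<mu> (snd ij))"
  have "integrable (count_space I \<Otimes>\<^sub>M count_space I) ?E"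
    using admissible_mutual(3)[OF \<nu> \<mu>] by (simp add: pair_measure_countable)
  note E = this
  have E1: "integrable (count_space I) (\<lambda>i. \<integral>j. ?E (i, j) \<partial>count_space I)"
    by (rule pair.integrable_fst'[OF E])
  have E2: "(\<integral>i. \<integral>j. ?E (i, j) \<partial>count_space I \<partial>count_space I) = signed_total \<nu> \<mu>"
    unfolding signed_total_def using pair.integral_fst'[OF E] by (simp add: pair_measure_countable)
  show "integrable (count_space I) (potential_mass \<nu> \<mu>)"
    unfolding potential_mass_def[abs_def] using E1 field_pairing_eq(1)[OF \<nu>] by (intro Bochner_Integration.integrable_add) simp_all
  show "(\<integral>i. potential_mass \<nu> \<mu> i \<partial>count_space I) = signed_total \<nu> \<mu> + field_total \<nu>"
    unfolding potential_mass_def field_total_def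
    using E1 E2 field_pairing_eq(1)[OF \<nu>] by (subst Bochner_Integration.integral_add) simp_all
qed

lemma weighted_energy_eq:
  assumes \<nu>: "\<nu> \<in> Adm"
  shows "weighted_energy \<kappa> Ip In f1 f2 \<nu> = ereal (signed_total \<nu> \<nu> + 2 * field_total \<nu>)"
  unfolding weighted_energy_def vec_energy_eq[OF \<nu>] field_pairing_eq(2)[OF \<nu>] by simp

lemma weight_integral:
  assumes \<nu>: "\<nu> \<in> Adm" and i: "i \<in> I"
  shows "integrable (\<nu> i) (\<lambda>x. indicator (A i) x *\<^sub>R g i x)" and "(\<integral>x. indicator (A i) x *\<^sub>R g i x \<partial>\<nu> i) = a i"
proof -
  note M = admissible_measure(1)[OF \<nu> i]
  let ?u = "\<lambda>x. indicator (A i) x *\<^sub>R g i x"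
  have "?u \<in> borel_measurable borel"
    using weight i closed_plate[OF i] by (intro borel_measurable_continuous_on_indicator) simp_all
  then have m: "?u \<in> borel_measurable (\<nu> i)" by (rule sigma_radon_measurable[OF M])
  have nonneg: "0 \<le> ?u x" for x
    using weight i by (auto simp: indicator_def intro: less_imp_le)
  have "(\<integral>\<^sup>+x. ennreal (?u x) \<partial>\<nu> i) = (\<integral>\<^sup>+x \<in> A i. ennreal (g i x) \<partial>\<nu> i)"
    by (rule nn_integral_cong) (simp split: split_indicator)
  also have "\<dots> = ennreal (a i)"
    using \<nu> i unfolding admissible_def by blast
  finally have eq: "(\<integral>\<^sup>+x. ennreal (?u x) \<partial>\<nu> i) = ennreal (a i)" .
  show "integrable (\<nu> i) ?u" by (rule integrableI_nonneg[OF m]) (use nonneg eq in simp_all)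
  have "(\<integral>x. ?u x \<partial>\<nu> i) = enn2real (ennreal (a i))"
    using integral_eq_nn_integral[OF m] nonneg eq by simp
  also have "\<dots> = a i"
    by (rule enn2real_ennreal) (use mass i in \<open>simp add: less_imp_le\<close>)
  finally show "(\<integral>x. ?u x \<partial>\<nu> i) = a i" .
qed

text \<open>
  Dividing by \<open>a\<^sub>i\<close> after integration: the integral of \<open>\<eta> g\<^sub>i\<close> against \<open>\<nu>\<^sup>i\<close> is \<open>\<eta> a\<^sub>i\<close> by admissibility.
\<close>

lemma potential_mass_bound:
  fixes \<eta> :: real
  assumes \<nu>: "\<nu> \<in> Adm" and \<mu>: "\<mu> \<in> Adm" and i: "i \<in> I"
  shows "AE x in \<nu> i. ereal (\<eta> * g i x) \<le> ereal (a i) * W \<mu> i x \<Longrightarrow> \<eta> \<le> potential_mass \<nu> \<mu> i"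
    and "AE x in \<nu> i. ereal (a i) * W \<mu> i x \<le> ereal (\<eta> * g i x) \<Longrightarrow> potential_mass \<nu> \<mu> i \<le> \<eta>"
proof -
  let ?u = "\<lambda>x. indicator (A i) x *\<^sub>R g i x"
  note W = weighted_potential_integral[OF \<nu> \<mu> i]
  note WD = ext_integral_finiteD[OF W(1)] and u = weight_integral[OF \<nu> i]
  have int: "integrable (\<nu> i) (\<lambda>x. a i * real_of_ereal (W \<mu> i x))" "integrable (\<nu> i) (\<lambda>x. \<eta> * ?u x)"
    using WD(1) u(1) by (intro integrable_mult_right; simp)+
  have vals: "(\<integral>x. a i * real_of_ereal (W \<mu> i x) \<partial>\<nu> i) = a i * potential_mass \<nu> \<mu> i" "(\<integral>x. \<eta> * ?u x \<partial>\<nu> i) = a i * \<eta>"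
    using WD(2) W(2) u(2) by simp_all
  have pos: "0 < a i"
    using mass i by blast
  note ae = admissible_measure(2)[OF \<nu> i] WD(3)
  {
    assume "AE x in \<nu> i. ereal (\<eta> * g i x) \<le> ereal (a i) * W \<mu> i x"
    then have "AE x in \<nu> i. \<eta> * ?u x \<le> a i * real_of_ereal (W \<mu> i x)"
      using ae
    proof eventually_elim
      case (elim x)
      then show ?case by (cases "W \<mu> i x") simp_all
    qed
    then have "a i * \<eta> \<le> a i * potential_mass \<nu> \<mu> i"
      unfolding vals[symmetric] by (rule integral_mono_AE[OF int(2,1)])
    then show "\<eta> \<le> potential_mass \<nu> \<mu> i"
      using pos by simp
  }
  {
    assume "AE x in \<nu> i. ereal (a i) * W \<mu> i x \<le> ereal (\<eta> * g i x)"
    then have "AE x in \<nu> i. a i * real_of_ereal (W \<mu> i x) \<le> \<eta> * ?u x"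
      using ae
    proof eventually_elim
      case (elim x)
      then show ?case by (cases "W \<mu> i x") simp_all
    qed
    then have "a i * potential_mass \<nu> \<mu> i \<le> a i * \<eta>"
      unfolding vals[symmetric] by (rule integral_mono_AE[OF int])
    then show "potential_mass \<nu> \<mu> i \<le> \<eta>"
      using pos by simp
  }
qed

text \<open>
  The exceptional set is Borel, so it is null for \<open>\<nu>\<^sup>i\<close>, a measure of finite energy supported by \<open>A\<^sub>i\<close>.
\<close>

lemma nearly_everywhere_imp_AE:
  fixes \<eta> :: real
  assumes \<nu>: "\<nu> \<in> Adm" and \<mu>: "\<mu> \<in> Adm" and i: "i \<in> I"
    and ne: "nearly_everywhere \<kappa> (A i) (\<lambda>x. W_defined \<mu> i x \<and>
      ereal (a i) * W \<mu> i x \<ge> ereal (\<eta> * g i x))"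
  shows "AE x in \<nu> i. W_defined \<mu> i x"
    and "AE x in \<nu> i. ereal (\<eta> * g i x) \<le> ereal (a i) * W \<mu> i x"
proof -
  let ?u = "\<lambda>x. indicator (A i) x *\<^sub>R g i x"
  let ?Q = "\<lambda>x. W_defined \<mu> i x \<and> ereal (a i) * W \<mu> i x \<ge> ereal (\<eta> * g i x)"
  let ?B = "{x \<in> A i. \<not> ?Q x}"
  note M = admissible_measure(1)[OF \<nu> i]
  have Ab: "A i \<in> sets borel"
    using closed_plate[OF i] by simp
  have u: "?u \<in> borel_measurable borel"
    using weight i closed_plate[OF i] by (intro borel_measurable_continuous_on_indicator) simp_all
  note [measurable] = vp_borel[OF \<mu>] vec_potential_borel[OF \<mu>] field_borel[OF i] weighted_potential_borel[OF \<mu> i] u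
  have "?B = A i \<inter> {x \<in> space borel. \<not> (
      \<not> (vp_pos \<mu> i x = \<infinity> \<and> vp_neg \<mu> i x = \<infinity>) \<and> \<not> (f1 i x = \<infinity> \<and> f2 i x = \<infinity>) \<and>
      \<not> (V \<mu> i x = \<infinity> \<and> field_fun f1 f2 i x = -\<infinity>) \<and>
      \<not> (V \<mu> i x = -\<infinity> \<and> field_fun f1 f2 i x = \<infinity>) \<and>
      ereal (\<eta> * ?u x) \<le> ereal (a i) * W \<mu> i x)}"
    unfolding weighted_potential_defined_def vec_potential_defined_iff field_defined_def by auto
  also have "\<dots> \<in> sets borel" by (rule sets.Int[OF Ab]) measurable
  finally have B: "?B \<in> sets borel" .
  have "(\<integral>\<^sup>+j. Dp (\<nu> (fst j)) (\<nu> (snd j)) \<partial>count_space (I \<times> I)) < \<infinity>"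
    using admissible_energy[OF \<nu>] unfolding total_def .
  then have "AE ij in count_space (I \<times> I). Dp (\<nu> (fst ij)) (\<nu> (snd ij)) < \<infinity>"
    by (intro integral_enn2real(3)) simp_all
  then have fin: "Dp (\<nu> i) (\<nu> i) < \<infinity>"
    using i unfolding AE_count_space by force
  have "emeasure (\<nu> i) ?B = 0"
    by (rule null_if_capacity_zero[OF M fin B]) (use ne in \<open>simp add: nearly_everywhere_def\<close>)
  then have "AE x in \<nu> i. x \<notin> ?B"
    using B sigma_radon_sets[OF M] by (intro AE_not_in) (simp add: null_sets_def)
  then have "AE x in \<nu> i. ?Q x"
    using admissible_measure(2)[OF \<nu> i] by eventually_elim blast
  then show "AE x in \<nu> i. W_defined \<mu> i x"
    and "AE x in \<nu> i. ereal (\<eta> * g i x) \<le> ereal (a i) * W \<mu> i x"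
    by (simp_all only: AE_conj_iff)
qed

end

theorem theorem7p3:
  fixes \<kappa> :: "'a::t2_space \<times> 'a \<Rightarrow> ereal"
    and Ip In :: "nat set"
    and A :: "nat \<Rightarrow> 'a set"
    and f1 f2 :: "nat \<Rightarrow> 'a \<Rightarrow> ereal"
    and a \<eta> :: "nat \<Rightarrow> real"
    and g :: "nat \<Rightarrow> 'a \<Rightarrow> real"
    and \<mu> :: "nat \<Rightarrow> 'a measure"
  assumes "locally_compact_space (euclidean :: 'a topology)"
    and "\<kappa> \<in> Phi" and "positive_definite \<kappa>"
    and "condenser Ip In A"
    and "external_field \<kappa> (Ip \<union> In) f1 f2"
    and "\<forall>i \<in> Ip \<union> In. continuous_on (A i) (g i) \<and> (\<forall>x \<in> A i. 0 < g i x)"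
    and "\<forall>i \<in> Ip \<union> In. 0 < a i"
    and "equilibrium_measures \<kappa> Ip In f1 f2 A a g \<noteq> {}"
    and "\<mu> \<in> admissible \<kappa> Ip In f1 f2 A a g"
    and "ext_sum_defined (Ip \<union> In) (\<lambda>i. ereal (\<eta> i))"
    and "((\<forall>i \<in> Ip \<union> In. nearly_everywhere \<kappa> (A i) (\<lambda>x.
              weighted_potential_defined \<kappa> Ip In f1 f2 \<mu> i x \<and>
              ereal (a i) * weighted_potential \<kappa> Ip In f1 f2 \<mu> i x \<ge> ereal (\<eta> i * g i x))) \<and>
          weighted_energy \<kappa> Ip In f1 f2 \<mu>
            \<le> ext_sum (Ip \<union> In) (\<lambda>i. ereal (\<eta> i)) + field_pairing (Ip \<union> In) f1 f2 \<mu>)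
       \<or> ((\<forall>i \<in> Ip \<union> In. AE x in \<mu> i.
              weighted_potential_defined \<kappa> Ip In f1 f2 \<mu> i x \<and>
              ereal (a i) * weighted_potential \<kappa> Ip In f1 f2 \<mu> i x \<le> ereal (\<eta> i * g i x)) \<and>
          min_weighted_energy \<kappa> Ip In f1 f2 A a g
            \<ge> ext_sum (Ip \<union> In) (\<lambda>i. ereal (\<eta> i)) + field_pairing (Ip \<union> In) f1 f2 \<mu>)"
  shows "\<mu> \<in> equilibrium_measures \<kappa> Ip In f1 f2 A a g \<and>
    (\<forall>i \<in> Ip \<union> In.
       pairing_defined (weighted_potential_defined \<kappa> Ip In f1 f2 \<mu> i)
         (weighted_potential \<kappa> Ip In f1 f2 \<mu> i) (\<mu> i) \<and>
       ereal (\<eta> i) = ext_integral (\<mu> i) (weighted_potential \<kappa> Ip In f1 f2 \<mu> i))"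
proof -
  interpret condenser_problem \<kappa> Ip In A f1 f2 a g
    by unfold_locales (rule assms)+
  note \<mu> = \<open>\<mu> \<in> Adm\<close>
  let ?w = "potential_mass \<mu> \<mu>"
  let ?m = "min_weighted_energy \<kappa> Ip In f1 f2 A a g"
  let ?G = "weighted_energy \<kappa> Ip In f1 f2" and ?\<eta> = "ext_sum I (\<lambda>i. ereal (\<eta> i))"
  let ?e = "signed_total \<mu> \<mu>" and ?f = "field_total \<mu>"
  note w = potential_mass_sum[OF \<mu> \<mu>]
  have min_le: "?m \<le> ?G \<nu>" if "\<nu> \<in> Adm" for \<nu>
    unfolding min_weighted_energy_def by (rule INF_lower[OF that])
  have pairing: "pairing_defined (W_defined \<mu> i) (W \<mu> i) (\<mu> i)"
    if "i \<in> I" "AE x in \<mu> i. W_defined \<mu> i x" for i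
    using that weighted_potential_integral(1)[OF \<mu> \<mu> that(1)]
    unfolding pairing_defined_def ext_integral_finite_def ext_integral_defined_def by auto
  have goal: ?thesis
    if le: "?G \<mu> \<le> ?m" and eq: "\<forall>i\<in>I. \<eta> i = ?w i"
      and def: "\<And>i. i \<in> I \<Longrightarrow> AE x in \<mu> i. W_defined \<mu> i x"
  proof -
    have "\<mu> \<in> equilibrium_measures \<kappa> Ip In f1 f2 A a g"
      unfolding equilibrium_measures_def using \<mu> antisym[OF le min_le[OF \<mu>]] by simp
    then show ?thesis
      using pairing def eq weighted_potential_integral(2)[OF \<mu> \<mu>] by simp
  qed
  show ?thesis
    using assms(11)
  proof (elim disjE conjE)
    assume ne: "\<forall>i \<in> I. nearly_everywhere \<kappa> (A i) (\<lambda>x. W_defined \<mu> i x \<and>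
        ereal (a i) * W \<mu> i x \<ge> ereal (\<eta> i * g i x))"
      and G: "?G \<mu> \<le> ?\<eta> + field_pairing I f1 f2 \<mu>"
    have bound: "\<eta> i \<le> potential_mass \<nu> \<mu> i" if "\<nu> \<in> Adm" "i \<in> I" for \<nu> i
      by (rule potential_mass_bound(1)[OF that(1) \<mu> that(2)])
        (rule nearly_everywhere_imp_AE(2)[OF that(1) \<mu> that(2) bspec[OF ne that(2)]])
    \<comment> \<open>Cancelling the finite number \<open>F(\<mu>)\<close> from the energy condition.\<close>
    have "ereal (\<integral>i. ?w i \<partial>count_space I) \<le> ?\<eta>"
      using G unfolding w(2) weighted_energy_eq[OF \<mu>] field_pairing_eq(2)[OF \<mu>] by (cases ?\<eta>) simp_all
    note eq = ext_sum_eq_imp_eq[OF w(1) bound[OF \<mu>] this]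
    have le: "?G \<mu> \<le> ?m"
      unfolding min_weighted_energy_def
    proof (rule INF_greatest)
      fix \<nu>
      assume \<nu>: "\<nu> \<in> Adm"
      have "(\<integral>i. ?w i \<partial>count_space I) \<le> (\<integral>i. potential_mass \<nu> \<mu> i \<partial>count_space I)"
        by (rule integral_mono[OF w(1) potential_mass_sum(1)[OF \<nu> \<mu>]]) (use bound[OF \<nu>] eq(1) in simp)
      then have "?e + ?f \<le> signed_total \<nu> \<mu> + field_total \<nu>"
        unfolding w(2) potential_mass_sum(2)[OF \<nu> \<mu>] .
      then have "?e + 2 * ?f \<le> signed_total \<nu> \<nu> + 2 * field_total \<nu>"
        using signed_total_inequality[OF \<nu> \<mu>] by linarith
      then show "?G \<mu> \<le> ?G \<nu>"
        unfolding weighted_energy_eq[OF \<mu>] weighted_energy_eq[OF \<nu>] by simp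
    qed
    have def: "AE x in \<mu> i. W_defined \<mu> i x" if "i \<in> I" for i
      by (rule nearly_everywhere_imp_AE(1)[OF \<mu> \<mu> that bspec[OF ne that]])
    show ?thesis by (rule goal[OF le eq(1) def])
  next
    assume ae: "\<forall>i \<in> I. AE x in \<mu> i. W_defined \<mu> i x \<and>
        ereal (a i) * W \<mu> i x \<le> ereal (\<eta> i * g i x)"
      and m: "?\<eta> + field_pairing I f1 f2 \<mu> \<le> ?m"
    have bound: "?w i \<le> \<eta> i" if "i \<in> I" for i
      by (rule potential_mass_bound(2)[OF \<mu> \<mu> that]) (use bspec[OF ae that] in simp)
    \<comment> \<open>The minimum is at most the weighted energy of \<open>\<mu>\<close>, as \<open>\<mu>\<close> is admissible.\<close>
    have "?\<eta> + ereal ?f \<le> ereal (?e + 2 * ?f)"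
      using order_trans[OF m min_le[OF \<mu>]] unfolding field_pairing_eq(2)[OF \<mu>] weighted_energy_eq[OF \<mu>] .
    then have "?\<eta> \<le> ereal (\<integral>i. ?w i \<partial>count_space I)"
      unfolding w(2) by (cases ?\<eta>) simp_all
    note eq = ext_sum_eq_imp_eq'[OF w(1) bound this]
    have "?\<eta> + ereal ?f = ereal (?e + 2 * ?f)"
      using eq(2) w(2) by simp
    then have le: "?G \<mu> \<le> ?m"
      using m unfolding field_pairing_eq(2)[OF \<mu>] weighted_energy_eq[OF \<mu>] by simp
    have def: "AE x in \<mu> i. W_defined \<mu> i x" if "i \<in> I" for i
      using bspec[OF ae that] by eventually_elim (rule conjunct1)
    show ?thesis by (rule goal[OF le eq(1) def])
  qed
qed

end
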